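(* Let $L\colon\mathbb R^n\times\mathbb R^n\to\mathbb R_+$ and $\varphi\colon\mathbb R^n\to\mathbb R_+\cup\{+\infty\}$ satisfy the standing assumptions listed in the context, let $V$ be the value function, and assume that $L$ is continuous. Then: (i) $V$ is lower semicontinuous on $\mathbb R_+\times\mathbb R^n$ and satisfies $$\forall (t,x)\in\mathrm{dom}(V),\ t>0,\ \exists u\in\mathbb R^n:\quad D_\uparrow V(t,x)(-1,u)\le -L(x,u), \tag{a}$$ $$\forall (t,x)\in\mathrm{dom}(V),\ \forall u\in\mathbb R^n:\quad D_\downarrow V(t,x)(1,-u)\le L(x,u). \tag{b}$$ (ii) Let $W\colon\mathbb R_+\times\mathbb R^n\to\mathbb R_+\cup\{+\infty\}$ be a lower semicontinuous function with $W(0,\cdot)=\varphi$. If for every $(t,x)\in\mathrm{dom}(W)$ with $t>0$ there exists $u\in\mathbb R^n$ such that $D_\uparrow W(t,x)(-1,u)\le -L(x,u)$, then $W\ge V$ on $\mathbb R_+\times\mathbb R^n$. If for every $(t,x)\in\mathrm{dom}(W)$ and every $u\in\mathbb R^n$ one has $D_\downarrow W(t,x)(1,-u)\le L(x,u)$, then $W\le V$ on $\mathbb R_+\times\mathbb R^n$. (iii) Therefore $V$ is the unique non-negative lower semicontinuous function (from $\mathbb R_+\times\mathbb R^n$ to $\mathbb R_+\cup\{+\infty\}$) which satisfies the initial condition $V(0,\cdot)=\varphi$ and conditions (a) and (b).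
   Context: Notation: $\mathbb R_+=[0,+\infty)$. Standing assumptions: $L\colon\mathbb R^n\times\mathbb R^n\to\mathbb R_+$ is lower semicontinuous and $L(x,\cdot)$ is convex for every $x$; there is a convex function $\Theta\colon\mathbb R^n\to\mathbb R_+$ with $\lim_{|u|\to\infty}\Theta(u)/|u|=+\infty$ and $L(x,u)\ge\Theta(u)$ for all $(x,u)$; $\varphi\colon\mathbb R^n\to\mathbb R_+\cup\{+\infty\}$ is lower semicontinuous and not identically $+\infty$. Value function: for $(t,x)\in\mathbb R_+\times\mathbb R^n$, $$V(t,x)=\inf\Big\{\int_0^t L(y(s),y'(s))\,ds+\varphi(y(t)) : y\in W^{1,1}(0,t;\mathbb R^n),\ y(0)=x\Big\},$$ so $V(0,x)=\varphi(x)$. For an extended-real-valued function $W$ of $(t,x)$, $\mathrm{dom}(W)$ is the set where $W<+\infty$. For $(t,x)\in\mathrm{dom}(W)$ and $(\alpha,u)\in\mathbb R\times\mathbb R^n$ (the limits being taken over $h\to0+$ and $(\alpha',v)\to(\alpha,u)$), $$D_\uparrow W(t,x)(\alpha,u)=\liminf_{h\to0+,\,(\alpha',v)\to(\alpha,u)}\frac{W(t+h\alpha',x+hv)-W(t,x)}{h},$$ $$D_\downarrow W(t,x)(\alpha,u)=\limsup_{h\to0+,\,(\alpha',v)\to(\alpha,u)}\frac{W(t+h\alpha',x+hv)-W(t,x)}{h}.$$ *)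

theory Defs
  imports "HOL-Analysis.Analysis"
begin

definition lsc_on :: "'a::topological_space set \<Rightarrow> ('a \<Rightarrow> 'b::linorder) \<Rightarrow> bool" where
  "lsc_on S f \<longleftrightarrow> (\<forall>p\<in>S. \<forall>c<f p. eventually (\<lambda>q. c < f q) (at p within S))"

(* C^1 functions with compact support in the open interval (a,b), and their derivatives.
   In dimension one these are the usual test functions for W^{1,1}(a,b); smooth ones
   give the same space. *)
definition test_fun :: "real \<Rightarrow> real \<Rightarrow> (real \<Rightarrow> real) \<Rightarrow> (real \<Rightarrow> real) \<Rightarrow> bool" where
  "test_fun a b \<psi> \<psi>' \<longleftrightarrow>
     (\<forall>s. (\<psi> has_real_derivative \<psi>' s) (at s)) \<and> continuous_on UNIV \<psi>' \<and>
     (\<exists>K. compact K \<and> K \<subseteq> {a<..<b} \<and> (\<forall>s. s \<notin> K \<longrightarrow> \<psi> s = 0))"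

(* y belongs to W^{1,1}(a,b;E), with g as (a version of) its weak derivative y', and y is
   the continuous representative on [a,b]; it is the one for which y(a), y(b) make sense.
   Every L^1 class has a Borel representative, so lborel loses nothing here. *)
definition W11 :: "real \<Rightarrow> real \<Rightarrow> (real \<Rightarrow> 'a::euclidean_space) \<Rightarrow> (real \<Rightarrow> 'a) \<Rightarrow> bool" where
  "W11 a b y g \<longleftrightarrow>
     continuous_on {a..b} y \<and>
     set_integrable lborel {a<..<b} y \<and> set_integrable lborel {a<..<b} g \<and>
     (\<forall>\<psi> \<psi>'. test_fun a b \<psi> \<psi>' \<longrightarrow>
        (LINT s:{a<..<b}|lborel. \<psi>' s *\<^sub>R y s) = - (LINT s:{a<..<b}|lborel. \<psi> s *\<^sub>R g s))"

(* The weak derivative is unique almost everywhere, so ranging over all its versions g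
   does not change the infimum. For t = 0 the interval degenerates and the cost is phi(x).
   Only times t >= 0 are meaningful. *)
definition value_fun ::
  "('a::euclidean_space \<Rightarrow> 'a \<Rightarrow> real) \<Rightarrow> ('a \<Rightarrow> ereal) \<Rightarrow> real \<times> 'a \<Rightarrow> ereal" where
  "value_fun L \<phi> = (\<lambda>(t, x).
     INF (y, g) \<in> {(y, g). W11 0 t y g \<and> y 0 = x}.
       enn2ereal (\<integral>\<^sup>+s\<in>{0<..<t}. ennreal (L (y s) (g s)) \<partial>lborel) + \<phi> (y t))"

(* With p = (t,x) and d = (alpha,u) these are the lower and upper derivatives
   D_up W(t,x)(alpha,u) and D_down W(t,x)(alpha,u). Both liminf and limsup are over
   h -> 0+ and d' -> d, where d' = d is allowed. *)
definition D_up :: "('a::real_normed_vector \<Rightarrow> ereal) \<Rightarrow> 'a \<Rightarrow> 'a \<Rightarrow> ereal" where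
  "D_up W p d = Liminf (at_right 0 \<times>\<^sub>F nhds d) (\<lambda>(h, d'). (W (p + h *\<^sub>R d') - W p) / ereal h)"

definition D_down :: "('a::real_normed_vector \<Rightarrow> ereal) \<Rightarrow> 'a \<Rightarrow> 'a \<Rightarrow> ereal" where
  "D_down W p d = Limsup (at_right 0 \<times>\<^sub>F nhds d) (\<lambda>(h, d'). (W (p + h *\<^sub>R d') - W p) / ereal h)"

(* A function on [0,oo) x E is a total function whose values at negative times are ignored.
   In the conditions below the difference quotients eventually stay at times >= 0,
   because the time direction is -1 only where t > 0. *)
definition cond_a :: "('a::euclidean_space \<Rightarrow> 'a \<Rightarrow> real) \<Rightarrow> (real \<times> 'a \<Rightarrow> ereal) \<Rightarrow> bool" where
  "cond_a L W \<longleftrightarrow>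
     (\<forall>t x. t > 0 \<and> W (t, x) < \<infinity> \<longrightarrow> (\<exists>u. D_up W (t, x) (-1, u) \<le> - ereal (L x u)))"

definition cond_b :: "('a::euclidean_space \<Rightarrow> 'a \<Rightarrow> real) \<Rightarrow> (real \<times> 'a \<Rightarrow> ereal) \<Rightarrow> bool" where
  "cond_b L W \<longleftrightarrow>
     (\<forall>t x. t \<ge> 0 \<and> W (t, x) < \<infinity> \<longrightarrow> (\<forall>u. D_down W (t, x) (1, -u) \<le> ereal (L x u)))"

definition nonneg_lsc_with_init :: "('a::euclidean_space \<Rightarrow> ereal) \<Rightarrow> (real \<times> 'a \<Rightarrow> ereal) \<Rightarrow> bool" where
  "nonneg_lsc_with_init \<phi> W \<longleftrightarrow>
     (\<forall>t\<ge>0. \<forall>x. 0 \<le> W (t, x)) \<and> lsc_on ({0..} \<times> UNIV) W \<and> (\<forall>x. W (0, x) = \<phi> x)"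

end

theory Submission
  imports Defs
begin

text \<open>
  Everything is reduced to polygonal curves. Given a curve of finite cost, replace it on a fine uniform
  partition by the polygon through the same nodes. On the pieces of moderate average speed, convexity and
  continuity of \<open>L\<close> show that the cost increases only by an arbitrarily small amount. The pieces of
  very large average speed are traversed at unit speed instead; by superlinearity this saves much more than
  it costs, and the extra time is regained by accelerating slightly on the (many) slow pieces. Hence the
  value function is an infimum over polygonal curves, with speeds bounded locally uniformly.

  With bounded speeds, a curve can be moved to nearby end points and durations at small extra cost, by an
  affine change of the curve and of time. This gives lower semicontinuity without any weak compactness, and
  condition (a) by splitting near-optimal polygons at a small time. A function satisfying (a) is compared
  with the value function by following the descent directions until the last reachable time, which is attained
  by the closedness above and must be zero. A function satisfying (b) is compared along the segments of a
  polygon, read backwards from its end point.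
\<close>

section \<open>The fundamental theorem of calculus for weak derivatives\<close>

text \<open>The obstacle is that continuity of \<open>L\<close> compares \<open>L x' u\<close> with
  \<open>L x u\<close> uniformly only on compact sets of positions and velocities. On fast pieces
  there is thus no estimate for replacing a curve by its chord or for translating it, and a speed
  bound has to precede every perturbation or limit. Retiming provides one because unit speed costs
  at most \<open>Q\<close> per unit of length, while a fast piece costs at least
  \<open>A / 2\<close> per unit of length, where \<open>A\<close> is chosen after \<open>Q\<close>.
  The bound depends only on bounds for the cost, the duration (from both sides) and the starting
  point, so it can be fixed before a near-optimal sequence is chosen. Convexity acts through affine
  minorants of \<open>L\<close> that survive small changes of position. The linear part of such a
  minorant, integrated along a curve, depends on the displacement alone; this plays the role of
  Jensen's inequality for the discretisation and of weak lower semicontinuity for condition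
  (a).\<close>

definition bump :: "real \<Rightarrow> real" where
  "bump r = 4 * (max 0 r - 2 * max 0 (r - 1/2) + max 0 (r - 1))"

text \<open>An antiderivative of the hat function \<open>bump\<close>, which is supported on
  \<open>[0, 1]\<close> and has mass 1. Test functions are only required to be C^1, so a quadratic
  spline suffices; truncated powers give it by one formula.\<close>

definition smoothstep :: "real \<Rightarrow> real" where
  "smoothstep r = 2 * ((max 0 r)\<^sup>2 - 2 * (max 0 (r - 1/2))\<^sup>2 + (max 0 (r - 1))\<^sup>2)"

lemma pospart_square_deriv: "((\<lambda>r::real. (max 0 r)\<^sup>2) has_real_derivative 2 * max 0 r) (at r)"
proof (cases r "0 :: real" rule: linorder_cases)
  case less
  have "((\<lambda>r::real. 0) has_real_derivative 2 * max 0 r) (at r)" using less by simp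
  moreover have "\<forall>\<^sub>F s in nhds r. (max 0 s)\<^sup>2 = 0"
    using eventually_nhds_in_open[of "{..<0}" r] less by (auto elim!: eventually_mono)
  ultimately show ?thesis
    using DERIV_cong_ev[where f="\<lambda>r. (max 0 r)\<^sup>2" and g="\<lambda>r. 0" and x=r, OF refl _ refl] by simp
next
  case equal
  have "((\<lambda>h::real. (max 0 h)\<^sup>2 / h) \<longlongrightarrow> 0) (at 0)"
  proof (rule Lim_null_comparison)
    show "\<forall>\<^sub>F h in at 0. norm ((max 0 h)\<^sup>2 / h) \<le> \<bar>h::real\<bar>"
      by (intro always_eventually) (auto simp: max_def power2_eq_square)
  qed (intro tendsto_eq_intros; simp)
  then show ?thesis using equal by (simp add: DERIV_def)
next
  case greater
  have "((\<lambda>r::real. r\<^sup>2) has_real_derivative 2 * max 0 r) (at r)"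
    using greater by (auto intro!: derivative_eq_intros)
  moreover have "\<forall>\<^sub>F s in nhds r. (max 0 s)\<^sup>2 = s\<^sup>2"
    using eventually_nhds_in_open[of "{0<..}" r] greater by (auto elim!: eventually_mono)
  ultimately show ?thesis
    using DERIV_cong_ev[where f="\<lambda>r. (max 0 r)\<^sup>2" and g="\<lambda>r. r\<^sup>2" and x=r, OF refl _ refl] by simp
qed

lemma smoothstep_deriv: "(smoothstep has_real_derivative bump r) (at r)"
proof -
  have *: "((\<lambda>r::real. (max 0 (r - c))\<^sup>2) has_real_derivative 2 * max 0 (r - c)) (at r)" for c
    using DERIV_chain'[OF DERIV_diff[OF DERIV_ident DERIV_const[of c]] pospart_square_deriv, of r UNIV] by simp
  show ?thesis
    unfolding smoothstep_def[abs_def] bump_def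
    by (rule DERIV_cong[OF DERIV_cmult[OF DERIV_add[OF DERIV_diff[OF pospart_square_deriv DERIV_cmult[OF *]] *]]]) simp
qed

lemma continuous_on_bump: "continuous_on S (\<lambda>s. bump (f s))" if "continuous_on S f"
  unfolding bump_def using that by (intro continuous_intros)

lemma bump_nonneg: "0 \<le> bump r" and bump_zero: "r \<notin> {0<..<1} \<Longrightarrow> bump r = 0"
  by (auto simp: bump_def max_def)

lemma smoothstep_ge_1: "1 \<le> r \<Longrightarrow> smoothstep r = 1" and smoothstep_le_0: "r \<le> 0 \<Longrightarrow> smoothstep r = 0"
  by (simp_all add: smoothstep_def max_absorb1 max_absorb2 power2_diff power_one_over)

lemma smoothstep_bounds: "0 \<le> smoothstep r" "smoothstep r \<le> 1"
proof -
  have "mono smoothstep"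
  proof (rule monoI)
    fix a b :: real assume "a \<le> b"
    then show "smoothstep a \<le> smoothstep b"
    proof (rule DERIV_nonneg_imp_nondecreasing)
      show "\<exists>y. (smoothstep has_real_derivative y) (at x) \<and> 0 \<le> y" for x
        using smoothstep_deriv[of x] bump_nonneg[of x] by (intro exI conjI)
    qed
  qed
  then have "smoothstep (min r 0) \<le> smoothstep r" "smoothstep r \<le> smoothstep (max r 1)"
    by (simp_all add: monoD[OF \<open>mono smoothstep\<close>])
  then show "0 \<le> smoothstep r" "smoothstep r \<le> 1" by (simp_all add: smoothstep_ge_1 smoothstep_le_0)
qed

text \<open>A plateau with ramps on \<open>[a, a + e]\<close> and \<open>[b, b + e]\<close>. Both
  ramps lie to the right of their base points, so for small \<open>e\<close> the support stays in
  the open interval, and the pointwise limit is exactly the indicator of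
  \<open>{a<..b}\<close>.\<close>

lemma test_fun_smoothstep:
  assumes "0 < a" "a \<le> b" "0 < e" "b + e < t"
  shows "test_fun 0 t (\<lambda>s. smoothstep ((s - a) / e) - smoothstep ((s - b) / e))
      (\<lambda>s. bump ((s - a) / e) / e - bump ((s - b) / e) / e)"
  unfolding test_fun_def
proof (intro conjI allI exI[of _ "{a..b + e}"] impI)
  fix s
  have *: "((\<lambda>s. smoothstep ((s - c) / e)) has_real_derivative bump ((s - c) / e) / e) (at s)" for c
    using DERIV_chain'[OF DERIV_cdivide[OF DERIV_diff[OF DERIV_ident DERIV_const]] smoothstep_deriv] by simp
  show "((\<lambda>s. smoothstep ((s - a) / e) - smoothstep ((s - b) / e)) has_real_derivative
      bump ((s - a) / e) / e - bump ((s - b) / e) / e) (at s)"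
    by (intro DERIV_diff *)
  show "continuous_on UNIV (\<lambda>s. bump ((s - a) / e) / e - bump ((s - b) / e) / e)"
    using assms by (intro continuous_intros continuous_on_bump) auto
  show "smoothstep ((s - a) / e) - smoothstep ((s - b) / e) = 0" if "s \<notin> {a..b + e}"
    using assms that by (cases "s < a") (auto simp: smoothstep_ge_1 smoothstep_le_0 field_simps)
qed (use assms in auto)

lemma integral_bump:
  assumes "0 < e"
  shows "((\<lambda>s. bump ((s - a) / e) / e) has_integral 1) {a..a + e}"
proof -
  have *: "((\<lambda>s. smoothstep ((s - a) / e)) has_real_derivative bump ((s - a) / e) / e) (at s)" for s
    using DERIV_chain'[OF DERIV_cdivide[OF DERIV_diff[OF DERIV_ident DERIV_const]] smoothstep_deriv] by simp
  have "((\<lambda>s. bump ((s - a) / e) / e) has_integral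
      (smoothstep ((a + e - a) / e) - smoothstep ((a - a) / e))) {a..a + e}"
    using assms by (intro fundamental_theorem_of_calculus)
      (auto intro!: has_vector_derivative_at_within[OF *[THEN has_real_derivative_iff_has_vector_derivative[THEN iffD1]]])
  then show ?thesis using assms by (simp add: smoothstep_ge_1 smoothstep_le_0)
qed

text \<open>The scaled bumps are a one-sided approximate identity: mass one and support in
  \<open>[a, a + e]\<close> reduce the claim to continuity of \<open>y\<close> at \<open>a\<close>
  from the right. This recovers point values of \<open>y\<close> from the weak formulation.\<close>

lemma bump_average_tendsto:
  fixes y :: "real \<Rightarrow> 'a::euclidean_space"
  assumes y: "continuous_on {0..t} y" and a: "0 \<le> a" "a < t"
  shows "((\<lambda>e. LINT s:{0<..<t}|lborel. (bump ((s - a) / e) / e) *\<^sub>R y s) \<longlongrightarrow> y a) (at_right 0)"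
proof (rule tendstoI)
  fix \<epsilon> :: real assume "\<epsilon> > 0"
  obtain d where d: "d > 0" "\<And>s. s \<in> {0..t} \<Longrightarrow> dist s a < d \<Longrightarrow> dist (y s) (y a) < \<epsilon> / 2"
  proof -
    have "a \<in> {0..t}" "\<epsilon> / 2 > 0" using a \<open>\<epsilon> > 0\<close> by auto
    with y show ?thesis unfolding continuous_on_iff using that by blast
  qed
  have "dist (LINT s:{0<..<t}|lborel. (bump ((s - a) / e) / e) *\<^sub>R y s) (y a) < \<epsilon>"
    if e: "0 < e" "e < min d (t - a)" for e
  proof -
    let ?\<chi> = "\<lambda>s. bump ((s - a) / e) / e"
    have sub: "{a..a+e} \<subseteq> {0..t}" using a e by auto
    have cont: "continuous_on {a..a + e} (\<lambda>s. ?\<chi> s *\<^sub>R y s)"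
      using e by (intro continuous_intros continuous_on_bump continuous_on_subset[OF y sub]) auto
    have z: "bump ((s - a) / e) = 0" if "s \<notin> {a<..<a + e}" for s
    proof -
      have "(s - a) / e \<le> 0 \<or> 1 \<le> (s - a) / e" using that e by (auto simp: field_simps not_less)
      then show ?thesis by (auto intro: bump_zero)
    qed
    have "(LINT s:{0<..<t}|lborel. ?\<chi> s *\<^sub>R y s) = (LINT s:{a..a+e}|lborel. ?\<chi> s *\<^sub>R y s)"
      unfolding set_lebesgue_integral_def
    proof (rule Bochner_Integration.integral_cong[OF refl])
      fix s
      show "indicator {0<..<t} s *\<^sub>R ?\<chi> s *\<^sub>R y s = indicator {a..a+e} s *\<^sub>R ?\<chi> s *\<^sub>R y s"
      proof (cases "s \<in> {a<..<a+e}")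
        case True
        then show ?thesis using a e by (auto simp: indicator_def)
      next
        case False
        then show ?thesis using z[OF False] by simp
      qed
    qed
    also have "\<dots> = integral {a..a+e} (\<lambda>s. ?\<chi> s *\<^sub>R y s)"
      by (intro set_borel_integral_eq_integral borel_integrable_atLeastAtMost' cont)
    finally have eq: "(LINT s:{0<..<t}|lborel. ?\<chi> s *\<^sub>R y s) = integral {a..a+e} (\<lambda>s. ?\<chi> s *\<^sub>R y s)" .
    have i1: "((\<lambda>s. ?\<chi> s *\<^sub>R y a) has_integral y a) {a..a+e}"
      using has_integral_scaleR_left[OF integral_bump[OF e(1)], where c="y a"] by simp
    have i2: "((\<lambda>s. ?\<chi> s *\<^sub>R y s) has_integral integral {a..a+e} (\<lambda>s. ?\<chi> s *\<^sub>R y s)) {a..a+e}"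
      using integrable_continuous_real[OF cont] by blast
    have i3: "((\<lambda>s. ?\<chi> s * (\<epsilon> / 2)) has_integral 1 * (\<epsilon> / 2)) {a..a+e}"
      by (intro has_integral_mult_left integral_bump e)
    have "norm (integral {a..a+e} (\<lambda>s. ?\<chi> s *\<^sub>R y s - ?\<chi> s *\<^sub>R y a)) \<le> integral {a..a+e} (\<lambda>s. ?\<chi> s * (\<epsilon> / 2))"
    proof (rule Henstock_Kurzweil_Integration.integral_norm_bound_integral)
      show "norm (?\<chi> s *\<^sub>R y s - ?\<chi> s *\<^sub>R y a) \<le> ?\<chi> s * (\<epsilon> / 2)" if "s \<in> {a..a+e}" for s
      proof -
        have "norm (y s - y a) \<le> \<epsilon> / 2" using d(2)[of s] that sub e by (auto simp: dist_norm)
        moreover have "norm (?\<chi> s *\<^sub>R y s - ?\<chi> s *\<^sub>R y a) = ?\<chi> s * norm (y s - y a)"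
          using e(1) bump_nonneg[of "(s - a) / e"] by (simp flip: scaleR_diff_right)
        moreover have "0 \<le> ?\<chi> s" using e(1) bump_nonneg by simp
        ultimately show ?thesis by (simp only: mult_left_mono)
      qed
    qed (use i1 i2 i3 in \<open>auto intro!: integrable_diff\<close>)
    moreover have "integral {a..a+e} (\<lambda>s. ?\<chi> s *\<^sub>R y s - ?\<chi> s *\<^sub>R y a) = integral {a..a+e} (\<lambda>s. ?\<chi> s *\<^sub>R y s) - y a"
      using i1 i2 by (intro integral_unique has_integral_diff)
    ultimately have "norm (integral {a..a+e} (\<lambda>s. ?\<chi> s *\<^sub>R y s) - y a) \<le> \<epsilon> / 2"
      using integral_unique[OF i3] by (simp only: mult_1_left)
    then show ?thesis using eq \<open>\<epsilon> > 0\<close> by (simp add: dist_norm)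
  qed
  then show "\<forall>\<^sub>F e in at_right 0. dist (LINT s:{0<..<t}|lborel. (bump ((s - a) / e) / e) *\<^sub>R y s) (y a) < \<epsilon>"
    using d a by (auto simp: eventually_at_right_field intro!: exI[of _ "min d (t - a)"])
qed


text \<open>Testing with the plateaus turns the left side of the weak formulation into a difference
  of bump averages of \<open>y\<close>, and the right side into integrals of \<open>g\<close>
  against weights bounded by 1, to which dominated convergence applies.\<close>

lemma W11_diff_eq_integral:
  fixes y g :: "real \<Rightarrow> 'a::euclidean_space"
  assumes W: "W11 0 t y g" and ab: "0 < a" "a \<le> b" "b < t"
  shows "y b - y a = (LINT s:{a<..b}|lborel. g s)"
proof -
  define \<psi> where "\<psi> e s = smoothstep ((s - a) / e) - smoothstep ((s - b) / e)" for e s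
  let ?F = "at_right (0::real)"
  have y: "continuous_on {0..t} y" and ig: "set_integrable lborel {0<..<t} g"
    and weak: "\<And>\<psi> \<psi>'. test_fun 0 t \<psi> \<psi>' \<Longrightarrow>
        (LINT s:{0<..<t}|lborel. \<psi>' s *\<^sub>R y s) = - (LINT s:{0<..<t}|lborel. \<psi> s *\<^sub>R g s)"
    using W unfolding W11_def by auto
  have cont: "continuous_on {0..t} (\<lambda>s. (bump ((s - c) / e) / e) *\<^sub>R y s)" if "0 < e" for c e
    using that by (intro continuous_intros continuous_on_bump y) auto
  have int: "set_integrable lborel {0<..<t} (\<lambda>s. (bump ((s - c) / e) / e) *\<^sub>R y s)" if "0 < e" for c e
    by (rule set_integrable_subset[OF borel_integrable_atLeastAtMost'[OF cont[OF that]]]) auto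
  have "((\<lambda>e. (LINT s:{0<..<t}|lborel. (bump ((s - a) / e) / e) *\<^sub>R y s) -
      (LINT s:{0<..<t}|lborel. (bump ((s - b) / e) / e) *\<^sub>R y s)) \<longlongrightarrow> y a - y b) ?F"
    using ab by (intro tendsto_diff bump_average_tendsto[OF y]) auto
  moreover have "\<forall>\<^sub>F e in ?F. (LINT s:{0<..<t}|lborel. (bump ((s - a) / e) / e) *\<^sub>R y s) -
      (LINT s:{0<..<t}|lborel. (bump ((s - b) / e) / e) *\<^sub>R y s) = - (LINT s:{0<..<t}|lborel. \<psi> e s *\<^sub>R g s)"
  proof -
    have "(LINT s:{0<..<t}|lborel. (bump ((s - a) / e) / e) *\<^sub>R y s) -
      (LINT s:{0<..<t}|lborel. (bump ((s - b) / e) / e) *\<^sub>R y s) = - (LINT s:{0<..<t}|lborel. \<psi> e s *\<^sub>R g s)"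
      if e: "0 < e" "e < t - b" for e
      using weak[OF test_fun_smoothstep[of a b e t]] ab e int[OF e(1)]
      by (simp add: \<psi>_def scaleR_left_diff_distrib flip: set_integral_diff(2))
    then show ?thesis using ab by (auto simp: eventually_at_right_field intro!: exI[of _ "t - b"])
  qed
  ultimately have lim1: "((\<lambda>e. - (LINT s:{0<..<t}|lborel. \<psi> e s *\<^sub>R g s)) \<longlongrightarrow> y a - y b) ?F"
    by (rule Lim_transform_eventually)
  have lim2: "((\<lambda>e. LINT s:{0<..<t}|lborel. \<psi> e s *\<^sub>R g s) \<longlongrightarrow> (LINT s:{a<..b}|lborel. g s)) ?F"
    unfolding set_lebesgue_integral_def
  proof (rule tendsto_at_right_sequentially[of 0 1])
    fix X :: "nat \<Rightarrow> real"
    assume X: "\<And>n. 0 < X n" "X \<longlonglongrightarrow> 0"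
    show "(\<lambda>n. LINT s|lborel. indicat_real {0<..<t} s *\<^sub>R \<psi> (X n) s *\<^sub>R g s) \<longlonglongrightarrow>
        (LINT s|lborel. indicat_real {a<..b} s *\<^sub>R g s)"
    proof (rule integral_dominated_convergence[where w="\<lambda>s. norm (indicat_real {0<..<t} s *\<^sub>R g s)"])
      have [measurable]: "(\<lambda>s. indicat_real {0<..<t} s *\<^sub>R g s) \<in> borel_measurable borel"
        using ig unfolding set_integrable_def by simp
      have st: "continuous_on UNIV smoothstep"
        by (intro continuous_at_imp_continuous_on ballI DERIV_isCont[OF smoothstep_deriv])
      have "continuous_on UNIV (\<psi> (X n))" for n
        unfolding \<psi>_def[abs_def] using X(1)[of n]
        by (intro continuous_intros continuous_on_compose2[OF st]) auto
      then have [measurable]: "\<psi> (X n) \<in> borel_measurable borel" for n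
        by (rule borel_measurable_continuous_onI)
      have "(\<lambda>s. \<psi> (X n) s *\<^sub>R (indicat_real {0<..<t} s *\<^sub>R g s)) \<in> borel_measurable lborel" for n
        by measurable
      then show "(\<lambda>s. indicat_real {0<..<t} s *\<^sub>R \<psi> (X n) s *\<^sub>R g s) \<in> borel_measurable lborel" for n
        by (simp add: mult.commute)
      have "indicat_real {a<..b} s *\<^sub>R g s = indicat_real {a<..b} s *\<^sub>R (indicat_real {0<..<t} s *\<^sub>R g s)" for s
        using ab by (auto simp: indicator_def)
      then show "(\<lambda>s. indicat_real {a<..b} s *\<^sub>R g s) \<in> borel_measurable lborel"
        by (subst ext[where f="\<lambda>s. indicat_real {a<..b} s *\<^sub>R g s"], assumption) measurable
      show "integrable lborel (\<lambda>s. norm (indicat_real {0<..<t} s *\<^sub>R g s))"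
        using ig unfolding set_integrable_def by (rule integrable_norm)
      have "(\<lambda>n. \<psi> (X n) s) \<longlonglongrightarrow> indicat_real {a<..b} s" for s
      proof -
        have *: "(\<lambda>n. smoothstep ((s - c) / X n)) \<longlonglongrightarrow> indicat_real {c<..} s" for c
        proof (cases "c < s")
          case True
          have "\<forall>\<^sub>F n in sequentially. X n < s - c" using order_tendstoD(2)[OF X(2), of "s - c"] True by simp
          then have "\<forall>\<^sub>F n in sequentially. smoothstep ((s - c) / X n) = indicat_real {c<..} s"
            proof eventually_elim
              case (elim n)
              then have "1 \<le> (s - c) / X n" using X(1)[of n] by simp
              then show ?case using True by (simp add: smoothstep_ge_1)
            qed
          then show ?thesis by (rule tendsto_eventually)
        next
          case False
          then have "smoothstep ((s - c) / X n) = indicat_real {c<..} s" for n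
            using X(1)[of n] by (subst smoothstep_le_0) (auto simp: divide_le_0_iff)
          then show ?thesis by simp
        qed
        have "indicat_real {a<..b} s = indicat_real {a<..} s - indicat_real {b<..} s"
          using ab by (auto simp: indicator_def)
        then show ?thesis unfolding \<psi>_def by (simp add: tendsto_diff *)
      qed
      then have "(\<lambda>n. indicat_real {0<..<t} s *\<^sub>R \<psi> (X n) s *\<^sub>R g s) \<longlonglongrightarrow>
          indicat_real {0<..<t} s *\<^sub>R indicat_real {a<..b} s *\<^sub>R g s" for s
        by (intro tendsto_intros)
      moreover have "indicat_real {0<..<t} s *\<^sub>R indicat_real {a<..b} s *\<^sub>R g s = indicat_real {a<..b} s *\<^sub>R g s" for s
        using ab by (auto simp: indicator_def)
      ultimately show "AE s in lborel. (\<lambda>n. indicat_real {0<..<t} s *\<^sub>R \<psi> (X n) s *\<^sub>R g s) \<longlonglongrightarrow>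
          indicat_real {a<..b} s *\<^sub>R g s" by (intro AE_I2) (simp only:)
      have "\<bar>\<psi> e s\<bar> \<le> 1" for e s
        using smoothstep_bounds[of "(s - a) / e"] smoothstep_bounds[of "(s - b) / e"] unfolding \<psi>_def by linarith
      then show "AE s in lborel. norm (indicat_real {0<..<t} s *\<^sub>R \<psi> (X n) s *\<^sub>R g s) \<le> norm (indicat_real {0<..<t} s *\<^sub>R g s)" for n
        by (intro AE_I2) (simp add: indicator_def mult_left_le_one_le)
    qed
  qed simp
  have "y a - y b = - (LINT s:{a<..b}|lborel. g s)"
    by (rule tendsto_unique[OF _ lim1 tendsto_minus[OF lim2]]) simp
  then show ?thesis by (simp add: algebra_simps)
qed

lemma W11_has_integral:
  fixes y g :: "real \<Rightarrow> 'a::euclidean_space"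
  assumes W: "W11 0 t y g" and ab: "0 \<le> a" "a \<le> b" "b \<le> t"
  shows "(g has_integral (y b - y a)) {a..b}"
proof (cases "a = b")
  case False
  then have "0 < t" using ab by simp
  have y: "continuous_on {0..t} y" and ig: "set_integrable lborel {0<..<t} g"
    using W unfolding W11_def by auto
  have "g integrable_on {0<..<t}" using ig by (rule set_borel_integral_eq_integral)
  then have gi: "g integrable_on {0..t}" by (simp add: integrable_on_open_interval_real)
  then have sub: "g integrable_on {a..b}" if "0 \<le> a" "b \<le> t" for a b
    by (rule integrable_subinterval_real) (use that in auto)
  have "y b - y a = integral {a..b} g" if "0 < a" "a \<le> b" "b < t" for a b
  proof -
    have "set_integrable lborel {a<..b} g" by (rule set_integrable_subset[OF ig]) (use that in auto)
    then have "(LINT s:{a<..b}|lborel. g s) = integral {a<..b} g" by (rule set_borel_integral_eq_integral)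
    also have "\<dots> = integral {a..b} g"
      by (rule integral_spike_set; rule negligible_subset[of "{a}"]) auto
    finally show ?thesis using W11_diff_eq_integral[OF W that] by simp
  qed
  note inner = this
  \<comment> \<open>By the interior formula this difference is constant on the open interval.
    Continuity carries the constant to the end points, where test functions give no direct
    information.\<close>
  define f where "f s = y s - integral {0..s} g" for s
  have cf: "continuous_on {0..t} f"
    unfolding f_def by (intro continuous_intros y indefinite_integral_continuous_1 gi)
  have "f s = f (t / 2)" if "s \<in> {0<..<t}" for s
  proof -
    have "f u = f v" if "0 < u" "u \<le> v" "v < t" for u v
      using inner[OF that] Henstock_Kurzweil_Integration.integral_combine[of 0 u v g] sub[of 0 v] that
      by (simp add: f_def algebra_simps)
    from this[of s "t / 2"] this[of "t / 2" s] show ?thesis using that by (cases "s \<le> t / 2") auto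
  qed
  moreover have cl: "closure {0<..<t} = {0..t}" using closure_greaterThanLessThan[OF \<open>0 < t\<close>] .
  ultimately have "f s = f (t / 2)" if "s \<in> {0..t}" for s
    using that continuous_constant_on_closure[of "{0<..<t}" f "f (t / 2)" s] cf by metis
  from this[of a] this[of b] have "f b = f a" using ab by simp
  then have "y b - y a = integral {a..b} g"
    unfolding f_def Henstock_Kurzweil_Integration.integral_combine[OF ab(1,2) sub[OF order_refl ab(3)], symmetric]
    by (simp add: algebra_simps)
  then show ?thesis using sub[of a b] ab by (simp add: integrable_integral)
qed (use has_integral_refl(2)[of g b] in simp)

section \<open>Piecewise differentiable curves as Sobolev curves\<close>

definition polyline :: "real \<Rightarrow> (real \<Rightarrow> 'a::euclidean_space) \<Rightarrow> (real \<Rightarrow> 'a) \<Rightarrow> bool" where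
  "polyline t y g \<longleftrightarrow> continuous_on {0..t} y \<and> g \<in> borel_measurable borel \<and> (\<exists>M. \<forall>s. norm (g s) \<le> M) \<and>
     (\<exists>S. finite S \<and> (\<forall>s\<in>{0..t} - S. (y has_vector_derivative g s) (at s)))"

lemma bounded_measurable_set_integrable:
  fixes f :: "real \<Rightarrow> 'a::euclidean_space"
  assumes "f \<in> borel_measurable borel" "\<And>s. s \<in> {a<..<b} \<Longrightarrow> norm (f s) \<le> M"
  shows "set_integrable lborel {a<..<b} f"
proof (rule set_integrable_bound)
  show "set_integrable lborel {a<..<b} (\<lambda>s. M)"
    by (intro set_integrable_subset[OF borel_integrable_atLeastAtMost'[of a b]]) auto
  show "set_borel_measurable lborel {a<..<b} f"
    unfolding set_borel_measurable_def using assms(1) by measurable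
  show "AE s in lborel. s \<in> {a<..<b} \<longrightarrow> norm (f s) \<le> norm M"
    using assms(2) by (intro AE_I2) fastforce
qed

text \<open>Integration by parts: the product rule holds off a finite set, and \<open>\<psi>\<close>
  vanishes at both ends. The predicate \<open>polyline\<close> is kept apart from \<open>W11\<close>
  because it passes through concatenation by pointwise checks, without splitting test functions at
  the junction.\<close>

lemma polyline_W11:
  assumes "0 \<le> t" and "polyline t y g"
  shows "W11 0 t y g"
  unfolding W11_def
proof (intro conjI allI impI)
  from assms obtain M S where y: "continuous_on {0..t} y" and g [measurable]: "g \<in> borel_measurable borel"
    and M: "\<And>s. norm (g s) \<le> M" and S: "finite S" "\<And>s. s \<in> {0..t} - S \<Longrightarrow> (y has_vector_derivative g s) (at s)"
    unfolding polyline_def by blast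
  show "continuous_on {0..t} y" by fact
  show "set_integrable lborel {0<..<t} y"
    by (rule set_integrable_subset[OF borel_integrable_atLeastAtMost'[OF y]]) auto
  show "set_integrable lborel {0<..<t} g"
    using M by (rule bounded_measurable_set_integrable[OF g])
  fix \<psi> \<psi>' assume "test_fun 0 t \<psi> \<psi>'"
  then have d: "\<And>s. (\<psi> has_real_derivative \<psi>' s) (at s)" and c': "continuous_on UNIV \<psi>'"
    and z: "\<psi> 0 = 0" "\<psi> t = 0"
    unfolding test_fun_def by (blast, blast, (metis greaterThanLessThan_iff less_irrefl subset_iff)+)
  have c: "continuous_on UNIV \<psi>"
    by (intro continuous_at_imp_continuous_on ballI DERIV_isCont[OF d])
  have "((\<lambda>s. \<psi>' s *\<^sub>R y s + \<psi> s *\<^sub>R g s) has_integral (\<psi> t *\<^sub>R y t - \<psi> 0 *\<^sub>R y 0)) {0..t}"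
  proof (rule fundamental_theorem_of_calculus_strong[OF S(1) assms(1)])
    show "((\<lambda>s. \<psi> s *\<^sub>R y s) has_vector_derivative \<psi>' s *\<^sub>R y s + \<psi> s *\<^sub>R g s) (at s)" if "s \<in> {0..t} - S" for s
      using has_vector_derivative_scaleR[OF d S(2)[OF that]] by (simp add: add.commute)
    show "continuous_on {0..t} (\<lambda>s. \<psi> s *\<^sub>R y s)"
      by (intro continuous_intros y continuous_on_subset[OF c]) auto
  qed
  then have sum0: "integral {0..t} (\<lambda>s. \<psi>' s *\<^sub>R y s + \<psi> s *\<^sub>R g s) = 0"
    using z by (simp add: integral_unique)
  have i1: "set_integrable lborel {0<..<t} (\<lambda>s. \<psi>' s *\<^sub>R y s)"
    by (rule set_integrable_subset[OF borel_integrable_atLeastAtMost'])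
       (auto intro!: continuous_intros y continuous_on_subset[OF c'])
  obtain B where B: "\<And>s. s \<in> {0..t} \<Longrightarrow> norm (\<psi> s) \<le> B"
    using compact_imp_bounded[OF compact_continuous_image[OF continuous_on_subset[OF c], of "{0..t}"]]
    by (force simp: bounded_iff)
  have [measurable]: "\<psi> \<in> borel_measurable borel" by (rule borel_measurable_continuous_onI[OF c])
  have i2: "set_integrable lborel {0<..<t} (\<lambda>s. \<psi> s *\<^sub>R g s)"
  proof (rule bounded_measurable_set_integrable)
    show "norm (\<psi> s *\<^sub>R g s) \<le> B * M" if "s \<in> {0<..<t}" for s
      using B[of s] M[of s] that by (auto intro!: mult_mono order_trans[OF norm_ge_zero B])
  qed measurable
  note hk1 = set_borel_integral_eq_integral[OF i1] and hk2 = set_borel_integral_eq_integral[OF i2]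
  have "(\<lambda>s. \<psi>' s *\<^sub>R y s) integrable_on {0..t}" "(\<lambda>s. \<psi> s *\<^sub>R g s) integrable_on {0..t}"
    using hk1(1) hk2(1) by (simp_all add: integrable_on_open_interval_real)
  from Henstock_Kurzweil_Integration.integral_add[OF this] sum0
  have "integral {0..t} (\<lambda>s. \<psi>' s *\<^sub>R y s) = - integral {0..t} (\<lambda>s. \<psi> s *\<^sub>R g s)"
    by (simp add: eq_neg_iff_add_eq_0)
  then show "(LINT s:{0<..<t}|lborel. \<psi>' s *\<^sub>R y s) = - (LINT s:{0<..<t}|lborel. \<psi> s *\<^sub>R g s)"
    using hk1(2) hk2(2) by (simp add: integral_open_interval_real)
qed

section \<open>Lower semicontinuity and directional derivatives along sequences\<close>

lemma lsc_onI_sequentially: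
  fixes f :: "'a::metric_space \<Rightarrow> 'b::linorder"
  assumes "\<And>p q c. p \<in> S \<Longrightarrow> (\<And>n. q n \<in> S) \<Longrightarrow> q \<longlonglongrightarrow> p \<Longrightarrow> (\<And>n. f (q n) \<le> c) \<Longrightarrow> f p \<le> c"
  shows "lsc_on S f"
  unfolding lsc_on_def
proof (intro ballI allI impI, rule ccontr)
  fix p c assume p: "p \<in> S" "c < f p" and n: "\<not> (\<forall>\<^sub>F q in at p within S. c < f q)"
  have "\<exists>q\<in>S. dist q p < inverse (Suc n) \<and> f q \<le> c" for n
  proof -
    have "0 < inverse (real (Suc n))" by simp
    with n show ?thesis unfolding eventually_at not_ex by (meson not_le)
  qed
  then obtain q where q: "\<And>n. q n \<in> S" "\<And>n. dist (q n) p < inverse (Suc n)" "\<And>n. f (q n) \<le> c" by metis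
  have "(\<lambda>n. dist (q n) p) \<longlonglongrightarrow> 0"
    by (rule tendsto_sandwich[OF _ _ tendsto_const LIMSEQ_inverse_real_of_nat])
       (use q(2) in \<open>auto intro!: always_eventually less_imp_le\<close>)
  then have "q \<longlonglongrightarrow> p" by (rule tendsto_dist_iff[THEN iffD2])
  then have "f p \<le> c" using assms[of p q c, OF p(1) q(1) _ q(3)] by blast
  then show False using p(2) by simp
qed

lemma lsc_on_sequentially_le:
  fixes f :: "'a::topological_space \<Rightarrow> ereal"
  assumes "lsc_on S f" "p \<in> S" "\<And>n. q n \<in> S" "q \<longlonglongrightarrow> p" "\<And>n. f (q n) \<le> ereal (a n)" "a \<longlonglongrightarrow> b"
  shows "f p \<le> ereal b"
proof (rule ccontr)
  assume "\<not> ?thesis"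
  then obtain c where c: "ereal b < ereal c" "ereal c < f p"
    using ereal_dense2[of "ereal b" "f p"] by (auto simp: not_le)
  \<comment> \<open>\<open>lsc_on\<close> speaks of a punctured neighbourhood. At \<open>p\<close>
    itself \<open>c < f p\<close> fills the gap, so the sequence may hit \<open>p\<close>.\<close>
  have "\<forall>\<^sub>F q in nhds p. q \<in> S \<longrightarrow> ereal c < f q"
    using assms(1,2) c(2) unfolding lsc_on_def eventually_at_filter by (auto elim!: eventually_mono)
  then have "\<forall>\<^sub>F n in sequentially. q n \<in> S \<longrightarrow> ereal c < f (q n)"
    by (rule eventually_compose_filterlim[OF _ assms(4)])
  moreover have "\<forall>\<^sub>F n in sequentially. a n < c"
    using order_tendstoD(2)[OF assms(6), of c] c(1) by simp
  ultimately have "\<forall>\<^sub>F n in sequentially. False"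
  proof eventually_elim
    case (elim n)
    then have "ereal c < ereal (a n)" using assms(3,5) by (meson less_le_trans)
    then show False using elim(2) by simp
  qed
  then show False by simp
qed

lemma D_up_le_sequentially:
  assumes "\<And>n. 0 < h n" "h \<longlonglongrightarrow> 0" "d \<longlonglongrightarrow> d0"
    and "\<And>n. (W (p + h n *\<^sub>R d n) - W p) / ereal (h n) \<le> ereal (q n)" "q \<longlonglongrightarrow> q0"
  shows "D_up W p d0 \<le> ereal q0"
proof (rule ccontr)
  assume "\<not> ?thesis"
  then obtain c where c: "ereal q0 < ereal c" "ereal c < D_up W p d0"
    using ereal_dense2[of "ereal q0" "D_up W p d0"] by (auto simp: not_le)
  have "LIM n sequentially. (h n, d n) :> at_right 0 \<times>\<^sub>F nhds d0"
    using assms by (intro filterlim_Pair tendsto_imp_filterlim_at_right always_eventually) auto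
  moreover have "\<forall>\<^sub>F (h, d') in at_right 0 \<times>\<^sub>F nhds d0. ereal c < (W (p + h *\<^sub>R d') - W p) / ereal h"
    using less_LiminfD[OF c(2)[unfolded D_up_def]] by (simp add: case_prod_beta')
  ultimately have "\<forall>\<^sub>F n in sequentially. ereal c < (W (p + h n *\<^sub>R d n) - W p) / ereal (h n)"
    by (auto simp: filterlim_iff)
  moreover have "\<forall>\<^sub>F n in sequentially. q n < c"
    using order_tendstoD(2)[OF assms(5), of c] c(1) by simp
  ultimately have "\<forall>\<^sub>F n in sequentially. False"
  proof eventually_elim
    case (elim n)
    then have "ereal c < ereal (q n)" using assms(4) by (meson less_le_trans)
    then show False using elim(2) by simp
  qed
  then show False by simp
qed

section \<open>Superlinear convex Lagrangians\<close>

text \<open>Separate the graph point over \<open>u\<close> from the strict epigraph. A vertical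
  hyperplane is impossible because \<open>f\<close> is finite everywhere, in particular at
  \<open>u - w\<close> for the horizontal part \<open>w\<close> of the normal.\<close>

lemma convex_subgradient:
  fixes f :: "'a::euclidean_space \<Rightarrow> real"
  assumes "convex_on UNIV f"
  obtains p where "\<And>v. f u + p \<bullet> (v - u) \<le> f v"
proof -
  let ?S = "{(u, f u)}" and ?T = "{(v, r). f v < r}"
  have "convex ?T"
  proof (rule convexI, clarsimp)
    fix v r v' r' and a b :: real
    assume h: "f v < r" "f v' < r'" "0 \<le> a" "0 \<le> b" "a + b = 1"
    have "f (a *\<^sub>R v + b *\<^sub>R v') \<le> a * f v + b * f v'"
      using assms h by (auto simp: convex_on_def)
    also have "\<dots> < a * r + b * r'"
    proof (cases "a = 0")
      case False
      then have "a * f v < a * r" using h by simp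
      moreover have "b * f v' \<le> b * r'" using h by (simp add: mult_left_mono)
      ultimately show ?thesis by simp
    qed (use h in auto)
    finally show "f (a *\<^sub>R v + b *\<^sub>R v') < a * r + b * r'" .
  qed
  moreover have "(u, f u + 1) \<in> ?T" by simp
  then have "?T \<noteq> {}" by blast
  ultimately obtain q b where q: "q \<noteq> 0" "\<forall>z\<in>?S. q \<bullet> z \<le> b" "\<forall>z\<in>?T. b \<le> q \<bullet> z"
    using separating_hyperplane_sets[of ?S ?T] by fastforce
  obtain w \<beta> where w: "q = (w, \<beta>)" by fastforce
  have sep: "w \<bullet> u + \<beta> * f u \<le> w \<bullet> v + \<beta> * r" if "f v < r" for v r
  proof -
    have "(v, r) \<in> ?T" using that by simp
    then have "b \<le> q \<bullet> (v, r)" using q(3) by blast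
    with q(2) show ?thesis by (simp add: w inner_prod_def)
  qed
  have "\<beta> > 0"
  proof (rule ccontr)
    assume "\<not> \<beta> > 0"
    moreover have "0 \<le> \<beta>" using sep[of u "f u + 1"] by (simp add: algebra_simps)
    ultimately have "\<beta> = 0" by simp
    then have "w \<noteq> 0" using q(1) w by (auto simp: zero_prod_def)
    have "w \<bullet> w \<le> 0"
      using sep[of "u - w" "f (u - w) + 1"] \<open>\<beta> = 0\<close> by (simp add: inner_diff_right)
    with \<open>w \<noteq> 0\<close> show False using inner_gt_zero_iff[of w] by linarith
  qed
  have sep': "w \<bullet> u + \<beta> * f u \<le> w \<bullet> v + \<beta> * f v" for v
  proof (rule field_le_epsilon)
    fix e :: real assume "0 < e"
    then have "f v < f v + e / \<beta>" using \<open>\<beta> > 0\<close> by simp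
    from sep[OF this] show "w \<bullet> u + \<beta> * f u \<le> w \<bullet> v + \<beta> * f v + e"
      using \<open>\<beta> > 0\<close> by (simp add: algebra_simps)
  qed
  show ?thesis
  proof
    fix v
    have "\<beta> * (f u + ((- 1 / \<beta>) *\<^sub>R w) \<bullet> (v - u)) \<le> \<beta> * f v"
      using sep'[of v] \<open>\<beta> > 0\<close> by (simp add: algebra_simps inner_diff_right)
    then show "f u + ((- 1 / \<beta>) *\<^sub>R w) \<bullet> (v - u) \<le> f v"
      using \<open>\<beta> > 0\<close> by simp
  qed
qed

(* The left-hand side is the cost of covering the displacement u in the shorter time 1 - \<theta>. *)
lemma convex_perspective_le:
  fixes f :: "'a::real_vector \<Rightarrow> real"
  assumes "convex_on UNIV f" "0 \<le> \<theta>" "\<theta> \<le> 1 / 2"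
  shows "(1 - \<theta>) * f (u /\<^sub>R (1 - \<theta>)) \<le> (1 - 2 * \<theta>) * f u + \<theta> * f (2 *\<^sub>R u)"
proof -
  let ?s = "\<theta> / (1 - \<theta>)"
  have s: "0 \<le> ?s" "?s \<le> 1" using assms by auto
  have "u /\<^sub>R (1 - \<theta>) = (1 - ?s) *\<^sub>R u + ?s *\<^sub>R (2 *\<^sub>R u)"
  proof -
    have "(1 - ?s) *\<^sub>R u + ?s *\<^sub>R (2 *\<^sub>R u) = (1 + ?s) *\<^sub>R u" by (simp add: scaleR_left_distrib scaleR_left_diff_distrib scaleR_2 scaleR_right_distrib)
    moreover have "1 + ?s = inverse (1 - \<theta>)" using assms by (simp add: field_simps)
    ultimately show ?thesis by simp
  qed
  then have "f (u /\<^sub>R (1 - \<theta>)) \<le> (1 - ?s) * f u + ?s * f (2 *\<^sub>R u)"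
    using convex_onD[OF assms(1), of ?s u "2 *\<^sub>R u"] s by simp
  then have "(1 - \<theta>) * f (u /\<^sub>R (1 - \<theta>)) \<le> (1 - \<theta>) * ((1 - ?s) * f u + ?s * f (2 *\<^sub>R u))"
    using assms by (intro mult_left_mono) auto
  also have "\<dots> = ((1 - \<theta>) - (1 - \<theta>) * ?s) * f u + ((1 - \<theta>) * ?s) * f (2 *\<^sub>R u)"
    by (simp only: ring_distribs mult.assoc mult_1_right left_diff_distrib right_diff_distrib)
  also have "(1 - \<theta>) * ?s = \<theta>" using assms by simp
  also have "(1 - \<theta>) - \<theta> = 1 - 2 * \<theta>" by simp
  finally show ?thesis .
qed

text \<open>Coercivity is stated through minorants of every slope in \<open>norm u\<close>,
  uniformly in \<open>x\<close>. In this form it integrates along a curve and bounds displacement by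
  cost and duration.\<close>

locale superlinear_lagrangian =
  fixes L :: "'a::euclidean_space \<Rightarrow> 'a \<Rightarrow> real"
  assumes L_nonneg: "0 \<le> L x u"
    and L_convex: "convex_on UNIV (L x)"
    and L_cont: "continuous_on UNIV (\<lambda>(x, u). L x u)"
    and L_superlinear: "\<exists>B\<ge>0. \<forall>x u. A * norm u - B \<le> L x u"
begin

lemma L_cont_compose [continuous_intros]:
  "continuous_on S f \<Longrightarrow> continuous_on S g \<Longrightarrow> continuous_on S (\<lambda>s. L (f s) (g s))"
  using continuous_on_compose2[OF L_cont, of S "\<lambda>s. (f s, g s)"] by (auto intro: continuous_intros)

lemma L_measurable [measurable (raw)]:
  "f \<in> borel_measurable M \<Longrightarrow> g \<in> borel_measurable M \<Longrightarrow> (\<lambda>s. L (f s) (g s)) \<in> borel_measurable M"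
  using borel_measurable_continuous_Pair[OF _ _ L_cont[unfolded case_prod_beta'], of f M g] by simp

lemma L_bounded:
  obtains Q where "Q > 0" "\<And>x u. norm x \<le> R \<Longrightarrow> norm u \<le> K \<Longrightarrow> L x u \<le> Q"
proof -
  have "compact ((\<lambda>(x, u). L x u) ` (cball 0 R \<times> cball 0 K))"
    by (intro compact_continuous_image continuous_on_subset[OF L_cont] compact_Times) auto
  then obtain B where B: "\<forall>z\<in>(\<lambda>(x, u). L x u) ` (cball 0 R \<times> cball 0 K). norm z \<le> B"
    using compact_imp_bounded bounded_iff by metis
  have "L x u \<le> max 1 B" if "norm x \<le> R" "norm u \<le> K" for x u
  proof -
    have "norm (L x u) \<le> B"
      using B that by (force simp: mem_cball_0)
    then show ?thesis by simp
  qed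
  then show ?thesis using that[of "max 1 B"] by simp
qed

lemma L_unif_cont:
  assumes "e > 0"
  obtains \<delta> where "\<delta> > 0" "\<And>x u x' u'. norm x \<le> R \<Longrightarrow> norm u \<le> K \<Longrightarrow> norm (x' - x) \<le> \<delta> \<Longrightarrow>
      norm (u' - u) \<le> \<delta> \<Longrightarrow> \<bar>L x' u' - L x u\<bar> \<le> e"
proof -
  let ?C = "cball (0::'a) (R + 1) \<times> cball (0::'a) (K + 1)"
  have "uniformly_continuous_on ?C (\<lambda>(x, u). L x u)"
    by (intro compact_uniformly_continuous continuous_on_subset[OF L_cont] compact_Times) auto
  then obtain d where d: "d > 0"
    "\<And>z z'. z \<in> ?C \<Longrightarrow> z' \<in> ?C \<Longrightarrow> dist z' z < d \<Longrightarrow> dist ((\<lambda>(x, u). L x u) z') ((\<lambda>(x, u). L x u) z) < e"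
    using assms unfolding uniformly_continuous_on_def by metis
  show ?thesis
  proof
    \<comment> \<open>The two components contribute at most \<open>d / 3\<close> each, which keeps
      the product distance below \<open>d\<close>; the cap 1 keeps the displaced pair inside the
      enlarged compact set \<open>?C\<close>.\<close>
    show "min 1 (d / 3) > 0" using d by simp
    fix x u x' u' :: 'a
    assume h: "norm x \<le> R" "norm u \<le> K" "norm (x' - x) \<le> min 1 (d / 3)" "norm (u' - u) \<le> min 1 (d / 3)"
    have "norm x' \<le> norm (x' - x) + norm x" "norm u' \<le> norm (u' - u) + norm u"
      using norm_triangle_sub by (metis add.commute)+
    then have "(x, u) \<in> ?C" "(x', u') \<in> ?C" using h by (auto simp: mem_cball_0)
    moreover have "dist (x', u') (x, u) \<le> dist x' x + dist u' u"
      unfolding dist_prod_def by (simp add: sqrt_sum_squares_le_sum)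
    then have "dist (x', u') (x, u) < d" using h d(1) by (simp add: dist_norm)
    ultimately show "\<bar>L x' u' - L x u\<bar> \<le> e"
      using d(2)[of "(x, u)" "(x', u')"] by (simp add: dist_real_def)
  qed
qed

text \<open>A subgradient inequality at \<open>(x, u)\<close> persists at nearby positions for all
  velocities \<open>v\<close> at once. Up to speed \<open>K2\<close> this is uniform continuity;
  beyond \<open>K2\<close> a minorant of slope \<open>P + 1\<close> overtakes the affine function,
  whose slope is at most \<open>P\<close>.\<close>

lemma L_affine_lower:
  assumes "e > 0"
  obtains \<delta> where "\<delta> > 0"
    "\<And>x u. norm x \<le> R \<Longrightarrow> norm u \<le> K \<Longrightarrow>
       \<exists>p. \<forall>x' v. norm (x' - x) \<le> \<delta> \<longrightarrow> L x u + p \<bullet> (v - u) - e \<le> L x' v"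
proof -
  obtain P where P: "P > 0" "\<And>x u. norm x \<le> R \<Longrightarrow> norm u \<le> K + 1 \<Longrightarrow> L x u \<le> P"
    using L_bounded by blast
  obtain B where B: "B \<ge> 0" "\<And>x u. (P + 1) * norm u - B \<le> L x u"
    using L_superlinear[of "P + 1"] by blast
  \<comment> \<open>Beyond this speed the surplus slope 1 of the coercive minorant outweighs all
    constants in the comparison.\<close>
  define K2 where "K2 = P + P * \<bar>K\<bar> + B"
  obtain \<delta> where \<delta>: "\<delta> > 0" "\<And>x u x' u'. norm x \<le> R \<Longrightarrow> norm u \<le> K2 \<Longrightarrow> norm (x' - x) \<le> \<delta> \<Longrightarrow>
      norm (u' - u) \<le> \<delta> \<Longrightarrow> \<bar>L x' u' - L x u\<bar> \<le> e"
    using L_unif_cont[OF assms] by blast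
  show ?thesis
  proof
    fix x u :: 'a assume x: "norm x \<le> R" and u: "norm u \<le> K"
    obtain p where p: "\<And>v. L x u + p \<bullet> (v - u) \<le> L x v"
      using convex_subgradient[OF L_convex] by blast
    have pP: "norm p \<le> P"
    proof (cases "p = 0")
      case False
      \<comment> \<open>One unit step in the direction of \<open>p\<close> raises the affine
        minorant by \<open>norm p\<close>, while \<open>L\<close> stays below \<open>P\<close>
        there.\<close>
      let ?v = "u + p /\<^sub>R norm p"
      have "norm ?v \<le> K + 1" using norm_triangle_ineq[of u "p /\<^sub>R norm p"] u False by simp
      then have "L x ?v \<le> P" using P x by blast
      moreover have "p \<bullet> (?v - u) = norm p"
        using False by (simp add: dot_square_norm power2_eq_square)
      ultimately show ?thesis using p[of ?v] L_nonneg[of x u] by simp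
    qed (use P in simp)
    have "L x u + p \<bullet> (v - u) - e \<le> L x' v" if x': "norm (x' - x) \<le> \<delta>" for x' v
    proof (cases "norm v \<le> K2")
      case True
      then have "\<bar>L x' v - L x v\<bar> \<le> e" using \<delta>(2)[OF x True x', of v] \<delta>(1) by simp
      then show ?thesis using p[of v] by linarith
    next
      case False
      have "p \<bullet> (v - u) \<le> norm p * norm (v - u)" by (rule norm_cauchy_schwarz)
      also have "\<dots> \<le> P * (norm v + \<bar>K\<bar>)"
        using norm_triangle_ineq4[of v u] u pP P by (intro mult_mono) auto
      finally have "L x u + p \<bullet> (v - u) \<le> P + P * norm v + P * \<bar>K\<bar>"
        using P(2)[OF x, of u] u by (simp add: algebra_simps)
      also have "\<dots> \<le> (P + 1) * norm v - B" using False by (simp add: K2_def algebra_simps)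
      finally show ?thesis using B(2)[of v x'] assms by simp
    qed
    then show "\<exists>p. \<forall>x' v. norm (x' - x) \<le> \<delta> \<longrightarrow> L x u + p \<bullet> (v - u) - e \<le> L x' v" by blast
  qed (rule \<delta>(1))
qed

section \<open>Polygonal curves\<close>

definition seg :: "real \<Rightarrow> 'a \<Rightarrow> 'a \<Rightarrow> real" where
  "seg \<tau> x u = integral {0..\<tau>} (\<lambda>s. L (x + s *\<^sub>R u) u)"

text \<open>Polygons from \<open>x\<close> to \<open>z\<close> of duration \<open>t\<close>, cost
  \<open>c\<close> and speed at most \<open>K\<close>. The cost is an exact index, not an upper
  bound, so that cutting a polygon in two splits its cost additively.\<close>

inductive reach :: "real \<Rightarrow> real \<Rightarrow> 'a \<Rightarrow> 'a \<Rightarrow> real \<Rightarrow> bool" for K where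
  reach_refl: "reach K 0 x x 0"
| reach_step: "0 < \<tau> \<Longrightarrow> norm u \<le> K \<Longrightarrow> reach K t (x + \<tau> *\<^sub>R u) z c \<Longrightarrow> reach K (\<tau> + t) x z (seg \<tau> x u + c)"

lemma seg_integrable: "(\<lambda>s. L (x + s *\<^sub>R u) u) integrable_on {a..b}"
  by (intro integrable_continuous_real continuous_intros)

lemma seg_nonneg: "0 \<le> seg \<tau> x u"
  unfolding seg_def by (intro integral_nonneg seg_integrable L_nonneg)

lemma seg_le:
  assumes "0 \<le> \<tau>" "\<And>s. 0 \<le> s \<Longrightarrow> s \<le> \<tau> \<Longrightarrow> L (x + s *\<^sub>R u) u \<le> Q"
  shows "seg \<tau> x u \<le> \<tau> * Q"
  using integral_le[of "\<lambda>s. L (x + s *\<^sub>R u) u" "{0..\<tau>}" "\<lambda>_. Q"] assms seg_integrable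
  by (auto simp: seg_def)

lemma seg_ge:
  assumes "0 \<le> \<tau>" "\<And>s. 0 \<le> s \<Longrightarrow> s \<le> \<tau> \<Longrightarrow> Q \<le> L (x + s *\<^sub>R u) u"
  shows "\<tau> * Q \<le> seg \<tau> x u"
  using integral_le[of "\<lambda>_. Q" "{0..\<tau>}" "\<lambda>s. L (x + s *\<^sub>R u) u"] assms seg_integrable
  by (auto simp: seg_def)

lemma seg_add:
  assumes "0 \<le> \<sigma>" "0 \<le> \<tau>"
  shows "seg (\<sigma> + \<tau>) x u = seg \<sigma> x u + seg \<tau> (x + \<sigma> *\<^sub>R u) u"
proof -
  have "seg (\<sigma> + \<tau>) x u = seg \<sigma> x u + integral {\<sigma>..\<sigma> + \<tau>} (\<lambda>s. L (x + s *\<^sub>R u) u)"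
    unfolding seg_def
    by (rule Henstock_Kurzweil_Integration.integral_combine[symmetric]) (use assms seg_integrable in auto)
  also have "integral {\<sigma>..\<sigma> + \<tau>} (\<lambda>s. L (x + s *\<^sub>R u) u) = seg \<tau> (x + \<sigma> *\<^sub>R u) u"
    using integral_shift_real_ivl[of \<sigma> \<sigma> "\<sigma> + \<tau>" "\<lambda>s. L (x + s *\<^sub>R u) u"]
    by (simp add: seg_def scaleR_left_distrib algebra_simps)
  finally show ?thesis .
qed

lemma seg_scale:
  assumes "0 < k" "0 \<le> \<tau>"
  shows "seg (k * \<tau>) x u = k * integral {0..\<tau>} (\<lambda>s. L (x + (k * s) *\<^sub>R u) u)"
proof -
  have "((\<lambda>s. L (x + s *\<^sub>R u) u) has_integral seg (k * \<tau>) x u) (cbox 0 (k * \<tau>))"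
    using seg_integrable[of x u 0 "k * \<tau>"] by (simp add: seg_def integrable_integral)
  from has_integral_affinity'[OF this assms(1), of 0]
  have "((\<lambda>s. L (x + (k * s) *\<^sub>R u) u) has_integral (seg (k * \<tau>) x u / k)) {0..\<tau>}"
    using assms by (simp add: divide_inverse_commute mult.assoc[symmetric])
  then show ?thesis using assms by (simp add: integral_unique)
qed

lemma reach_mono: "reach K t x z c \<Longrightarrow> K \<le> K' \<Longrightarrow> reach K' t x z c"
  by (induction rule: reach.induct) (auto intro: reach.intros)

lemma reach_time_nonneg: "reach K t x z c \<Longrightarrow> 0 \<le> t"
  and reach_cost_nonneg: "reach K t x z c \<Longrightarrow> 0 \<le> c"
  by (induction rule: reach.induct) (auto intro: add_nonneg_nonneg seg_nonneg)

lemma reach_time_0: "reach K 0 x z c \<Longrightarrow> z = x \<and> c = 0"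
  by (erule reach.cases) (use reach_time_nonneg in force)+

lemma reach_seg: "0 < \<tau> \<Longrightarrow> norm u \<le> K \<Longrightarrow> z = x + \<tau> *\<^sub>R u \<Longrightarrow> reach K \<tau> x z (seg \<tau> x u)"
  using reach_step[OF _ _ reach_refl] by fastforce

lemma reach_append: "reach K s x y c \<Longrightarrow> reach K t y z d \<Longrightarrow> reach K (s + t) x z (c + d)"
  by (induction rule: reach.induct) (auto intro: reach.intros simp: add.assoc)

lemma reach_split:
  assumes "reach K t x z c" "0 \<le> s" "s \<le> t"
  shows "\<exists>w c1 c2. reach K s x w c1 \<and> reach K (t - s) w z c2 \<and> c = c1 + c2"
  using assms
proof (induction arbitrary: s rule: reach.induct)
  case (reach_refl x)
  then show ?case using reach.reach_refl by fastforce
next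
  case (reach_step \<tau> u t x z c)
  consider "s = 0" | "0 < s" "s < \<tau>" | "\<tau> \<le> s" using reach_step.prems by linarith
  then show ?case
  proof cases
    case 1
    then show ?thesis
      using reach.reach_refl reach.reach_step[OF reach_step.hyps] by (metis add_0 diff_zero)
  next
    case 2
    have "reach K (\<tau> - s + t) (x + s *\<^sub>R u) z (seg (\<tau> - s) (x + s *\<^sub>R u) u + c)"
      using reach_step.hyps 2 by (intro reach.reach_step) (auto simp flip: scaleR_left_distrib simp: add.assoc)
    moreover have "seg \<tau> x u = seg s x u + seg (\<tau> - s) (x + s *\<^sub>R u) u"
      using seg_add[of s "\<tau> - s" x u] 2 by simp
    ultimately show ?thesis
      using reach_seg[OF 2(1) reach_step.hyps(2) refl, of x] by (force simp: algebra_simps)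
  next
    case 3
    then obtain w c1 c2 where w: "reach K (s - \<tau>) (x + \<tau> *\<^sub>R u) w c1" "reach K (t - (s - \<tau>)) w z c2" "c = c1 + c2"
      using reach_step.IH[of "s - \<tau>"] reach_step.prems by auto
    from reach.reach_step[OF reach_step.hyps(1,2) w(1)] have "reach K s x w (seg \<tau> x u + c1)" by simp
    with w(2,3) show ?thesis by (intro exI[of _ w] exI[of _ "seg \<tau> x u + c1"] exI[of _ c2]) (simp add: algebra_simps)
  qed
qed

lemma reach_dist: "reach K t x z c \<Longrightarrow> norm (z - x) \<le> K * t"
proof (induction rule: reach.induct)
  case (reach_step \<tau> u t x z c)
  have "norm (z - x) \<le> norm (z - (x + \<tau> *\<^sub>R u)) + norm (\<tau> *\<^sub>R u)"
    using norm_triangle_ineq[of "z - (x + \<tau> *\<^sub>R u)" "\<tau> *\<^sub>R u"] by simp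
  also have "\<dots> \<le> K * t + \<tau> * K"
    using reach_step by (intro add_mono) (auto intro: mult_left_mono)
  finally show ?case by (simp add: algebra_simps)
qed simp

text \<open>The triangle inequality for the pieces, weighted by the coercive minorant. The bound
  does not involve \<open>K\<close>, so it controls end points even when the speeds of a sequence
  are unbounded; large \<open>A\<close> controls them over short times.\<close>

lemma reach_growth:
  assumes "reach K t x z c" "\<And>x u. A * norm u - B \<le> L x u" "0 \<le> A"
  shows "A * norm (z - x) - B * t \<le> c"
  using assms(1)
proof (induction rule: reach.induct)
  case (reach_step \<tau> u t x z c)
  have "norm (z - x) \<le> norm (z - (x + \<tau> *\<^sub>R u)) + norm (\<tau> *\<^sub>R u)"
    using norm_triangle_ineq[of "z - (x + \<tau> *\<^sub>R u)" "\<tau> *\<^sub>R u"] by simp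
  then have "A * norm (z - x) \<le> A * norm (z - (x + \<tau> *\<^sub>R u)) + \<tau> * (A * norm u)"
    using mult_left_mono[OF _ assms(3)] reach_step.hyps by (fastforce simp: algebra_simps)
  moreover have "\<tau> * (A * norm u - B) \<le> seg \<tau> x u"
    using seg_ge[of \<tau> "A * norm u - B" x u] reach_step.hyps assms(2) by simp
  ultimately show ?case using reach_step.IH by (simp add: algebra_simps)
qed simp

text \<open>An affine minorant valid on a ball that the polygon cannot leave: its constant
  integrates to \<open>a * t\<close>, and its linear part telescopes to the displacement, whatever
  the individual velocities are.\<close>

lemma reach_affine_lower:
  assumes "reach K t x z c"
    and "\<And>x' v. norm (x' - x0) \<le> \<delta> \<Longrightarrow> a + p \<bullet> v \<le> L x' v"
    and "norm (x - x0) + K * t \<le> \<delta>"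
  shows "a * t + p \<bullet> (z - x) \<le> c"
  using assms(1,3)
proof (induction rule: reach.induct)
  case (reach_step \<tau> u t x z c)
  have Kt: "0 \<le> K * t"
    using reach_step.hyps reach_time_nonneg by (meson norm_ge_zero order_trans mult_nonneg_nonneg)
  have near: "norm (x + s *\<^sub>R u - x0) \<le> norm (x - x0) + s * K" if "0 \<le> s" for s
  proof -
    have "norm (x + s *\<^sub>R u - x0) \<le> norm (x - x0) + norm (s *\<^sub>R u)"
      using norm_triangle_ineq[of "x - x0" "s *\<^sub>R u"] by (simp add: algebra_simps)
    then show ?thesis using mult_left_mono[OF reach_step.hyps(2) that] that by simp
  qed
  have "\<tau> * (a + p \<bullet> u) \<le> seg \<tau> x u"
  proof (rule seg_ge)
    fix s assume s: "0 \<le> s" "s \<le> \<tau>"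
    have "s * K \<le> \<tau> * K" using s reach_step.hyps(2) by (meson mult_right_mono norm_ge_zero order_trans)
    then show "a + p \<bullet> u \<le> L (x + s *\<^sub>R u) u"
      using near[OF s(1)] reach_step.prems Kt by (intro assms(2)) (simp add: algebra_simps)
  qed (use reach_step.hyps in simp)
  moreover have "a * t + p \<bullet> (z - (x + \<tau> *\<^sub>R u)) \<le> c"
    using near[of \<tau>] reach_step.prems reach_step.hyps by (intro reach_step.IH) (simp add: algebra_simps)
  ultimately show ?case by (simp add: algebra_simps inner_diff_right inner_add_right)
qed simp

(* The curve y is replaced by p' + (y (s / k) - p) + s b. *)
lemma reach_perturb:
  assumes "reach K t p q c" and "0 < k"
    and cmp: "\<And>x u x' u'. norm x \<le> R \<Longrightarrow> norm u \<le> K \<Longrightarrow> norm (x' - x) \<le> \<delta> \<Longrightarrow> norm (u' - u) \<le> \<delta> \<Longrightarrow>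
        L x' u' \<le> L x u + e"
    and vel: "\<And>u. norm u \<le> K \<Longrightarrow> norm (u /\<^sub>R k + b - u) \<le> \<delta>"
    and "norm p + K * t \<le> R" "norm (p' - p) + k * t * norm b \<le> \<delta>"
  shows "\<exists>c'. reach (K + \<delta>) (k * t) p' (p' + (q - p) + (k * t) *\<^sub>R b) c' \<and> c' \<le> k * (c + e * t)"
  using assms(1,5,6)
proof (induction arbitrary: p' rule: reach.induct)
  case (reach_refl x)
  then show ?case using reach.reach_refl by fastforce
next
  case (reach_step \<tau> u t x z c)
  let ?u = "u /\<^sub>R k + b" and ?x = "x + \<tau> *\<^sub>R u"
  let ?x' = "p' + (k * \<tau>) *\<^sub>R ?u"
  have t: "0 \<le> t" "0 \<le> K"
    using reach_time_nonneg[OF reach_step.hyps(3)] order_trans[OF norm_ge_zero reach_step.hyps(2)] by auto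
  have u': "norm ?u \<le> K + \<delta>"
    using vel[OF reach_step.hyps(2)] norm_triangle_ineq[of "?u - u" u] reach_step.hyps(2) by simp
  have x': "?x' = p' + \<tau> *\<^sub>R u + (k * \<tau>) *\<^sub>R b" using assms(2) by (simp add: algebra_simps)
  have shift: "norm (p' + s *\<^sub>R u + (k * s) *\<^sub>R b - (x + s *\<^sub>R u)) \<le> norm (p' - x) + k * s * norm b" if "0 \<le> s" for s
    using norm_triangle_ineq[of "p' - x" "(k * s) *\<^sub>R b"] that assms(2) by (simp add: algebra_simps)
  have moved: "norm (x + s *\<^sub>R u) \<le> norm x + K * s" if "0 \<le> s" for s
    using norm_triangle_ineq[of x "s *\<^sub>R u"] mult_left_mono[OF reach_step.hyps(2) that] that by (simp add: mult.commute)
  \<comment> \<open>The budget \<open>norm (p' - p) + k * t * norm b\<close> does not increase from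
    piece to piece: the drift gained on this piece moves from the second summand to the first. The
    same holds for \<open>norm p + K * t\<close>.\<close>
  have "\<exists>c'. reach (K + \<delta>) (k * t) ?x' (?x' + (z - ?x) + (k * t) *\<^sub>R b) c' \<and> c' \<le> k * (c + e * t)"
  proof (rule reach_step.IH)
    show "norm ?x + K * t \<le> R"
      using moved[of \<tau>] reach_step.prems(1) reach_step.hyps(1) by (simp add: algebra_simps)
    show "norm (?x' - ?x) + k * t * norm b \<le> \<delta>"
      using shift[of \<tau>] reach_step.prems(2) reach_step.hyps(1) unfolding x' by (simp add: algebra_simps)
  qed
  then obtain c' where c': "reach (K + \<delta>) (k * t) ?x' (?x' + (z - ?x) + (k * t) *\<^sub>R b) c'" "c' \<le> k * (c + e * t)"
    by blast
  have end_eq: "?x' + (z - ?x) + (k * t) *\<^sub>R b = p' + (z - x) + (k * (\<tau> + t)) *\<^sub>R b"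
    unfolding x' by (simp add: algebra_simps)
  have "0 < k * \<tau>" using reach_step.hyps(1) assms(2) by simp
  from reach.reach_step[OF this u' c'(1)]
  have r: "reach (K + \<delta>) (k * (\<tau> + t)) p' (p' + (z - x) + (k * (\<tau> + t)) *\<^sub>R b) (seg (k * \<tau>) p' ?u + c')"
    unfolding end_eq distrib_left[of k \<tau> t, symmetric] .
  have "integral {0..\<tau>} (\<lambda>s. L (p' + (k * s) *\<^sub>R ?u) ?u) \<le> integral {0..\<tau>} (\<lambda>s. L (x + s *\<^sub>R u) u + e)"
  proof (rule integral_le)
    show "(\<lambda>s. L (p' + (k * s) *\<^sub>R ?u) ?u) integrable_on {0..\<tau>}" "(\<lambda>s. L (x + s *\<^sub>R u) u + e) integrable_on {0..\<tau>}"
      by (intro integrable_continuous_real continuous_intros)+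
  next
    fix s assume s: "s \<in> {0..\<tau>}"
    have eq: "p' + (k * s) *\<^sub>R ?u = p' + s *\<^sub>R u + (k * s) *\<^sub>R b"
      using assms(2) by (simp add: algebra_simps)
    show "L (p' + (k * s) *\<^sub>R ?u) ?u \<le> L (x + s *\<^sub>R u) u + e"
    proof (rule cmp[OF _ reach_step.hyps(2) _ vel[OF reach_step.hyps(2)]])
      have "K * s \<le> K * (\<tau> + t)" using s t by (intro mult_left_mono) auto
      then show "norm (x + s *\<^sub>R u) \<le> R" using moved[of s] s reach_step.prems(1) by simp
      have "k * s * norm b \<le> k * (\<tau> + t) * norm b"
        using s t assms(2) by (intro mult_right_mono mult_left_mono) auto
      then show "norm (p' + (k * s) *\<^sub>R ?u - (x + s *\<^sub>R u)) \<le> \<delta>"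
        using shift[of s] s reach_step.prems(2) unfolding eq by simp
    qed
  qed
  also have "\<dots> = seg \<tau> x u + e * \<tau>"
    using reach_step.hyps(1) seg_integrable by (subst integral_add) (auto simp: seg_def)
  finally have "seg (k * \<tau>) p' ?u \<le> k * (seg \<tau> x u + e * \<tau>)"
    using seg_scale[OF assms(2), of \<tau> p' ?u] reach_step.hyps(1) assms(2) by (simp add: mult_left_mono)
  with c'(2) have "seg (k * \<tau>) p' ?u + c' \<le> k * (seg \<tau> x u + c + e * (\<tau> + t))"
    by (simp add: algebra_simps)
  with r show ?case by blast
qed

section \<open>Retiming polygons to bounded speed\<close>

lemma reach_chain:
  assumes "\<And>i. i < N \<Longrightarrow> 0 < \<tau> i" "\<And>i. i < N \<Longrightarrow> norm (p (Suc i) - p i) \<le> K * \<tau> i"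
  shows "reach K (\<Sum>i<N. \<tau> i) (p 0) (p N) (\<Sum>i<N. seg (\<tau> i) (p i) ((p (Suc i) - p i) /\<^sub>R \<tau> i))"
  using assms
proof (induction N)
  case (Suc N)
  have "norm ((p (Suc N) - p N) /\<^sub>R \<tau> N) \<le> K"
    using Suc.prems[of N] by (simp add: pos_divide_le_eq flip: divide_inverse_commute)
  then have "reach K (\<tau> N) (p N) (p (Suc N)) (seg (\<tau> N) (p N) ((p (Suc N) - p N) /\<^sub>R \<tau> N))"
    using Suc.prems(1)[of N] by (intro reach_seg) auto
  with Suc show ?case by (auto intro!: reach_append)
qed (simp add: reach_refl)

lemma seg_le_near:
  assumes "0 < \<tau>" and "norm (\<tau> *\<^sub>R u) \<le> \<delta>"
    and "\<And>x'. norm (x' - x) \<le> \<delta> \<Longrightarrow> L x' u \<le> L x u + e"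
  shows "seg \<tau> x u \<le> \<tau> * (L x u + e)"
proof (rule seg_le)
  fix s assume "0 \<le> s" "s \<le> \<tau>"
  then have "norm (s *\<^sub>R u) \<le> norm (\<tau> *\<^sub>R u)" by (simp add: mult_right_mono)
  then show "L (x + s *\<^sub>R u) u \<le> L x u + e" using assms(2) by (intro assms(3)) simp
qed (use assms in simp)

(* The data p, f, h stand for the nodes of an arbitrary curve, its costs on the N intervals of a uniform
   partition, and the length of these intervals. Only the existence of \<delta> depends on e, so the speed
   bound K is uniform. *)
lemma retime_polygon:
  assumes "0 \<le> C" "0 < t0"
  obtains K where "0 < K"
    "\<And>e. 0 < e \<Longrightarrow> \<exists>\<delta>>0. \<forall>h N p f. 0 < h \<and> t0 \<le> N * h \<and> N * h \<le> T \<and> h * K \<le> \<delta> \<and> norm (p 0) \<le> R0 \<and>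
       (\<forall>i<N. 0 \<le> f i) \<and> (\<Sum>i<N. f i) \<le> C \<and>
       (\<forall>A B. 0 \<le> A \<and> (\<forall>x u. A * norm u - B \<le> L x u) \<longrightarrow> (\<forall>i<N. A * norm (p (Suc i) - p i) - B * h \<le> f i)) \<and>
       (\<forall>i<N. norm (p (Suc i) - p i) \<le> K * h \<longrightarrow> h * (L (p i) ((p (Suc i) - p i) /\<^sub>R h) - e) \<le> f i) \<longrightarrow>
       (\<exists>c. reach K (N * h) (p 0) (p N) c \<and> c \<le> (\<Sum>i<N. f i) + 2 * e * (N * h))"
proof -
  obtain B1 where B1: "B1 \<ge> 0" "\<And>x u. 1 * norm u - B1 \<le> L x u"
    using L_superlinear[of 1] by blast
  \<comment> \<open>Growth of slope 1 bounds the total displacement of the nodes by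
    \<open>C + B1 * \<bar>T\<bar>\<close>; the summand 1 makes \<open>D\<close> positive.\<close>
  define D where "D = C + B1 * \<bar>T\<bar> + 1"
  define R where "R = R0 + D"
  \<comment> \<open>Pieces faster than \<open>M\<close> occupy at most \<open>D / M = t0 / 4\<close>
    of the time, so the slow ones keep at least \<open>3 / 4 * t0\<close>.\<close>
  define M where "M = 4 * D / t0"
  have D: "0 < D" using assms B1 by (simp add: D_def add_nonneg_pos)
  have M: "0 < M" using D assms by (simp add: M_def)
  \<comment> \<open>Speed 1 is for the retimed fast pieces; \<open>2 * M\<close> appears because
    \<open>convex_perspective_le\<close> evaluates the Lagrangian at twice a slow velocity.\<close>
  obtain Q where Q: "Q > 0" "\<And>x u. norm x \<le> R \<Longrightarrow> norm u \<le> max 1 (2 * M) \<Longrightarrow> L x u \<le> Q"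
    using L_bounded by blast
  \<comment> \<open>The first summand makes a fast piece cost at least \<open>4 * Q\<close> per unit
    of length, enough for its unit-speed replacement and for the accelerations elsewhere. The second
    keeps the total length of fast pieces below \<open>t0 / 4\<close>.\<close>
  define A where "A = 8 * Q + 8 * C / t0"
  have A: "0 < A" "8 * Q \<le> A" "8 * C \<le> A * t0"
    using Q assms by (auto simp: A_def add_pos_nonneg distrib_right)
  obtain B where B: "B \<ge> 0" "\<And>x u. A * norm u - B \<le> L x u"
    using L_superlinear[of A] by blast
  \<comment> \<open>The summands ensure that unit speed slows a fast piece down, that an accelerated
    slow piece stays admissible, and that on a fast piece \<open>B * h\<close> uses up at most half
    of \<open>A * d i\<close>.\<close>
  define K where "K = 1 + 2 * M + 2 * B / A"
  have K: "1 \<le> K" "2 * M \<le> K" "2 * B \<le> K * A"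
    using M B A by (auto simp: K_def field_simps)
  show ?thesis
  proof
    show "0 < K" using K by simp
    fix e :: real assume "0 < e"
    obtain \<delta> where \<delta>: "\<delta> > 0" "\<And>x u x' u'. norm x \<le> R \<Longrightarrow> norm u \<le> K \<Longrightarrow> norm (x' - x) \<le> \<delta> \<Longrightarrow>
      norm (u' - u) \<le> \<delta> \<Longrightarrow> \<bar>L x' u' - L x u\<bar> \<le> e"
      using L_unif_cont[OF \<open>0 < e\<close>] by blast
    have "\<exists>c. reach K (N * h) (p 0) (p N) c \<and> c \<le> (\<Sum>i<N. f i) + 2 * e * (N * h)"
      if h: "0 < h" "t0 \<le> N * h" "N * h \<le> T" "h * K \<le> \<delta>" and p0: "norm (p 0) \<le> R0"
        and f: "\<And>i. i < N \<Longrightarrow> 0 \<le> f i" "(\<Sum>i<N. f i) \<le> C"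
        and D1: "\<forall>A B. 0 \<le> A \<and> (\<forall>x u. A * norm u - B \<le> L x u) \<longrightarrow> (\<forall>i<N. A * norm (p (Suc i) - p i) - B * h \<le> f i)"
        and D2: "\<And>i. i < N \<Longrightarrow> norm (p (Suc i) - p i) \<le> K * h \<Longrightarrow> h * (L (p i) ((p (Suc i) - p i) /\<^sub>R h) - e) \<le> f i"
      for h N f and p :: "nat \<Rightarrow> 'a"
    proof -
      define d where "d i = norm (p (Suc i) - p i)" for i
      (* Z: the fast pieces, to be traversed at unit speed. G: the slow pieces, to be traversed in
         time h * (1 - \<theta>), with \<theta> chosen so that the total duration is unchanged. *)
      define Z where "Z = {i\<in>{..<N}. K * h < d i}"
      define G where "G = {i\<in>{..<N}. d i \<le> M * h}"
      have fin: "finite Z" "finite G" and sub: "Z \<subseteq> {..<N}" "G \<subseteq> {..<N}" by (auto simp: Z_def G_def)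
      have hZ: "h \<le> d i" if "i \<in> Z" for i
        proof -
        have "1 * h \<le> K * h" using K(1) h(1) by (intro mult_right_mono) auto
        moreover have "K * h < d i" using that by (simp add: Z_def)
        ultimately show ?thesis by linarith
      qed
      have disj: "i \<notin> G" if "i \<in> Z" for i
        proof -
        have "M * h \<le> K * h" using K(2) M h(1) by (intro mult_right_mono) auto
        moreover have "K * h < d i" using that by (simp add: Z_def)
        ultimately show ?thesis unfolding G_def by (simp del: mult_le_cancel_right)
      qed
      have "(\<Sum>i<N. d i) \<le> (\<Sum>i<N. f i + B1 * h)"
        using D1[rule_format, of 1 B1] B1 by (intro sum_mono) (fastforce simp: d_def)
      also have "\<dots> \<le> C + B1 * (N * h)"
        using f by (simp add: sum.distrib)
      also have "\<dots> \<le> C + B1 * \<bar>T\<bar>"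
        using h B1 by (intro add_left_mono mult_left_mono) auto
      finally have dD: "(\<Sum>i<N. d i) \<le> D" by (simp add: D_def)
      have d0: "0 \<le> d i" for i by (simp add: d_def)
      have pR: "norm (p i) \<le> R" if "i \<le> N" for i
      proof -
        have "norm (p i - p 0) \<le> (\<Sum>j<i. d j)"
          unfolding d_def using norm_sum[of "\<lambda>j. p (Suc j) - p j" "{..<i}"] by (simp add: sum_lessThan_telescope)
        also have "\<dots> \<le> (\<Sum>i<N. d i)" using that d0 by (intro sum_mono2) auto
        finally show ?thesis using dD p0 norm_triangle_ineq2[of "p i" "p 0"] by (simp add: R_def)
      qed
      have fZ: "A / 2 * d i \<le> f i" if "i \<in> Z" for i
      proof -
        have "A * d i - B * h \<le> f i"
          using D1[rule_format, of A B] A B that by (fastforce simp: d_def Z_def)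
        moreover have "2 * B * h \<le> K * A * h" using K(3) h by (intro mult_right_mono) auto
        moreover have "A * (K * h) \<le> A * d i" using that A by (intro mult_left_mono) (auto simp: Z_def)
        ultimately show ?thesis by (simp add: algebra_simps)
      qed
      \<comment> \<open>At unit speed the duration of a piece equals its length, so \<open>S\<close>
        is the new total duration of the fast pieces and \<open>H\<close> is the time by which they
        overrun.\<close>
      define S where "S = (\<Sum>i\<in>Z. d i)"
      define H where "H = (\<Sum>i\<in>Z. d i - h)"
      have S: "A / 2 * S \<le> (\<Sum>i\<in>Z. f i)" unfolding S_def sum_distrib_left using fZ by (intro sum_mono)
      also have "\<dots> \<le> (\<Sum>i<N. f i)" using f sub by (intro sum_mono2) auto
      finally have "A / 2 * S \<le> C" using f(2) by simp
      then have "A * (4 * S) \<le> A * t0" using A(3) by simp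
      then have St: "4 * S \<le> t0" using A(1) by simp
      have H: "0 \<le> H" "H \<le> S"
        unfolding H_def S_def using hZ h by (auto intro!: sum_nonneg sum_mono)
      define \<gamma> where "\<gamma> = card G * h"
      have "(N - card G) * (M * h) = (\<Sum>i\<in>{..<N} - G. M * h)"
        using fin sub by (simp add: card_Diff_subset)
      also have "\<dots> \<le> (\<Sum>i\<in>{..<N} - G. d i)" by (intro sum_mono) (auto simp: G_def)
      also have "\<dots> \<le> (\<Sum>i<N. d i)" using d0 by (intro sum_mono2) auto
      finally have "(N - card G) * (M * h) \<le> D" using dD by simp
      moreover have "card G \<le> N" using card_mono[OF _ sub(2)] by simp
      ultimately have "(N * h - \<gamma>) * (4 * D) \<le> D * t0"
        using assms by (simp add: \<gamma>_def M_def of_nat_diff field_simps)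
      then have "D * (4 * (N * h - \<gamma>)) \<le> D * t0" by (simp add: mult.commute mult.left_commute)
      then have \<gamma>: "3 / 4 * t0 \<le> \<gamma>" using D h(2) by simp
      then have \<gamma>0: "0 < \<gamma>" using assms by simp
      define \<theta> where "\<theta> = H / \<gamma>"
      have \<theta>: "0 \<le> \<theta>" "\<theta> \<le> 1 / 2" "\<theta> * \<gamma> = H"
        using H St \<gamma> \<gamma>0 assms by (auto simp: \<theta>_def field_simps)
      define \<tau> where "\<tau> i = (if i \<in> Z then d i else if i \<in> G then h * (1 - \<theta>) else h)" for i
      have \<tau>0: "0 < \<tau> i" for i using hZ[of i] h \<theta> by (auto simp: \<tau>_def)
      have "(\<Sum>i<N. \<tau> i) = (\<Sum>i<N. h + (if i \<in> Z then d i - h else 0) - (if i \<in> G then h * \<theta> else 0))"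
        by (intro sum.cong) (auto simp: \<tau>_def algebra_simps dest: disj)
      also have "\<dots> = N * h + H - \<gamma> * \<theta>"
        using sub by (simp add: sum.distrib sum_subtractf H_def \<gamma>_def sum.inter_restrict[symmetric] Int_absorb1)
      finally have sum\<tau>: "(\<Sum>i<N. \<tau> i) = N * h" using \<theta>(3) by (simp add: mult.commute)
      have vel: "d i \<le> K * \<tau> i" if "i < N" for i
      proof -
        consider "i \<in> Z" | "i \<in> G" "i \<notin> Z" | "i \<notin> Z" "i \<notin> G" by blast
        then show ?thesis
        proof cases
          case 1
          then show ?thesis using mult_right_mono[OF K(1) d0, of i] by (simp add: \<tau>_def)
        next
          case 2
          have "M * 1 \<le> K * (1 - \<theta>)"
          proof -
            have "K * (1 / 2) \<le> K * (1 - \<theta>)" using K(1) \<theta>(2) by (intro mult_left_mono) auto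
            with K(2) show ?thesis by simp
          qed
          then have "M * h \<le> K * (1 - \<theta>) * h" using h by (intro mult_right_mono) auto
          then show ?thesis using 2 by (simp add: \<tau>_def G_def algebra_simps)
        next
          case 3
          then show ?thesis using that by (simp add: \<tau>_def Z_def)
        qed
      qed
      \<comment> \<open>The cost allowed to piece \<open>i\<close>. One \<open>e\<close> pays for
        freezing the position at \<open>p i\<close>, the other for the slack in \<open>D2\<close>. A
        fast piece trades \<open>f i\<close> for \<open>d i * Q\<close>, and an accelerated piece
        pays the extra term of \<open>convex_perspective_le\<close>.\<close>
      define w where "w i = f i + 2 * e * h + (if i \<in> Z then d i * Q - f i else 0) + (if i \<in> G then h * \<theta> * Q else 0)" for i
      have seg_w: "seg (\<tau> i) (p i) ((p (Suc i) - p i) /\<^sub>R \<tau> i) \<le> w i" if i: "i < N" for i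
      proof (cases "i \<in> Z")
        case True
        then have di: "0 < d i" using hZ h by fastforce
        have "seg (d i) (p i) ((p (Suc i) - p i) /\<^sub>R d i) \<le> d i * Q"
        proof (rule seg_le)
          fix s assume s: "0 \<le> s" "s \<le> d i"
          have "p i + s *\<^sub>R ((p (Suc i) - p i) /\<^sub>R d i) = (1 - s / d i) *\<^sub>R p i + (s / d i) *\<^sub>R p (Suc i)"
            by (simp add: algebra_simps divide_inverse)
          moreover have "norm ((1 - s / d i) *\<^sub>R p i + (s / d i) *\<^sub>R p (Suc i)) \<le> (1 - s / d i) * R + (s / d i) * R"
          proof -
            have "norm ((1 - s / d i) *\<^sub>R p i) = (1 - s / d i) * norm (p i)"
              "norm ((s / d i) *\<^sub>R p (Suc i)) = (s / d i) * norm (p (Suc i))"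
              using s di by auto
            moreover have "(1 - s / d i) * norm (p i) \<le> (1 - s / d i) * R" "(s / d i) * norm (p (Suc i)) \<le> (s / d i) * R"
              using s di pR[of i] pR[of "Suc i"] i by (auto intro!: mult_left_mono simp del: times_divide_eq_left)
            ultimately show ?thesis by (intro norm_triangle_le) linarith
          qed
          moreover have "norm ((p (Suc i) - p i) /\<^sub>R d i) \<le> 1" using di by (simp add: d_def)
          ultimately show "L (p i + s *\<^sub>R ((p (Suc i) - p i) /\<^sub>R d i)) ((p (Suc i) - p i) /\<^sub>R d i) \<le> Q"
            by (intro Q(2)) (simp_all add: left_diff_distrib)
        qed (rule d0)
        moreover have "0 \<le> 2 * e * h" using \<open>0 < e\<close> h(1) by simp
        ultimately show ?thesis using True disj[OF True] by (simp add: w_def \<tau>_def)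
      next
        case False
        let ?u = "(p (Suc i) - p i) /\<^sub>R \<tau> i" and ?v = "(p (Suc i) - p i) /\<^sub>R h"
        have dK: "d i \<le> K * h" using False i by (simp add: Z_def)
        have uK: "norm ?u \<le> K" using vel[OF i] \<tau>0[of i]
          by (simp add: d_def pos_divide_le_eq flip: divide_inverse_commute)
        have "seg (\<tau> i) (p i) ?u \<le> \<tau> i * (L (p i) ?u + e)"
        proof (rule seg_le_near[OF \<tau>0])
          show "norm (\<tau> i *\<^sub>R ?u) \<le> \<delta>"
            using dK h(4) \<tau>0[of i] by (simp add: d_def mult.commute)
          show "L x' ?u \<le> L (p i) ?u + e" if "norm (x' - p i) \<le> \<delta>" for x'
            using \<delta>(2)[OF pR[of i] uK that, of ?u] i \<delta>(1) by simp
        qed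
        moreover have "\<tau> i \<le> h" using False \<theta> h by (auto simp: \<tau>_def)
        then have "\<tau> i * e \<le> h * e" using \<open>0 < e\<close> by simp
        moreover have "h * (L (p i) ?v - e) \<le> f i" using D2[OF i] dK by (simp add: d_def)
        moreover have "\<tau> i * L (p i) ?u \<le> h * L (p i) ?v + (if i \<in> G then h * \<theta> * Q else 0)"
        proof (cases "i \<in> G")
          case True
          have uv: "?u = ?v /\<^sub>R (1 - \<theta>)" using True False by (simp add: \<tau>_def)
          have "(1 - \<theta>) * L (p i) ?u \<le> (1 - 2 * \<theta>) * L (p i) ?v + \<theta> * L (p i) (2 *\<^sub>R ?v)"
            unfolding uv by (rule convex_perspective_le[OF L_convex \<theta>(1,2)])
          also have "\<dots> \<le> 1 * L (p i) ?v + \<theta> * Q"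
          proof (intro add_mono mult_right_mono mult_left_mono Q(2) pR)
            show "norm (2 *\<^sub>R ?v) \<le> max 1 (2 * M)" 
            proof -
              have "norm ?v \<le> M"
                using True h(1) by (simp add: G_def d_def pos_divide_le_eq flip: divide_inverse_commute)
              with norm_scaleR[of 2 ?v] show ?thesis by linarith
            qed
          qed (use \<theta> i L_nonneg in auto)
          finally have "h * ((1 - \<theta>) * L (p i) ?u) \<le> h * (1 * L (p i) ?v + \<theta> * Q)"
            using h(1) by (intro mult_left_mono) auto
          moreover have "\<tau> i * L (p i) ?u = h * ((1 - \<theta>) * L (p i) ?u)"
            using True False by (simp add: \<tau>_def)
          ultimately show ?thesis using True by (simp only: distrib_left mult.assoc if_True mult_1_left)
        qed (simp add: \<tau>_def False)
        moreover have "w i = f i + 2 * (h * e) + (if i \<in> G then h * \<theta> * Q else 0)"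
          using False by (simp add: w_def mult.commute)
        \<comment> \<open>Linear bookkeeping, with the products abstracted to variables.\<close>
        moreover have "a \<le> c" if "a \<le> b + b'" "b' \<le> h * e" "l - h * e \<le> f'" "b \<le> l + q" "c = f' + 2 * (h * e) + q"
          for a b b' c l f' q :: real
          using that by linarith
        ultimately show ?thesis unfolding distrib_left right_diff_distrib by blast
      qed
      have "(\<Sum>i<N. seg (\<tau> i) (p i) ((p (Suc i) - p i) /\<^sub>R \<tau> i)) \<le> (\<Sum>i<N. w i)"
        using seg_w by (intro sum_mono) auto
      also have "\<dots> = (\<Sum>i<N. f i) + 2 * e * (N * h) + (Q * S - (\<Sum>i\<in>Z. f i)) + \<gamma> * \<theta> * Q"
        using sub
        by (simp add: w_def sum.distrib sum_subtractf S_def \<gamma>_def sum.inter_restrict[symmetric] Int_absorb1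
            sum_distrib_left mult.commute mult.left_commute)
      also have "\<gamma> * \<theta> = H" using \<theta>(3) by (simp add: mult.commute)
      \<comment> \<open>The fast pieces originally cost at least
        \<open>A / 2 * S \<ge> 4 * Q * S\<close>. Their replacement and the accelerations together
        cost at most \<open>Q * S + H * Q \<le> 2 * Q * S\<close>.\<close>
      also have "(\<Sum>i<N. f i) + 2 * e * (N * h) + (Q * S - (\<Sum>i\<in>Z. f i)) + H * Q \<le> (\<Sum>i<N. f i) + 2 * e * (N * h)"
      proof -
        have "H * Q \<le> Q * S" using H Q by simp
        moreover have "8 * Q * S \<le> A * S" using A(2) H by (intro mult_right_mono) auto
        moreover have "0 \<le> Q * S" using Q(1) H by simp
        ultimately show ?thesis using S by simp
      qed
      finally have "(\<Sum>i<N. seg (\<tau> i) (p i) ((p (Suc i) - p i) /\<^sub>R \<tau> i)) \<le> (\<Sum>i<N. f i) + 2 * e * (N * h)" .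
      moreover have "reach K (\<Sum>i<N. \<tau> i) (p 0) (p N) (\<Sum>i<N. seg (\<tau> i) (p i) ((p (Suc i) - p i) /\<^sub>R \<tau> i))"
        using \<tau>0 vel by (intro reach_chain) (auto simp: d_def)
      ultimately show ?thesis unfolding sum\<tau> by blast
    qed
    with \<delta>(1) show "\<exists>\<delta>>0. \<forall>h N p f. 0 < h \<and> t0 \<le> N * h \<and> N * h \<le> T \<and> h * K \<le> \<delta> \<and> norm (p 0) \<le> R0 \<and>
       (\<forall>i<N. 0 \<le> f i) \<and> (\<Sum>i<N. f i) \<le> C \<and>
       (\<forall>A B. 0 \<le> A \<and> (\<forall>x u. A * norm u - B \<le> L x u) \<longrightarrow> (\<forall>i<N. A * norm (p (Suc i) - p i) - B * h \<le> f i)) \<and>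
       (\<forall>i<N. norm (p (Suc i) - p i) \<le> K * h \<longrightarrow> h * (L (p i) ((p (Suc i) - p i) /\<^sub>R h) - e) \<le> f i) \<longrightarrow>
       (\<exists>c. reach K (N * h) (p 0) (p N) c \<and> c \<le> (\<Sum>i<N. f i) + 2 * e * (N * h))"
      by (intro exI[of _ \<delta>]) blast
  qed
qed

section \<open>From Sobolev curves of finite cost to polygons\<close>

lemma W11_cost_measurable:
  assumes "W11 0 t y g"
  shows "(\<lambda>s. indicat_real {0<..<t} s *\<^sub>R L (y s) (g s)) \<in> borel_measurable borel"
proof -
  let ?I = "indicat_real {0<..<t}"
  have [measurable]: "(\<lambda>s. ?I s *\<^sub>R y s) \<in> borel_measurable borel" "(\<lambda>s. ?I s *\<^sub>R g s) \<in> borel_measurable borel"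
    using assms unfolding W11_def set_integrable_def by (auto dest: borel_measurable_integrable)
  \<comment> \<open>Measurability of \<open>y\<close> and \<open>g\<close> is known only after
    restriction, so the indicator is put inside both arguments as well; where the outer factor is
    nonzero this changes nothing.\<close>
  have "(\<lambda>s. ?I s * L (?I s *\<^sub>R y s) (?I s *\<^sub>R g s)) \<in> borel_measurable borel" by measurable
  also have "(\<lambda>s. ?I s * L (?I s *\<^sub>R y s) (?I s *\<^sub>R g s)) = (\<lambda>s. ?I s *\<^sub>R L (y s) (g s))"
    by (auto simp: indicator_def)
  finally show ?thesis .
qed

lemma integral_restrict_indicator:
  fixes f :: "real \<Rightarrow> real"
  shows "((\<lambda>s. indicat_real {a<..<b} s *\<^sub>R f s) has_integral r) UNIV \<longleftrightarrow> (f has_integral r) {a..b}"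
proof -
  have "(\<lambda>s. indicat_real {a<..<b} s *\<^sub>R f s) = (\<lambda>s. if s \<in> {a<..<b} then f s else 0)"
    by (auto simp: indicator_def)
  then show ?thesis using has_integral_restrict_UNIV[of "{a<..<b}" f r] by (simp add: has_integral_Icc_iff_Ioo)
qed

lemma W11_cost_integrable:
  assumes W: "W11 0 t y g" and fin: "(\<integral>\<^sup>+s\<in>{0<..<t}. ennreal (L (y s) (g s)) \<partial>lborel) = ennreal r" and "0 \<le> r"
  shows "((\<lambda>s. L (y s) (g s)) has_integral r) {0..t}"
proof -
  let ?I = "indicat_real {0<..<t}"
  have nn: "(\<integral>\<^sup>+s. ennreal (?I s *\<^sub>R L (y s) (g s)) \<partial>lborel) = ennreal r"
    unfolding fin[symmetric] by (intro nn_integral_cong) (auto simp: indicator_def)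
  have "((\<lambda>s. ?I s *\<^sub>R L (y s) (g s)) has_integral r) UNIV"
    by (rule nn_integral_has_integral) (use W11_cost_measurable[OF W] nn assms(3) L_nonneg in \<open>auto\<close>)
  then show ?thesis by (simp only: integral_restrict_indicator)
qed

text \<open>A uniform partition supplies the data of \<open>retime_polygon\<close>: integrated
  growth bounds the interval costs below by displacements, and affine minorants at the chord
  velocity do so for moderate speeds. The accuracy \<open>e\<close> affects only the mesh, so
  \<open>K\<close> serves all accuracies and all curves within the given bounds.\<close>

lemma W11_imp_reach:
  assumes "0 \<le> C" "0 < t0"
  obtains K where "0 < K"
    "\<And>t y g r e. W11 0 t y g \<Longrightarrow> t0 \<le> t \<Longrightarrow> t \<le> T \<Longrightarrow> norm (y 0) \<le> R0 \<Longrightarrow>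
       (\<integral>\<^sup>+s\<in>{0<..<t}. ennreal (L (y s) (g s)) \<partial>lborel) = ennreal r \<Longrightarrow> 0 \<le> r \<Longrightarrow> r \<le> C \<Longrightarrow> 0 < e \<Longrightarrow>
       \<exists>c. reach K t (y 0) (y t) c \<and> c \<le> r + e"
proof -
  obtain K where K: "0 < K" and retime:
    "\<And>e. 0 < e \<Longrightarrow> \<exists>\<delta>>0. \<forall>h N p f. 0 < h \<and> t0 \<le> real N * h \<and> real N * h \<le> T \<and> h * K \<le> \<delta> \<and> norm (p 0) \<le> R0 \<and>
       (\<forall>i<N. 0 \<le> f i) \<and> (\<Sum>i<N. f i) \<le> C \<and>
       (\<forall>A B. 0 \<le> A \<and> (\<forall>x u. A * norm u - B \<le> L x u) \<longrightarrow> (\<forall>i<N. A * norm (p (Suc i) - p i) - B * h \<le> f i)) \<and>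
       (\<forall>i<N. norm (p (Suc i) - p i) \<le> K * h \<longrightarrow> h * (L (p i) ((p (Suc i) - p i) /\<^sub>R h) - e) \<le> f i) \<longrightarrow>
       (\<exists>c. reach K (real N * h) (p 0) (p N) c \<and> c \<le> (\<Sum>i<N. f i) + 2 * e * (real N * h))"
    using retime_polygon[OF assms, of T R0] by blast
  obtain B1 where B1: "B1 \<ge> 0" "\<And>x u. 1 * norm u - B1 \<le> L x u"
    using L_superlinear[of 1] by blast
  show ?thesis
  proof (rule that[OF K])
    fix t y g r and e :: real
    assume W: "W11 0 t y g" and t: "t0 \<le> t" "t \<le> T" and y0: "norm (y 0) \<le> R0"
      and nn: "(\<integral>\<^sup>+s\<in>{0<..<t}. ennreal (L (y s) (g s)) \<partial>lborel) = ennreal r"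
      and r: "0 \<le> r" "r \<le> C" and e: "0 < e"
    have t0: "0 < t" using t assms by simp
    let ?F = "\<lambda>s. L (y s) (g s)"
    have F: "(?F has_integral r) {0..t}" by (rule W11_cost_integrable[OF W nn r(1)])
    have Fi: "?F integrable_on {a..b}" if "0 \<le> a" "b \<le> t" for a b
      by (rule integrable_subinterval_real[OF has_integral_integrable[OF F]]) (use that in auto)
    have G: "(g has_integral (y b - y a)) {a..b}" if "0 \<le> a" "a \<le> b" "b \<le> t" for a b
      by (rule W11_has_integral[OF W that])
    have growth: "A * norm (y b - y a) - B * (b - a) \<le> integral {a..b} ?F"
      if A: "0 \<le> A" "\<And>x u. A * norm u - B \<le> L x u" and ab: "0 \<le> a" "a \<le> b" "b \<le> t" for A B a b
    proof -
      have "norm (integral {a..b} (\<lambda>s. A *\<^sub>R g s)) \<le> integral {a..b} (\<lambda>s. ?F s + B)"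
      proof (rule Henstock_Kurzweil_Integration.integral_norm_bound_integral)
        show "(\<lambda>s. A *\<^sub>R g s) integrable_on {a..b}" using G[OF ab] by (intro integrable_cmul) auto
        show "(\<lambda>s. ?F s + B) integrable_on {a..b}" using Fi ab by (intro integrable_add) auto
        show "norm (A *\<^sub>R g s) \<le> ?F s + B" for s using A(2)[of "g s" "y s"] A(1) by simp
      qed
      also have "integral {a..b} (\<lambda>s. A *\<^sub>R g s) = A *\<^sub>R (y b - y a)"
        using G[OF ab] by (simp add: integral_unique)
      also have "integral {a..b} (\<lambda>s. ?F s + B) = integral {a..b} ?F + B * (b - a)"
        using Fi ab by (subst Henstock_Kurzweil_Integration.integral_add) auto
      finally show ?thesis using A(1) by simp
    qed
    define e1 where "e1 = e / (2 * t)"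
    have e1: "0 < e1" "2 * e1 * t = e" using e t0 by (auto simp: e1_def)
    define R where "R = R0 + C + B1 * T"
    have Fle: "integral {a..b} ?F \<le> C" if "0 \<le> a" "a \<le> b" "b \<le> t" for a b
    proof -
      have "integral {a..b} ?F \<le> integral {0..t} ?F"
        by (rule integral_subset_le) (use that Fi L_nonneg in auto)
      then show ?thesis using integral_unique[OF F] r by simp
    qed
    have yR: "norm (y s) \<le> R" if "0 \<le> s" "s \<le> t" for s
    proof -
      have "norm (y s - y 0) \<le> C + B1 * s" using growth[of 1 B1 0 s] B1 Fle[of 0 s] that by simp
      moreover have "B1 * s \<le> B1 * T" using that t B1 by (intro mult_left_mono) auto
      ultimately show ?thesis using y0 norm_triangle_ineq2[of "y s" "y 0"] by (simp add: R_def)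
    qed
    obtain \<delta>1 where \<delta>1: "\<delta>1 > 0" and ret: "\<And>h N p f. 0 < h \<Longrightarrow> t0 \<le> real N * h \<Longrightarrow> real N * h \<le> T \<Longrightarrow> h * K \<le> \<delta>1 \<Longrightarrow>
       norm (p 0) \<le> R0 \<Longrightarrow> (\<forall>i<N. 0 \<le> f i) \<Longrightarrow> (\<Sum>i<N. f i) \<le> C \<Longrightarrow>
       (\<forall>A B. 0 \<le> A \<and> (\<forall>x u. A * norm u - B \<le> L x u) \<longrightarrow> (\<forall>i<N. A * norm (p (Suc i) - p i) - B * h \<le> f i)) \<Longrightarrow>
       (\<forall>i<N. norm (p (Suc i) - p i) \<le> K * h \<longrightarrow> h * (L (p i) ((p (Suc i) - p i) /\<^sub>R h) - e1) \<le> f i) \<Longrightarrow>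
       (\<exists>c. reach K (real N * h) (p 0) (p N) c \<and> c \<le> (\<Sum>i<N. f i) + 2 * e1 * (real N * h))"
      using retime[OF e1(1)] by auto
    obtain \<delta>2 where \<delta>2: "\<delta>2 > 0" and lower: "\<And>x u. norm x \<le> R \<Longrightarrow> norm u \<le> K \<Longrightarrow>
       \<exists>p. \<forall>x' v. norm (x' - x) \<le> \<delta>2 \<longrightarrow> L x u + p \<bullet> (v - u) - e1 \<le> L x' v"
      using L_affine_lower[OF e1(1), of R K] by blast
    (* The growth bound with this slope makes y oscillate by at most \<delta>2 on each short interval. *)
    define A2 where "A2 = 2 * C / \<delta>2 + 1"
    have A2: "0 < A2" "C \<le> A2 * (\<delta>2 / 2)" using assms \<delta>2 by (auto simp: A2_def field_simps add_pos_nonneg)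
    obtain B2 where B2: "B2 \<ge> 0" "\<And>x u. A2 * norm u - B2 \<le> L x u"
      using L_superlinear[of A2] by blast
    \<comment> \<open>The second condition gives \<open>h * K \<le> \<delta>1\<close> for retiming.
      The third makes \<open>B2 * h\<close> at most half of \<open>A2 * \<delta>2\<close>, which
      bounds the oscillation in \<open>near\<close>.\<close>
    obtain N :: nat where N: "N > 0" "t * K / \<delta>1 \<le> real N" "2 * B2 * t / (A2 * \<delta>2) \<le> real N"
    proof -
      obtain N :: nat where "max (t * K / \<delta>1) (2 * B2 * t / (A2 * \<delta>2)) < real N" using reals_Archimedean2 by blast
      then show ?thesis by (intro that[of "Suc N"]) auto
    qed
    define h where "h = t / real N"
    have h: "0 < h" "real N * h = t" using N t0 by (auto simp: h_def)
    have hK: "h * K \<le> \<delta>1" using N \<delta>1 by (simp add: h_def field_simps)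
    have hB: "B2 * h \<le> A2 * (\<delta>2 / 2)" using N \<delta>2 A2(1) by (simp add: h_def field_simps)
    define p where "p i = y (real i * h)" for i
    define f where "f i = integral {real i * h..real (Suc i) * h} ?F" for i
    have node: "0 \<le> real i * h" "real i * h \<le> real (Suc i) * h" "real (Suc i) * h \<le> t" if "i < N" for i
      using that h mult_right_mono[of "real (Suc i)" "real N" h] by (auto intro: mult_right_mono)
    have width: "real (Suc i) * h - real i * h = h" for i by (simp add: algebra_simps)
    have "(\<Sum>i<n. f i) = integral {0..real n * h} ?F" if "n \<le> N" for n
      using that
    proof (induction n)
      case (Suc n)
      then show ?case
        using Henstock_Kurzweil_Integration.integral_combine[of 0 "real n * h" "real (Suc n) * h" ?F] node[of n]
          Fi[of 0 "real (Suc n) * h"] by (simp add: f_def)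
    qed simp
    from this[of N] have sumf: "(\<Sum>i<N. f i) = r" using integral_unique[OF F] h by simp
    have "\<exists>c. reach K (real N * h) (p 0) (p N) c \<and> c \<le> (\<Sum>i<N. f i) + 2 * e1 * (real N * h)"
    proof (rule ret)
      show "\<forall>i<N. 0 \<le> f i"
        unfolding f_def using Fi node L_nonneg by (auto intro!: integral_nonneg)
      show "\<forall>A B. 0 \<le> A \<and> (\<forall>x u. A * norm u - B \<le> L x u) \<longrightarrow> (\<forall>i<N. A * norm (p (Suc i) - p i) - B * h \<le> f i)"
        using growth[OF _ _ node] unfolding p_def f_def width by blast
      show "\<forall>i<N. norm (p (Suc i) - p i) \<le> K * h \<longrightarrow> h * (L (p i) ((p (Suc i) - p i) /\<^sub>R h) - e1) \<le> f i"
      proof (intro allI impI)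
        fix i assume i: "i < N" and d: "norm (p (Suc i) - p i) \<le> K * h"
        let ?u = "(p (Suc i) - p i) /\<^sub>R h" and ?a = "real i * h" and ?b = "real (Suc i) * h"
        have "norm ?u \<le> K" using d h(1) by (simp add: pos_divide_le_eq flip: divide_inverse_commute)
        moreover have "norm (p i) \<le> R" using node[OF i] by (auto simp: p_def intro: yR)
        ultimately obtain q where q: "\<And>x' v. norm (x' - p i) \<le> \<delta>2 \<Longrightarrow> L (p i) ?u + q \<bullet> (v - ?u) - e1 \<le> L x' v"
          using lower by blast
        have near: "norm (y s - p i) \<le> \<delta>2" if s: "s \<in> {?a..?b}" for s
        proof -
          have s': "0 \<le> ?a" "?a \<le> s" "s \<le> t" using s node[OF i] by auto
          have "A2 * norm (y s - p i) \<le> C + B2 * (s - ?a)"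
            using growth[OF _ B2(2) s'] Fle[OF s'] A2(1) by (simp add: p_def)
          also have "B2 * (s - ?a) \<le> B2 * h" using s width[of i] B2(1) by (intro mult_left_mono) auto
          also have "C + B2 * h \<le> A2 * \<delta>2" using A2(2) hB by simp
          finally show ?thesis using A2(1) by simp
        qed
        have qg: "((\<lambda>s. q \<bullet> g s) has_integral q \<bullet> (p (Suc i) - p i)) {?a..?b}"
          using has_integral_linear[OF G[OF node[OF i]] bounded_linear_inner_right[of q]] by (simp add: p_def o_def)
        \<comment> \<open>The average of \<open>g\<close> over the interval is \<open>?u\<close>, so
          the linear part integrates to its value at \<open>?u\<close>: Jensen's inequality with an
          explicit supporting function, valid along the moving position up to
          \<open>e1\<close>.\<close>
        have "((\<lambda>s. q \<bullet> g s + (L (p i) ?u - q \<bullet> ?u - e1)) has_integral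
            (q \<bullet> (p (Suc i) - p i) + (?b - ?a) *\<^sub>R (L (p i) ?u - q \<bullet> ?u - e1))) {?a..?b}"
          using has_integral_const_real[of "L (p i) ?u - q \<bullet> ?u - e1" ?a ?b] node[OF i]
          by (intro has_integral_add qg) simp
        moreover have "q \<bullet> (p (Suc i) - p i) = h * (q \<bullet> ?u)"
          using h(1) by (simp add: inner_scaleR_right)
        ultimately have "((\<lambda>s. q \<bullet> g s + (L (p i) ?u - q \<bullet> ?u - e1)) has_integral (h * (L (p i) ?u - e1))) {?a..?b}"
          by (simp only: width real_scaleR_def right_diff_distrib) (simp add: algebra_simps)
        moreover have "(?F has_integral f i) {?a..?b}"
          unfolding f_def using Fi node[OF i] by (intro integrable_integral) auto
        ultimately show "h * (L (p i) ?u - e1) \<le> f i"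
        proof (rule has_integral_le)
          fix s assume "s \<in> {?a..?b}"
          from q[OF near[OF this], of "g s"]
          show "q \<bullet> g s + (L (p i) ?u - q \<bullet> ?u - e1) \<le> ?F s"
            unfolding inner_diff_right by linarith
        qed
      qed
    qed (use h t hK y0 sumf r in \<open>auto simp: p_def\<close>)
    then show "\<exists>c. reach K t (y 0) (y t) c \<and> c \<le> r + e"
      by (simp add: sumf h(2) e1(2) p_def)
  qed
qed

section \<open>The value function as an infimum over polygonal curves\<close>

lemma reach_polyline:
  "reach K t x z c \<Longrightarrow> \<exists>y g. polyline t y g \<and> y 0 = x \<and> y t = z \<and> ((\<lambda>s. L (y s) (g s)) has_integral c) {0..t}"
proof (induction rule: reach.induct)
  case (reach_refl x)
  show ?case
    by (rule exI[of _ "\<lambda>_. x"], rule exI[of _ "\<lambda>_. 0"])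
       (auto simp: polyline_def intro!: exI[of _ 0] exI[of _ "{}"] has_integral_refl)
next
  case (reach_step \<tau> u t x z c)
  then obtain y g where yg: "polyline t y g" and ends: "y 0 = x + \<tau> *\<^sub>R u" "y t = z"
    and cost: "((\<lambda>s. L (y s) (g s)) has_integral c) {0..t}" by blast
  from yg obtain M S where y: "continuous_on {0..t} y" and g [measurable]: "g \<in> borel_measurable borel"
    and M: "\<And>s. norm (g s) \<le> M" and S: "finite S" "\<And>s. s \<in> {0..t} - S \<Longrightarrow> (y has_vector_derivative g s) (at s)"
    unfolding polyline_def by blast
  have t: "0 \<le> t" "0 < \<tau>" using reach_step.hyps reach_time_nonneg by auto
  define Y where "Y s = (if s \<le> \<tau> then x + s *\<^sub>R u else y (s - \<tau>))" for s
  define G where "G s = (if s \<le> \<tau> then u else g (s - \<tau>))" for s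
  have "continuous_on ({0..\<tau>} \<union> {\<tau>..\<tau> + t}) Y"
    unfolding Y_def
  proof (rule continuous_on_If)
    show "continuous_on {\<tau>..\<tau> + t} (\<lambda>s. y (s - \<tau>))"
      by (rule continuous_on_compose2[OF y]) (auto intro!: continuous_intros)
  qed (auto intro!: continuous_intros simp: ends)
  moreover have "{0..\<tau>} \<union> {\<tau>..\<tau> + t} = {0..\<tau> + t}" using t by auto
  ultimately have "continuous_on {0..\<tau> + t} Y" by simp
  moreover have "G \<in> borel_measurable borel" unfolding G_def[abs_def] by measurable
  moreover have "norm (G s) \<le> max (norm u) M" for s using M[of "s - \<tau>"] by (auto simp: G_def)
  moreover have "(Y has_vector_derivative G s) (at s)" if s: "s \<in> {0..\<tau> + t} - ({\<tau>} \<union> (\<lambda>s. s + \<tau>) ` S)" for s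
  proof (cases "s < \<tau>")
    case True
    have "((\<lambda>s. x + s *\<^sub>R u) has_vector_derivative u) (at s)"
      by (auto intro!: derivative_eq_intros)
    then have "(Y has_vector_derivative u) (at s)"
      by (rule has_vector_derivative_transform_within_open[of _ _ _ "{..<\<tau>}"]) (use True in \<open>auto simp: Y_def\<close>)
    then show ?thesis using True by (simp add: G_def)
  next
    case False
    then have "\<tau> < s" using s by auto
    have "s - \<tau> \<notin> S" using s by force
    then have "(y has_vector_derivative g (s - \<tau>)) (at (s - \<tau>))" using S(2)[of "s - \<tau>"] s \<open>\<tau> < s\<close> by auto
    then have "((y \<circ> (\<lambda>s. s - \<tau>)) has_vector_derivative 1 *\<^sub>R g (s - \<tau>)) (at s)"
      by (intro vector_diff_chain_at) (auto intro!: derivative_eq_intros)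
    then have "((\<lambda>s. y (s - \<tau>)) has_vector_derivative g (s - \<tau>)) (at s)" by (simp add: o_def)
    then have "(Y has_vector_derivative g (s - \<tau>)) (at s)"
      by (rule has_vector_derivative_transform_within_open[of _ _ _ "{\<tau><..}"]) (use \<open>\<tau> < s\<close> in \<open>auto simp: Y_def\<close>)
    then show ?thesis using \<open>\<tau> < s\<close> by (simp add: G_def)
  qed
  ultimately have "polyline (\<tau> + t) Y G"
    unfolding polyline_def using S(1) by (intro conjI exI[of _ "max (norm u) M"] exI[of _ "{\<tau>} \<union> (\<lambda>s. s + \<tau>) ` S"]) auto
  moreover have "Y 0 = x" "Y (\<tau> + t) = z" using t ends by (auto simp: Y_def)
  moreover have "((\<lambda>s. L (Y s) (G s)) has_integral (seg \<tau> x u + c)) {0..\<tau> + t}"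
  proof (rule has_integral_combine[of 0 \<tau> "\<tau> + t"])
    show "((\<lambda>s. L (Y s) (G s)) has_integral seg \<tau> x u) {0..\<tau>}"
      by (rule has_integral_eq[of _ "\<lambda>s. L (x + s *\<^sub>R u) u"])
         (use seg_integrable[of x u 0 \<tau>] in \<open>auto simp: Y_def G_def seg_def\<close>)
    have "((\<lambda>s. L (y (s - \<tau>)) (g (s - \<tau>))) has_integral c) {\<tau>..\<tau> + t}"
      using has_integral_affinity'[of "\<lambda>s. L (y s) (g s)" c 0 t 1 "- \<tau>"] cost by (simp add: add.commute)
    \<comment> \<open>At the junction \<open>\<tau>\<close> itself \<open>G\<close> still has the
      velocity of the first piece; this one point is discarded.\<close>
    then show "((\<lambda>s. L (Y s) (G s)) has_integral c) {\<tau>..\<tau> + t}"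
      by (rule has_integral_spike_finite[of "{\<tau>}", rotated 2]) (auto simp: Y_def G_def)
  qed (use t in auto)
  ultimately show ?case by blast
qed

lemma reach_W11:
  assumes "reach K t x z c"
  shows "\<exists>y g. W11 0 t y g \<and> y 0 = x \<and> y t = z \<and>
    (\<integral>\<^sup>+s\<in>{0<..<t}. ennreal (L (y s) (g s)) \<partial>lborel) = ennreal c"
proof -
  from reach_polyline[OF assms] obtain y g where yg: "polyline t y g" "y 0 = x" "y t = z"
    and cost: "((\<lambda>s. L (y s) (g s)) has_integral c) {0..t}" by blast
  have W: "W11 0 t y g" by (rule polyline_W11[OF reach_time_nonneg[OF assms] yg(1)])
  let ?I = "indicat_real {0<..<t}"
  have meas: "(\<lambda>s. ?I s *\<^sub>R L (y s) (g s)) \<in> borel_measurable borel" by (rule W11_cost_measurable[OF W])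
  have "((\<lambda>s. ?I s *\<^sub>R L (y s) (g s)) has_integral c) UNIV"
    using cost by (simp only: integral_restrict_indicator)
  from nn_integral_has_integral_lborel[OF meas _ this]
  have "(\<integral>\<^sup>+s. ennreal (?I s *\<^sub>R L (y s) (g s)) \<partial>lborel) = ennreal c" using L_nonneg by simp
  moreover have "(\<integral>\<^sup>+s. ennreal (?I s *\<^sub>R L (y s) (g s)) \<partial>lborel) = (\<integral>\<^sup>+s\<in>{0<..<t}. ennreal (L (y s) (g s)) \<partial>lborel)"
    by (intro nn_integral_cong) (auto simp: indicator_def)
  ultimately show ?thesis using W yg by auto
qed

lemma value_fun_le:
  assumes "reach K t x z c"
  shows "value_fun L \<phi> (t, x) \<le> ereal c + \<phi> z"
proof -
  from reach_W11[OF assms] obtain y g where yg: "W11 0 t y g" "y 0 = x" "y t = z"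
    "(\<integral>\<^sup>+s\<in>{0<..<t}. ennreal (L (y s) (g s)) \<partial>lborel) = ennreal c" by blast
  have "value_fun L \<phi> (t, x) \<le> enn2ereal (\<integral>\<^sup>+s\<in>{0<..<t}. ennreal (L (y s) (g s)) \<partial>lborel) + \<phi> (y t)"
    unfolding value_fun_def by (auto intro!: INF_lower2[of "(y, g)"] simp: yg)
  then show ?thesis using yg reach_cost_nonneg[OF assms] by (simp add: enn2ereal_ennreal)
qed

text \<open>Near-optimal polygons stand in for minimisers throughout. The strict inequality leaves
  the gap in which the error of \<open>W11_imp_reach\<close> is hidden.\<close>

lemma value_fun_less:
  assumes "\<And>x. 0 \<le> \<phi> x" "0 \<le> t" "value_fun L \<phi> (t, x) < m"
  shows "\<exists>K z c. reach K t x z c \<and> ereal c + \<phi> z < m"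
proof -
  from assms(3) obtain y g where W: "W11 0 t y g" and y0: "y 0 = x"
    and less: "enn2ereal (\<integral>\<^sup>+s\<in>{0<..<t}. ennreal (L (y s) (g s)) \<partial>lborel) + \<phi> (y t) < m" (is "enn2ereal ?J + _ < _")
    unfolding value_fun_def by (auto simp: INF_less_iff)
  have "?J \<noteq> top" using less assms(1)[of "y t"] by (auto simp: plus_ereal.simps)
  then obtain r where r: "0 \<le> r" "?J = ennreal r" by (cases ?J) auto
  \<comment> \<open>\<open>W11_imp_reach\<close> requires a positive lower bound on the duration. At
    time 0 the trivial polygon has cost 0 and does at least as well.\<close>
  show ?thesis
  proof (cases "t = 0")
    case True
    have "ereal 0 + \<phi> (y t) \<le> enn2ereal ?J + \<phi> (y t)"
      by (intro add_mono) (simp_all add: enn2ereal_nonneg flip: zero_ereal_def)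
    then show ?thesis using less reach_refl[where K=0 and x=x] y0 True
      by (intro exI[of _ 0] exI[of _ x] exI[of _ 0]) (auto intro: le_less_trans)
  next
    case False
    then have t: "0 < t" using assms by simp
    obtain K where K: "\<And>e. 0 < e \<Longrightarrow> \<exists>c. reach K t x (y t) c \<and> c \<le> r + e"
    proof (rule W11_imp_reach[OF r(1) t, of t "norm x"])
      fix K assume K: "\<And>t' y g r' e. W11 0 t' y g \<Longrightarrow> t \<le> t' \<Longrightarrow> t' \<le> t \<Longrightarrow> norm (y 0) \<le> norm x \<Longrightarrow>
       (\<integral>\<^sup>+s\<in>{0<..<t'}. ennreal (L (y s) (g s)) \<partial>lborel) = ennreal r' \<Longrightarrow> 0 \<le> r' \<Longrightarrow> r' \<le> r \<Longrightarrow> 0 < e \<Longrightarrow>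
       \<exists>c. reach K t' (y 0) (y t') c \<and> c \<le> r' + e"
      have "norm (y 0) \<le> norm x" using y0 by simp
      from K[OF W order_refl order_refl this r(2,1) order_refl] show thesis
        unfolding y0 by (rule that)
    qed
    have less': "ereal r + \<phi> (y t) < m" using less r by (simp add: enn2ereal_ennreal)
    then obtain p where p: "\<phi> (y t) = ereal p" using assms(1)[of "y t"] by (cases "\<phi> (y t)") auto
    then obtain e where e: "0 < e" "ereal (r + p + e) < m"
    proof -
      from less' p obtain q where "ereal (r + p) < ereal q" "ereal q < m" using ereal_dense2[of "ereal (r + p)" m] by auto
      then show ?thesis by (intro that[of "q - r - p"]) auto
    qed
    from K[OF e(1)] obtain c where c: "reach K t x (y t) c" "c \<le> r + e" by blast
    have "ereal c + \<phi> (y t) \<le> ereal (r + p + e)" using c p by simp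
    then show ?thesis using c(1) e(2) by (meson le_less_trans)
  qed
qed

lemma value_fun_nonneg:
  assumes "\<And>x. 0 \<le> \<phi> x"
  shows "0 \<le> value_fun L \<phi> p"
proof (cases p)
  case (Pair t x)
  show ?thesis
    unfolding Pair value_fun_def prod.case
    by (rule INF_greatest) (clarsimp, intro add_nonneg_nonneg assms enn2ereal_nonneg)
qed

lemma value_fun_0:
  assumes "\<And>x. 0 \<le> \<phi> x"
  shows "value_fun L \<phi> (0, x) = \<phi> x"
proof (rule antisym)
  show "value_fun L \<phi> (0, x) \<le> \<phi> x" using value_fun_le[OF reach_refl[where K=0 and x=x]] by simp
  show "\<phi> x \<le> value_fun L \<phi> (0, x)"
  proof (rule ccontr)
    assume "\<not> ?thesis"
    then show False using value_fun_less[OF assms order_refl, where x=x and m="\<phi> x"] reach_time_0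
      by (force simp: not_le)
  qed
qed

section \<open>Uniform speed bounds and limits of polygons\<close>

lemma reach_bounded_speed:
  assumes "0 \<le> C" "0 < t0"
  obtains K where "0 < K"
    "\<And>t x z r K' e. reach K' t x z r \<Longrightarrow> t0 \<le> t \<Longrightarrow> t \<le> T \<Longrightarrow> norm x \<le> R0 \<Longrightarrow> r \<le> C \<Longrightarrow> 0 < e \<Longrightarrow>
       \<exists>c. reach K t x z c \<and> c \<le> r + e"
proof -
  obtain K where K: "0 < K"
    "\<And>t y g r e. W11 0 t y g \<Longrightarrow> t0 \<le> t \<Longrightarrow> t \<le> T \<Longrightarrow> norm (y 0) \<le> R0 \<Longrightarrow>
       (\<integral>\<^sup>+s\<in>{0<..<t}. ennreal (L (y s) (g s)) \<partial>lborel) = ennreal r \<Longrightarrow> 0 \<le> r \<Longrightarrow> r \<le> C \<Longrightarrow> 0 < e \<Longrightarrow>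
       \<exists>c. reach K t (y 0) (y t) c \<and> c \<le> r + e"
    using W11_imp_reach[OF assms, of T R0] by blast
  show ?thesis
  proof (rule that[OF K(1)])
    fix t x z r K' e
    assume h: "reach K' t x z r" "t0 \<le> t" "t \<le> T" "norm x \<le> R0" "r \<le> C" "0 < (e::real)"
    \<comment> \<open>Reading the polygon as a Sobolev curve and discretising it anew makes the
      resulting speed bound independent of \<open>K'\<close>.\<close>
    from reach_W11[OF h(1)] obtain y g where "W11 0 t y g" "y 0 = x" "y t = z"
      "(\<integral>\<^sup>+s\<in>{0<..<t}. ennreal (L (y s) (g s)) \<partial>lborel) = ennreal r" by blast
    with K(2)[of t y g r e] h reach_cost_nonneg[OF h(1)] show "\<exists>c. reach K t x z c \<and> c \<le> r + e" by auto
  qed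
qed

text \<open>The speeds \<open>Kn\<close> may be unbounded, so a polygon of the sequence is first
  replaced by one of the common speed \<open>K\<close>. A single term of large index, moved by
  \<open>reach_perturb\<close>, then already connects the limit points; no limit curve is
  formed.\<close>

lemma reach_limit:
  assumes reach: "\<And>n. reach (Kn n) (tn n) (xn n) (zn n) (cn n)"
    and lim: "tn \<longlonglongrightarrow> t" "xn \<longlonglongrightarrow> x" "zn \<longlonglongrightarrow> z" "cn \<longlonglongrightarrow> c"
    and t: "0 < t" and e: "0 < e"
  shows "\<exists>K c'. reach K t x z c' \<and> c' \<le> c + e"
proof -
  have c0: "0 \<le> c" by (rule LIMSEQ_le_const[OF lim(4)]) (use reach reach_cost_nonneg in blast)
  define R0 where "R0 = norm x + 1"
  obtain K where K: "0 < K"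
    "\<And>t' x z r K' e. reach K' t' x z r \<Longrightarrow> t / 2 \<le> t' \<Longrightarrow> t' \<le> 2 * t \<Longrightarrow> norm x \<le> R0 \<Longrightarrow> r \<le> c + 1 \<Longrightarrow> 0 < e \<Longrightarrow>
       \<exists>c. reach K t' x z c \<and> c \<le> r + e"
    using reach_bounded_speed[of "c + 1" "t / 2" "2 * t" R0] c0 t by auto
  define R where "R = R0 + 2 * K * t"
  \<comment> \<open>The errors inflate \<open>c\<close> to at most
    \<open>(1 + e1) * (c + 2 * e1 + e1 * (2 * t))\<close>. The cap 1 makes the quadratic terms
    linear in \<open>e1\<close>, and the denominator dominates the sum of the coefficients.\<close>
  define e1 where "e1 = min 1 (e / (8 * (t + c + 3)))"
  have e1: "0 < e1" "e1 \<le> 1" "8 * (t + c + 3) * e1 \<le> e"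
  proof -
    have D: "0 < 8 * (t + c + 3)" using t c0 by simp
    then show "0 < e1" "e1 \<le> 1" using e by (auto simp: e1_def)
    have "8 * (t + c + 3) * e1 \<le> 8 * (t + c + 3) * (e / (8 * (t + c + 3)))"
      using D by (intro mult_left_mono) (auto simp: e1_def)
    then show "8 * (t + c + 3) * e1 \<le> e" using D by simp
  qed
  obtain \<delta> where \<delta>: "\<delta> > 0" "\<And>x u x' u'. norm x \<le> R \<Longrightarrow> norm u \<le> K \<Longrightarrow> norm (x' - x) \<le> \<delta> \<Longrightarrow>
      norm (u' - u) \<le> \<delta> \<Longrightarrow> \<bar>L x' u' - L x u\<bar> \<le> e1"
    using L_unif_cont[OF e1(1)] by blast
  \<comment> \<open>The factor \<open>k n\<close> corrects the duration from \<open>tn n\<close> to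
    \<open>t\<close>; the constant drift \<open>b n\<close>, acting for time \<open>t\<close>,
    corrects the displacement to \<open>z - x\<close>.\<close>
  define b where "b n = ((z - x) - (zn n - xn n)) /\<^sub>R t" for n
  define k where "k n = t / tn n" for n
  have "b \<longlonglongrightarrow> ((z - x) - (z - x)) /\<^sub>R t" unfolding b_def by (intro tendsto_intros lim)
  then have b: "(\<lambda>n. norm (b n)) \<longlonglongrightarrow> 0" by (simp add: tendsto_norm_zero)
  have "k \<longlonglongrightarrow> t / t" unfolding k_def using t by (intro tendsto_intros lim) auto
  then have k: "k \<longlonglongrightarrow> 1" using t by simp
  have kinv: "(\<lambda>n. \<bar>inverse (k n) - 1\<bar> * K + norm (b n)) \<longlonglongrightarrow> \<bar>inverse 1 - 1\<bar> * K + 0"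
    by (intro tendsto_intros k b) simp
  have dx: "(\<lambda>n. norm (x - xn n) + t * norm (b n)) \<longlonglongrightarrow> norm (x - x) + t * 0"
    by (intro tendsto_intros lim b)
  have "\<forall>\<^sub>F n in sequentially. tn n < 2 * t \<and> t / 2 < tn n \<and> norm (xn n) < R0 \<and> cn n < c + e1 \<and>
      k n < 1 + e1 \<and> \<bar>inverse (k n) - 1\<bar> * K + norm (b n) < \<delta> \<and> norm (x - xn n) + t * norm (b n) < \<delta>"
  proof (intro eventually_conj)
    show "\<forall>\<^sub>F n in sequentially. tn n < 2 * t" by (rule order_tendstoD(2)[OF lim(1)]) (use t in simp)
    show "\<forall>\<^sub>F n in sequentially. t / 2 < tn n" by (rule order_tendstoD(1)[OF lim(1)]) (use t in simp)
    show "\<forall>\<^sub>F n in sequentially. norm (xn n) < R0"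
      by (rule order_tendstoD(2)[OF tendsto_norm[OF lim(2)]]) (simp add: R0_def)
    show "\<forall>\<^sub>F n in sequentially. cn n < c + e1" by (rule order_tendstoD(2)[OF lim(4)]) (use e1 in simp)
    show "\<forall>\<^sub>F n in sequentially. k n < 1 + e1" by (rule order_tendstoD(2)[OF k]) (use e1 in simp)
    show "\<forall>\<^sub>F n in sequentially. \<bar>inverse (k n) - 1\<bar> * K + norm (b n) < \<delta>"
      by (rule order_tendstoD(2)[OF kinv]) (use \<delta>(1) in simp)
    show "\<forall>\<^sub>F n in sequentially. norm (x - xn n) + t * norm (b n) < \<delta>"
      by (rule order_tendstoD(2)[OF dx]) (use \<delta>(1) in simp)
  qed
  then obtain n where n: "tn n < 2 * t" "t / 2 < tn n" "norm (xn n) < R0" "cn n < c + e1"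
      "k n < 1 + e1" "\<bar>inverse (k n) - 1\<bar> * K + norm (b n) < \<delta>" "norm (x - xn n) + t * norm (b n) < \<delta>"
    unfolding eventually_sequentially by blast
  obtain c1 where c1: "reach K (tn n) (xn n) (zn n) c1" "c1 \<le> cn n + e1"
    using K(2)[OF reach[of n]] n e1 by force
  have tn: "0 < tn n" using n t by simp
  have kn: "0 < k n" "k n * tn n = t" using tn t by (auto simp: k_def)
  have "\<exists>c'. reach (K + \<delta>) (k n * tn n) x (x + (zn n - xn n) + (k n * tn n) *\<^sub>R b n) c' \<and> c' \<le> k n * (c1 + e1 * tn n)"
  proof (rule reach_perturb[OF c1(1) kn(1), where R=R and \<delta>=\<delta>])
    show "L x' u' \<le> L x u + e1" if "norm x \<le> R" "norm u \<le> K" "norm (x' - x) \<le> \<delta>" "norm (u' - u) \<le> \<delta>" for x u x' u'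
      using \<delta>(2)[OF that] by simp
    show "norm (u /\<^sub>R k n + b n - u) \<le> \<delta>" if "norm u \<le> K" for u
    proof -
      have eq: "u /\<^sub>R k n + b n - u = (inverse (k n) - 1) *\<^sub>R u + b n" by (simp add: algebra_simps)
      have "norm (u /\<^sub>R k n + b n - u) \<le> \<bar>inverse (k n) - 1\<bar> * norm u + norm (b n)"
        unfolding eq by (rule order_trans[OF norm_triangle_ineq]) simp
      also have "\<bar>inverse (k n) - 1\<bar> * norm u \<le> \<bar>inverse (k n) - 1\<bar> * K"
        using that by (intro mult_left_mono) auto
      finally show ?thesis using n(6) by simp
    qed
    have "K * tn n \<le> K * (2 * t)" using n K by (intro mult_left_mono) auto
    then show "norm (xn n) + K * tn n \<le> R" using n(3) by (simp add: R_def)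
    show "norm (x - xn n) + k n * tn n * norm (b n) \<le> \<delta>" using n(7) kn by simp
  qed
  moreover have "x + (zn n - xn n) + t *\<^sub>R b n = z" using t by (simp add: b_def)
  ultimately obtain c' where c': "reach (K + \<delta>) t x z c'" "c' \<le> k n * (c1 + e1 * tn n)"
    using kn(2) by auto
  have nn: "0 \<le> c1 + e1 * tn n" using reach_cost_nonneg[OF c1(1)] e1 tn by simp
  have bound: "c1 + e1 * tn n \<le> c + 2 * e1 + e1 * (2 * t)"
  proof -
    have "e1 * tn n \<le> e1 * (2 * t)" using n(1) e1 by (intro mult_left_mono) auto
    then show ?thesis using c1(2) n(4) by linarith
  qed
  have "k n * (c1 + e1 * tn n) \<le> (1 + e1) * (c1 + e1 * tn n)"
    using n(5) nn by (intro mult_right_mono) auto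
  also have "\<dots> \<le> (1 + e1) * (c + 2 * e1 + e1 * (2 * t))"
    using bound e1 by (intro mult_left_mono) auto
  also have "\<dots> = c + e1 * (2 + 2 * t + c) + e1 * (e1 * (2 + 2 * t))" by (simp add: algebra_simps)
  also have "\<dots> \<le> c + e1 * (2 + 2 * t + c) + e1 * (1 * (2 + 2 * t))"
    using e1 t by (intro add_left_mono mult_left_mono mult_right_mono) auto
  also have "\<dots> \<le> c + 8 * (t + c + 3) * e1"
  proof -
    have "e1 * (2 + 2 * t + c + (2 + 2 * t)) \<le> e1 * (8 * (t + c + 3))"
      using e1 t c0 by (intro mult_left_mono) auto
    then show ?thesis by (simp add: algebra_simps)
  qed
  also have "\<dots> \<le> c + e" using e1(3) by simp
  finally show ?thesis using c' by fastforce
qed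

text \<open>Growth of slope 1 bounds the end points by cost and duration, whatever the speeds are,
  so compactness in finite dimension applies to the pairs of end point and cost.\<close>

lemma reach_subsequence:
  assumes reach: "\<And>n. reach (Kn n) (tn n) (xn n) (zn n) (cn n)"
    and lim: "tn \<longlonglongrightarrow> t" "xn \<longlonglongrightarrow> x" and c: "\<And>n. cn n \<le> C"
  obtains r z c where "strict_mono (r :: nat \<Rightarrow> nat)" "(\<lambda>n. zn (r n)) \<longlonglongrightarrow> z" "(\<lambda>n. cn (r n)) \<longlonglongrightarrow> c"
proof -
  obtain B where B: "B \<ge> 0" "\<And>x u. 1 * norm u - B \<le> L x u" using L_superlinear[of 1] by blast
  have "Bseq tn" "Bseq xn" using lim by (auto intro: convergent_imp_Bseq convergentI)
  then obtain M1 M2 where M: "\<And>n. norm (tn n) \<le> M1" "\<And>n. norm (xn n) \<le> M2" by (auto simp: Bseq_def)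
  have "norm (zn n) \<le> M2 + C + B * M1" for n
  proof -
    have "norm (zn n - xn n) \<le> C + B * tn n" using reach_growth[OF reach[of n] B(2)] c[of n] by simp
    moreover have "B * tn n \<le> B * M1" using M(1)[of n] B by (intro mult_left_mono) auto
    ultimately show ?thesis using M(2)[of n] norm_triangle_ineq2[of "zn n" "xn n"] by simp
  qed
  then have "(zn n, cn n) \<in> cball 0 (M2 + C + B * M1) \<times> {0..C}" for n
    using reach_cost_nonneg[OF reach[of n]] c[of n] by simp
  moreover have "compact (cball (0::'a) (M2 + C + B * M1) \<times> {0..C})" by (intro compact_Times) auto
  ultimately obtain l r where "strict_mono (r :: nat \<Rightarrow> nat)" "((\<lambda>n. (zn n, cn n)) \<circ> r) \<longlonglongrightarrow> l"
    using compact_def[THEN iffD1, rule_format, of _ "\<lambda>n. (zn n, cn n)"] by metis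
  then show ?thesis
    using that[of r "fst l" "snd l"] tendsto_fst[of "(\<lambda>n. (zn n, cn n)) \<circ> r" l] tendsto_snd[of "(\<lambda>n. (zn n, cn n)) \<circ> r" l]
    by (simp add: o_def)
qed

text \<open>The limit time 0, excluded from \<open>reach_limit\<close>. If the limits differed,
  growth of slope \<open>A = (\<bar>C\<bar> + 1) / norm (z - x)\<close> would force a limiting cost
  of at least \<open>\<bar>C\<bar> + 1\<close>, since the term \<open>B * tn n\<close>
  vanishes.\<close>

lemma reach_limit_0:
  assumes reach: "\<And>n. reach (Kn n) (tn n) (xn n) (zn n) (cn n)"
    and lim: "tn \<longlonglongrightarrow> 0" "xn \<longlonglongrightarrow> x" "zn \<longlonglongrightarrow> z" and c: "\<And>n. cn n \<le> C"
  shows "z = x"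
proof (rule ccontr)
  assume "z \<noteq> x"
  define A where "A = (\<bar>C\<bar> + 1) / norm (z - x)"
  have A: "0 < A" using \<open>z \<noteq> x\<close> by (simp add: A_def)
  obtain B where B: "B \<ge> 0" "\<And>x u. A * norm u - B \<le> L x u" using L_superlinear[of A] by blast
  have "(\<lambda>n. A * norm (zn n - xn n) - B * tn n) \<longlonglongrightarrow> A * norm (z - x) - B * 0"
    by (intro tendsto_intros lim)
  then have "A * norm (z - x) - B * 0 \<le> C"
    by (rule LIMSEQ_le_const2)
      (use reach_growth[OF reach B(2)] A c in \<open>auto intro!: exI[of _ 0] intro: order_trans\<close>)
  then show False using \<open>z \<noteq> x\<close> by (simp add: A_def)
qed

section \<open>Properties of the value function\<close>

text \<open>One inequality of the dynamic programming principle, the one behind (b).\<close>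

lemma value_fun_prepend:
  assumes \<phi>: "\<And>x. 0 \<le> \<phi> x" and "reach K s w x c" "0 \<le> t"
  shows "value_fun L \<phi> (s + t, w) \<le> ereal c + value_fun L \<phi> (t, x)"
proof (cases "value_fun L \<phi> (t, x)")
  case (real r)
  show ?thesis unfolding real
  proof (rule ereal_le_epsilon2)
    fix e :: real assume "0 < e"
    then have "value_fun L \<phi> (t, x) < ereal (r + e)" using real by simp
    from value_fun_less[OF \<phi> assms(3) this] obtain K' z c'
      where z: "reach K' t x z c'" "ereal c' + \<phi> z < ereal (r + e)" by blast
    have "reach (max K K') (s + t) w z (c + c')"
      using reach_append[OF reach_mono[OF assms(2)] reach_mono[OF z(1)], of "max K K'"] by simp
    from value_fun_le[OF this] have "value_fun L \<phi> (s + t, w) \<le> ereal c + (ereal c' + \<phi> z)"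
      by (simp add: add.assoc flip: plus_ereal.simps(1))
    also have "\<dots> \<le> ereal c + ereal (r + e)" using z(2) by (intro add_left_mono) simp
    finally show "value_fun L \<phi> (s + t, w) \<le> ereal c + ereal r + ereal e" by (simp add: add.assoc)
  qed
next
  case MInf
  then show ?thesis using value_fun_nonneg[of \<phi> "(t, x)"] \<phi> by simp
qed simp

text \<open>Running and final cost pass to the limit separately along near-optimal polygons:
  semicontinuity of \<open>\<phi>\<close> bounds the final cost by \<open>r - c\<close>, and
  \<open>reach_limit\<close> produces a polygon of running cost close to \<open>c\<close> at the
  limit point.\<close>

theorem value_fun_lsc:
  assumes \<phi>: "\<And>x. 0 \<le> \<phi> x" and lsc: "lsc_on UNIV \<phi>"
  shows "lsc_on ({0..} \<times> UNIV) (value_fun L \<phi>)"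
proof (rule lsc_onI_sequentially)
  fix p :: "real \<times> 'a" and q :: "nat \<Rightarrow> real \<times> 'a" and m
  assume p: "p \<in> {0..} \<times> UNIV" and q: "\<And>n. q n \<in> {0..} \<times> UNIV" "q \<longlonglongrightarrow> p"
    and le: "\<And>n. value_fun L \<phi> (q n) \<le> m"
  obtain t x where tx: "p = (t, x)" "0 \<le> t" using p by auto
  define tn xn where "tn n = fst (q n)" and "xn n = snd (q n)" for n
  have qn: "q n = (tn n, xn n)" "0 \<le> tn n" for n using q(1)[of n] by (auto simp: tn_def xn_def)
  have lim: "tn \<longlonglongrightarrow> t" "xn \<longlonglongrightarrow> x"
    using tendsto_fst[OF q(2)] tendsto_snd[OF q(2)] by (simp_all add: tn_def[abs_def] xn_def[abs_def] tx)
  show "value_fun L \<phi> p \<le> m"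
  proof (cases m)
    case (real r)
    have "\<exists>K z c. reach K (tn n) (xn n) z c \<and> ereal c + \<phi> z < ereal (r + inverse (Suc n))" for n
    proof (rule value_fun_less[OF \<phi> qn(2)])
      have "value_fun L \<phi> (tn n, xn n) \<le> ereal r" using le[of n] qn real by simp
      also have "\<dots> < ereal (r + inverse (Suc n))" by simp
      finally show "value_fun L \<phi> (tn n, xn n) < ereal (r + inverse (Suc n))" .
    qed
    then obtain Kn zn cn where R: "\<And>n. reach (Kn n) (tn n) (xn n) (zn n) (cn n)"
      and less: "\<And>n. ereal (cn n) + \<phi> (zn n) < ereal (r + inverse (Suc n))" by metis
    have \<phi>n: "\<phi> (zn n) \<le> ereal (r + inverse (Suc n) - cn n)" for n
      using less[of n] by (cases "\<phi> (zn n)") auto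
    have "cn n \<le> r + 1" for n
    proof -
      have "ereal (cn n) + 0 \<le> ereal (cn n) + \<phi> (zn n)" by (intro add_left_mono \<phi>)
      with less[of n] have "cn n < r + inverse (Suc n)" by (metis add.right_neutral le_less_trans less_ereal.simps(1))
      also have "inverse (real (Suc n)) \<le> 1" by (simp add: inverse_le_1_iff)
      finally show ?thesis by simp
    qed
    from reach_subsequence[OF R lim this] obtain s z c where s: "strict_mono (s :: nat \<Rightarrow> nat)"
      and zc: "(\<lambda>n. zn (s n)) \<longlonglongrightarrow> z" "(\<lambda>n. cn (s n)) \<longlonglongrightarrow> c" by blast
    have lim': "(\<lambda>n. tn (s n)) \<longlonglongrightarrow> t" "(\<lambda>n. xn (s n)) \<longlonglongrightarrow> x"
      "(\<lambda>n. inverse (real (Suc (s n)))) \<longlonglongrightarrow> 0"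
      using LIMSEQ_subseq_LIMSEQ[OF lim(1) s] LIMSEQ_subseq_LIMSEQ[OF lim(2) s]
        LIMSEQ_subseq_LIMSEQ[OF LIMSEQ_inverse_real_of_nat s] by (simp_all add: o_def)
    have "(\<lambda>n. r + inverse (real (Suc (s n))) - cn (s n)) \<longlonglongrightarrow> r + 0 - c"
      by (intro tendsto_intros lim' zc)
    from lsc_on_sequentially_le[OF lsc _ _ zc(1) \<phi>n this] have \<phi>z: "\<phi> z \<le> ereal (r - c)" by simp
    have c0: "0 \<le> c" by (rule LIMSEQ_le_const[OF zc(2)]) (use R reach_cost_nonneg in blast)
    show ?thesis
    proof (cases "t = 0")
      case True
      have "z = x" by (rule reach_limit_0[OF R _ lim'(2) zc(1)]) (use lim' True \<open>\<And>n. cn n \<le> r + 1\<close> in auto)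
      then have "value_fun L \<phi> p \<le> ereal (r - c)" using \<phi>z value_fun_0[of \<phi> x] \<phi> True tx by simp
      also have "\<dots> \<le> m" using c0 real by simp
      finally show ?thesis .
    next
      case False
      show ?thesis
      proof (rule ereal_le_epsilon2)
        fix e :: real assume e: "0 < e"
        from reach_limit[OF R lim'(1,2) zc _ e] False tx obtain K c' where
          c': "reach K t x z c'" "c' \<le> c + e" by fastforce
        have "value_fun L \<phi> p \<le> ereal c' + \<phi> z" using value_fun_le[OF c'(1)] tx by simp
        also have "\<dots> \<le> ereal (c + e) + ereal (r - c)" using c' \<phi>z by (intro add_mono) auto
        finally show "value_fun L \<phi> p \<le> m + ereal e" using real by (simp add: add.commute)
      qed
    qed
  next
    case MInf
    then show ?thesis using le[of 0] value_fun_nonneg[of \<phi> "q 0"] \<phi> by simp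
  qed simp
qed

text \<open>Serves (b) with \<open>s = 1\<close> and the descent step with \<open>s = -1\<close>.
  Near the direction \<open>(s, - s *\<^sub>R u)\<close> the factor \<open>s * fst d\<close> is the
  absolute value of the time component, and \<open>- snd d /\<^sub>R fst d\<close> is the velocity,
  close to \<open>u\<close>, of the segment joining \<open>x\<close> and
  \<open>x + h *\<^sub>R snd d\<close>, traversed towards the smaller remaining time.\<close>

lemma eventually_direction:
  assumes s: "s = 1 \<or> s = -1" and e: "0 < e" and "0 < \<eta>"
  shows "\<forall>\<^sub>F (h, d) in at_right 0 \<times>\<^sub>F nhds (s, - s *\<^sub>R u).
    0 < h \<and> 1 / 2 \<le> s * fst d \<and> h * (s * fst d) \<le> \<eta> \<and>
    (\<forall>x'. norm (x' - x) \<le> h * norm (snd d) \<longrightarrow> (s * fst d) * L x' (- (snd d) /\<^sub>R fst d) \<le> L x u + e)"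
proof -
  let ?F = "at_right (0::real) \<times>\<^sub>F nhds (s, - s *\<^sub>R u)"
  have "0 < e / 2" using e by simp
  from L_unif_cont[OF this] obtain \<delta> where \<delta>: "\<delta> > 0" "\<And>x1 u1 x' u'. norm x1 \<le> norm x \<Longrightarrow> norm u1 \<le> norm u \<Longrightarrow> norm (x' - x1) \<le> \<delta> \<Longrightarrow>
      norm (u' - u1) \<le> \<delta> \<Longrightarrow> \<bar>L x' u' - L x1 u1\<bar> \<le> e / 2"
    by metis
  have h: "(fst \<longlongrightarrow> 0) ?F"
    by (rule filterlim_mono[OF filterlim_fst at_within_le_nhds order_refl])
  have d: "(snd \<longlongrightarrow> (s, - s *\<^sub>R u)) ?F" using filterlim_snd .
  note lims = h tendsto_fst[OF d] tendsto_snd[OF d]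
  have s0: "s \<noteq> 0" "s * s = 1" using s by auto
  have l1: "((\<lambda>z. s * fst (snd z)) \<longlongrightarrow> s * fst (s, - s *\<^sub>R u)) ?F"
    by (intro tendsto_intros lims)
  have l2: "((\<lambda>z. fst z * (s * fst (snd z))) \<longlongrightarrow> 0 * (s * fst (s, - s *\<^sub>R u))) ?F"
    by (intro tendsto_intros lims)
  have l3: "((\<lambda>z. fst z * norm (snd (snd z))) \<longlongrightarrow> 0 * norm (snd (s, - s *\<^sub>R u))) ?F"
    by (intro tendsto_intros lims)
  have l4: "((\<lambda>z. norm (- (snd (snd z)) /\<^sub>R fst (snd z) - u)) \<longlongrightarrow> norm (- snd (s, - s *\<^sub>R u) /\<^sub>R fst (s, - s *\<^sub>R u) - u)) ?F"
    using s0 by (intro tendsto_intros lims) simp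
  have l5: "((\<lambda>z. s * fst (snd z) * (L x u + e / 2)) \<longlongrightarrow> s * fst (s, - s *\<^sub>R u) * (L x u + e / 2)) ?F"
    by (intro tendsto_intros lims)
  have "\<forall>\<^sub>F z in ?F. 0 < fst z"
    by (rule eventually_compose_filterlim[OF eventually_at_right_less filterlim_fst])
  moreover have "\<forall>\<^sub>F z in ?F. 1 / 2 < s * fst (snd z)"
    by (rule order_tendstoD(1)[OF l1]) (use s0 in simp)
  moreover have "\<forall>\<^sub>F z in ?F. fst z * (s * fst (snd z)) < \<eta>"
    by (rule order_tendstoD(2)[OF l2]) (use assms in simp)
  moreover have "\<forall>\<^sub>F z in ?F. fst z * norm (snd (snd z)) < \<delta>"
    by (rule order_tendstoD(2)[OF l3]) (use \<delta> in simp)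
  moreover have "\<forall>\<^sub>F z in ?F. norm (- (snd (snd z)) /\<^sub>R fst (snd z) - u) < \<delta>"
    by (rule order_tendstoD(2)[OF l4]) (use \<delta> s0 in simp)
  moreover have "\<forall>\<^sub>F z in ?F. s * fst (snd z) * (L x u + e / 2) < L x u + e"
    by (rule order_tendstoD(2)[OF l5]) (use e s0 in simp)
  ultimately show ?thesis
  proof eventually_elim
    case (elim z)
    obtain h d where z: "z = (h, d)" by (cases z)
    have "(s * fst d) * L x' (- (snd d) /\<^sub>R fst d) \<le> L x u + e" if x': "norm (x' - x) \<le> h * norm (snd d)" for x'
    proof -
      have "\<bar>L x' (- (snd d) /\<^sub>R fst d) - L x u\<bar> \<le> e / 2"
        using elim(4,5) x' by (intro \<delta>(2)) (auto simp: z)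
      then have "L x' (- (snd d) /\<^sub>R fst d) \<le> L x u + e / 2" by (simp only: abs_le_iff) linarith
      then have "(s * fst d) * L x' (- (snd d) /\<^sub>R fst d) \<le> (s * fst d) * (L x u + e / 2)"
        using elim(2)[unfolded z snd_conv] by (intro mult_left_mono) linarith+
      also have "\<dots> \<le> L x u + e" using elim(6) by (simp add: z)
      finally show ?thesis .
    qed
    then show ?case using elim by (auto simp: z)
  qed
qed

text \<open>From \<open>x + h *\<^sub>R v\<close> return to \<open>x\<close> along a segment of
  duration \<open>h * \<alpha>\<close> and continue near-optimally. The estimate is uniform over all
  \<open>(\<alpha>, v)\<close> near the direction, as a limsup requires.\<close>

theorem value_fun_cond_b:
  assumes \<phi>: "\<And>x. 0 \<le> \<phi> x"
  shows "cond_b L (value_fun L \<phi>)"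
  unfolding cond_b_def
proof (intro allI impI, elim conjE)
  fix t x u assume t: "(0::real) \<le> t" and fin: "value_fun L \<phi> (t, x) < \<infinity>"
  let ?V = "value_fun L \<phi>"
  obtain r where r: "?V (t, x) = ereal r"
    using fin value_fun_nonneg[of \<phi> "(t, x)"] \<phi> by (cases "?V (t, x)") auto
  show "D_down ?V (t, x) (1, - u) \<le> ereal (L x u)"
  proof (rule ereal_le_epsilon2)
    fix e :: real assume e: "0 < e"
    have "\<forall>\<^sub>F (h, d) in at_right 0 \<times>\<^sub>F nhds (1, - u). (?V ((t, x) + h *\<^sub>R d) - ?V (t, x)) / ereal h \<le> ereal (L x u + e)"
      using eventually_direction[where s=1 and \<eta>=1 and u=u and x=x, OF _ e, simplified]
    proof eventually_elim
      case (elim z)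
      obtain h \<alpha> v where z: "z = (h, (\<alpha>, v))" by (metis prod.exhaust)
      let ?w = "- v /\<^sub>R \<alpha>"
      have h: "0 < h" "1 / 2 \<le> \<alpha>" and Lx: "\<And>x'. norm (x' - x) \<le> h * norm v \<Longrightarrow> \<alpha> * L x' ?w \<le> L x u + e"
        using elim by (auto simp: z)
      have "seg (h * \<alpha>) (x + h *\<^sub>R v) ?w \<le> (h * \<alpha>) * ((L x u + e) / \<alpha>)"
      proof (rule seg_le)
        fix s assume s: "0 \<le> s" "s \<le> h * \<alpha>"
        have "x + h *\<^sub>R v + s *\<^sub>R ?w - x = (h - s / \<alpha>) *\<^sub>R v" by (simp add: algebra_simps divide_inverse)
        then have "norm (x + h *\<^sub>R v + s *\<^sub>R ?w - x) \<le> h * norm v"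
          using s h by (simp add: mult_right_mono field_simps abs_if)
        from Lx[OF this] show "L (x + h *\<^sub>R v + s *\<^sub>R ?w) ?w \<le> (L x u + e) / \<alpha>"
          using h by (simp add: field_simps)
      qed (use h in simp)
      then have cost: "seg (h * \<alpha>) (x + h *\<^sub>R v) ?w \<le> h * (L x u + e)" using h by simp
      have "reach (norm ?w) (h * \<alpha>) (x + h *\<^sub>R v) x (seg (h * \<alpha>) (x + h *\<^sub>R v) ?w)"
        using h by (intro reach_seg) auto
      from value_fun_prepend[where \<phi>=\<phi>, OF \<phi> this t]
      have "?V (t + h * \<alpha>, x + h *\<^sub>R v) \<le> ereal (seg (h * \<alpha>) (x + h *\<^sub>R v) ?w + r)" by (simp add: r add.commute)
      also have "\<dots> \<le> ereal (h * (L x u + e) + r)" using cost by simp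
      finally have "?V ((t, x) + h *\<^sub>R (\<alpha>, v)) \<le> ereal (h * (L x u + e) + r)" by simp
      moreover have "0 \<le> ?V ((t, x) + h *\<^sub>R (\<alpha>, v))" by (rule value_fun_nonneg[OF \<phi>])
      ultimately show ?case
        unfolding z prod.case r using h by (cases "?V ((t, x) + h *\<^sub>R (\<alpha>, v))") (auto simp: field_simps)
    qed
    then show "D_down ?V (t, x) (1, - u) \<le> ereal (L x u) + ereal e"
      unfolding D_down_def by (intro Limsup_bounded) (simp add: case_prod_beta')
  qed
qed

text \<open>Near-optimal polygons are cut at short times \<open>h n\<close>. The uniform speed bound
  keeps the average initial velocities in a compact ball, and a limit of them is the direction
  \<open>u\<close>. An affine minorant at \<open>(x, u)\<close> bounds the initial costs through
  these averages, although the velocities themselves need not converge.\<close>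

theorem value_fun_cond_a:
  assumes \<phi>: "\<And>x. 0 \<le> \<phi> x"
  shows "cond_a L (value_fun L \<phi>)"
  unfolding cond_a_def
proof (intro allI impI, elim conjE)
  fix t x assume t: "(0::real) < t" and fin: "value_fun L \<phi> (t, x) < \<infinity>"
  let ?V = "value_fun L \<phi>"
  obtain r where r: "?V (t, x) = ereal r" "0 \<le> r"
    using fin value_fun_nonneg[of \<phi> "(t, x)"] \<phi> by (cases "?V (t, x)") auto
  obtain K where K: "0 < K"
    "\<And>t' x' z r' K' e. reach K' t' x' z r' \<Longrightarrow> t \<le> t' \<Longrightarrow> t' \<le> t \<Longrightarrow> norm x' \<le> norm x \<Longrightarrow> r' \<le> r + 1 \<Longrightarrow> 0 < e \<Longrightarrow>
       \<exists>c. reach K t' x' z c \<and> c \<le> r' + e"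
    using reach_bounded_speed[of "r + 1" t t "norm x"] t r by auto
  define h where "h n = t / real (n + 2)" for n
  have h: "0 < h n" "h n \<le> t" for n using t by (auto simp: h_def field_simps)
  have h0: "h \<longlonglongrightarrow> 0"
    unfolding h_def using LIMSEQ_ignore_initial_segment[OF lim_const_over_n[of t], of 2] by simp
  \<comment> \<open>The error has to vanish after division by \<open>h n\<close>, hence the square;
    the cap 1 keeps the costs below the bound \<open>r + 1\<close> for which \<open>K\<close> was
    chosen.\<close>
  define en where "en n = min 1 ((h n)\<^sup>2)" for n
  have en: "0 < en n" "en n \<le> 1" "en n \<le> h n * h n" for n using h[of n] by (auto simp: en_def power2_eq_square)
  have "\<exists>w c1. reach K (h n) x w c1 \<and> ?V (t - h n, w) \<le> ereal (r + 2 * (h n * h n) - c1)" for n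
  proof -
    have "?V (t, x) < ereal (r + en n)" using r en by simp
    from value_fun_less[OF \<phi> less_imp_le[OF t] this] obtain K' z c
      where z: "reach K' t x z c" "ereal c + \<phi> z < ereal (r + en n)" by blast
    have "ereal c + 0 \<le> ereal c + \<phi> z" by (intro add_left_mono \<phi>)
    with z(2) have "c < r + en n" by (metis add.right_neutral le_less_trans less_ereal.simps(1))
    then obtain c' where c': "reach K t x z c'" "c' \<le> c + en n"
      using K(2)[OF z(1), of "en n"] en[of n] by auto
    from reach_split[OF c'(1), of "h n"] h[of n] obtain w c1 c2
      where w: "reach K (h n) x w c1" "reach K (t - h n) w z c2" "c' = c1 + c2" by auto
    obtain q where q: "\<phi> z = ereal q" using z(2) \<phi>[of z] by (cases "\<phi> z") auto
    have "?V (t - h n, w) \<le> ereal (c2 + q)" using value_fun_le[OF w(2), of \<phi>] q by simp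
    also have "\<dots> \<le> ereal (r + 2 * (h n * h n) - c1)" using w(3) c'(2) z(2) q en(3)[of n] by simp
    finally show ?thesis using w(1) by blast
  qed
  then obtain w c1 where w: "\<And>n. reach K (h n) x (w n) (c1 n)"
    and Vw: "\<And>n. ?V (t - h n, w n) \<le> ereal (r + 2 * (h n * h n) - c1 n)" by metis
  define un where "un n = (w n - x) /\<^sub>R h n" for n
  have "un n \<in> cball 0 K" for n
    using reach_dist[OF w[of n]] h(1)[of n] by (simp add: un_def pos_divide_le_eq mult.commute flip: divide_inverse_commute)
  moreover have "compact (cball (0::'a) K)" by simp
  ultimately obtain u s where s: "strict_mono (s :: nat \<Rightarrow> nat)" and u: "(un \<circ> s) \<longlonglongrightarrow> u"
    using compact_def[THEN iffD1, rule_format, of "cball 0 K" un] by blast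
  have hs: "(\<lambda>n. h (s n)) \<longlonglongrightarrow> 0" using LIMSEQ_subseq_LIMSEQ[OF h0 s] by (simp add: o_def)
  have us: "(\<lambda>n. un (s n)) \<longlonglongrightarrow> u" using u by (simp add: o_def)
  \<comment> \<open>The direction \<open>u\<close> is fixed before \<open>e\<close>; only the slope
    \<open>p\<close> and the starting index \<open>N\<close> depend on \<open>e\<close>.\<close>
  have "D_up ?V (t, x) (-1, u) \<le> - ereal (L x u)"
  proof (rule ereal_le_epsilon2)
    fix e :: real assume e: "0 < e"
    obtain \<delta> where \<delta>: "\<delta> > 0" "\<And>x1 u1. norm x1 \<le> norm x \<Longrightarrow> norm u1 \<le> norm u \<Longrightarrow>
       \<exists>p. \<forall>x' v. norm (x' - x1) \<le> \<delta> \<longrightarrow> L x1 u1 + p \<bullet> (v - u1) - e \<le> L x' v"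
      using L_affine_lower[OF e] by blast
    from \<delta>(2)[of x u] obtain p where p: "\<And>x' v. norm (x' - x) \<le> \<delta> \<Longrightarrow> (L x u - p \<bullet> u - e) + p \<bullet> v \<le> L x' v"
      by (auto simp: inner_diff_right algebra_simps)
    have "(\<lambda>n. K * h (s n)) \<longlonglongrightarrow> K * 0" by (intro tendsto_intros hs)
    then have "\<forall>\<^sub>F n in sequentially. K * h (s n) < \<delta>" using \<delta>(1) by (auto dest: order_tendstoD(2))
    then obtain N where N: "\<And>n. N \<le> n \<Longrightarrow> K * h (s n) < \<delta>" by (auto simp: eventually_sequentially)
    have shift: "(\<lambda>n. f (n + N)) \<longlonglongrightarrow> l" if "f \<longlonglongrightarrow> l" for f and l :: "'c::topological_space"
      using that by (rule LIMSEQ_ignore_initial_segment)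
    have "D_up ?V (t, x) (-1, u) \<le> ereal (2 * 0 - (L x u - e) - p \<bullet> (u - u))"
    proof (rule D_up_le_sequentially)
      show "0 < h (s (n + N))" for n by (rule h)
      show "(\<lambda>n. h (s (n + N))) \<longlonglongrightarrow> 0" by (rule shift[OF hs])
      show "(\<lambda>n. (- 1, un (s (n + N)))) \<longlonglongrightarrow> (- 1, u)" by (intro tendsto_intros shift[OF us])
      show "(\<lambda>n. 2 * h (s (n + N)) - (L x u - e) - p \<bullet> (un (s (n + N)) - u)) \<longlonglongrightarrow> 2 * 0 - (L x u - e) - p \<bullet> (u - u)"
        by (intro tendsto_intros shift[OF us] shift[OF hs])
      fix n
      let ?k = "s (n + N)"
      have pt: "(t, x) + h ?k *\<^sub>R (-1, un ?k) = (t - h ?k, w ?k)" using h(1)[of ?k] by (simp add: un_def)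
      have "(L x u - p \<bullet> u - e) * h ?k + p \<bullet> (w ?k - x) \<le> c1 ?k"
        by (rule reach_affine_lower[OF w p]) (use N[of "n + N"] in auto)
      moreover have "p \<bullet> (w ?k - x) = h ?k * (p \<bullet> un ?k)" using h(1)[of ?k] by (simp add: un_def)
      ultimately have c1: "h ?k * (L x u - e + p \<bullet> (un ?k - u)) \<le> c1 ?k" by (simp add: algebra_simps inner_diff_right)
      have "?V (t - h ?k, w ?k) \<le> ereal (r + h ?k * (2 * h ?k - (L x u - e) - p \<bullet> (un ?k - u)))"
        using order_trans[OF Vw[of ?k]] c1 by (simp add: algebra_simps)
      moreover have "0 \<le> ?V (t - h ?k, w ?k)" by (rule value_fun_nonneg[OF \<phi>])
      ultimately show "(?V ((t, x) + h ?k *\<^sub>R (-1, un ?k)) - ?V (t, x)) / ereal (h ?k)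
          \<le> ereal (2 * h ?k - (L x u - e) - p \<bullet> (un ?k - u))"
        unfolding pt r using h(1)[of ?k]
        by (cases "?V (t - h ?k, w ?k)") (auto simp: pos_divide_le_eq mult.commute)
    qed
    then show "D_up ?V (t, x) (-1, u) \<le> - ereal (L x u) + ereal e" by simp
  qed
  then show "\<exists>u. D_up ?V (t, x) (-1, u) \<le> - ereal (L x u)" by blast
qed

section \<open>Comparison\<close>

text \<open>A continuation argument from the far end of the segment: lower semicontinuity puts the
  supremum of the good times into the good set, and (b) would extend the set beyond any supremum
  below \<open>\<tau>\<close>.\<close>

lemma cond_b_segment:
  assumes W: "\<And>t x. 0 \<le> t \<Longrightarrow> 0 \<le> W (t, x)" and lsc: "lsc_on ({0..} \<times> UNIV) W" and b: "cond_b L W"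
    and t: "0 \<le> t" "0 \<le> \<tau>"
  shows "W (t + \<tau>, x) \<le> W (t, x + \<tau> *\<^sub>R u) + ereal (seg \<tau> x u)"
proof (cases "W (t, x + \<tau> *\<^sub>R u)")
  case (real r)
  define z where "z = x + \<tau> *\<^sub>R u"
  define f where "f \<sigma> = W (t + \<sigma>, z - \<sigma> *\<^sub>R u)" for \<sigma>
  define C where "C \<sigma> = seg \<sigma> (z - \<sigma> *\<^sub>R u) u" for \<sigma>
  have C_add: "C (\<sigma> + h) = seg h (z - (\<sigma> + h) *\<^sub>R u) u + C \<sigma>" if "0 \<le> \<sigma>" "0 \<le> h" for \<sigma> h
  proof -
    have eq: "z - (\<sigma> + h) *\<^sub>R u + h *\<^sub>R u = z - \<sigma> *\<^sub>R u" by (simp add: algebra_simps)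
    then show ?thesis
      using seg_add[OF that(2,1), of "z - (\<sigma> + h) *\<^sub>R u" u, unfolded eq] by (simp add: C_def add.commute[of \<sigma> h])
  qed
  have f0: "f 0 = ereal r" using real by (simp add: f_def z_def)
  show ?thesis
  proof (rule ereal_le_epsilon2)
    fix e0 :: real assume "0 < e0"
    define e where "e = e0 / (\<tau> + 1)"
    have e: "0 < e" "e * \<tau> \<le> e0" using \<open>0 < e0\<close> t by (auto simp: e_def field_simps)
    \<comment> \<open>The slack grows with elapsed time. In an extension step half of
      \<open>e\<close> absorbs the gap in the difference quotient and half the variation of
      \<open>L\<close> along the step.\<close>
    define A where "A = {\<sigma>\<in>{0..\<tau>}. f \<sigma> \<le> ereal (r + C \<sigma> + e * \<sigma>)}"
    have "0 \<in> A" using f0 t by (simp add: A_def C_def seg_def)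
    have bdd: "bdd_above A" by (rule bdd_aboveI[of _ \<tau>]) (auto simp: A_def)
    define S where "S = Sup A"
    have S: "0 \<le> S" "S \<le> \<tau>"
      using \<open>0 \<in> A\<close> bdd by (auto simp: S_def A_def intro!: cSup_upper cSup_least)
    obtain \<sigma> where \<sigma>: "\<And>n. \<sigma> n \<in> A" "\<sigma> \<longlonglongrightarrow> S"
      using closure_sequential[of S A] closure_contains_Sup[OF _ bdd] \<open>0 \<in> A\<close> by (auto simp: S_def)
    have \<sigma>S: "\<sigma> n \<le> S" "0 \<le> \<sigma> n" for n using \<sigma>(1)[of n] bdd by (auto simp: S_def A_def intro!: cSup_upper)
    have "W (t + S, z - S *\<^sub>R u) \<le> ereal (r + C S + e * S)"
    proof (rule lsc_on_sequentially_le[OF lsc])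
      show "(t + S, z - S *\<^sub>R u) \<in> {0..} \<times> UNIV" using t S by simp
      show "(t + \<sigma> n, z - \<sigma> n *\<^sub>R u) \<in> {0..} \<times> UNIV" for n using t \<sigma>S by simp
      show "(\<lambda>n. (t + \<sigma> n, z - \<sigma> n *\<^sub>R u)) \<longlonglongrightarrow> (t + S, z - S *\<^sub>R u)"
        by (intro tendsto_intros \<sigma>)
      \<comment> \<open>Monotonicity of \<open>C\<close>, which comes from \<open>L \<ge> 0\<close>,
        lets the bound at \<open>S\<close> serve for every \<open>\<sigma> n\<close>, in place of
        continuity of \<open>C\<close>.\<close>
      have "C S \<ge> C (\<sigma> n)" for n
        using C_add[of "\<sigma> n" "S - \<sigma> n"] seg_nonneg[of "S - \<sigma> n" "z - S *\<^sub>R u" u] \<sigma>S[of n] by simp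
      then have "r + C (\<sigma> n) + e * \<sigma> n \<le> r + C S + e * S" for n
        using \<sigma>S[of n] e by (intro add_mono mult_left_mono) auto
      moreover have "W (t + \<sigma> n, z - \<sigma> n *\<^sub>R u) \<le> ereal (r + C (\<sigma> n) + e * \<sigma> n)" for n
        using \<sigma>(1)[of n] by (simp add: A_def f_def)
      ultimately show "W (t + \<sigma> n, z - \<sigma> n *\<^sub>R u) \<le> ereal (r + C S + e * S)" for n
        by (meson ereal_less_eq(3) order_trans)
    qed (rule tendsto_const)
    then have SA: "f S \<le> ereal (r + C S + e * S)" by (simp add: f_def)
    have "S = \<tau>"
    proof (rule ccontr)
      assume "S \<noteq> \<tau>"
      then have S\<tau>: "S < \<tau>" using S by simp
      define y where "y = z - S *\<^sub>R u"
      \<comment> \<open>Condition (b) is available only where \<open>W\<close> is finite;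
        \<open>SA\<close> gives this at the supremum.\<close>
      obtain q where q: "f S = ereal q" using SA W[of "t + S" y] t S by (cases "f S") (auto simp: f_def y_def)
      have "D_down W (t + S, y) (1, - u) \<le> ereal (L y u)"
        using b t S q unfolding cond_b_def f_def y_def by simp
      also have "\<dots> < ereal (L y u + e / 2)" using e by simp
      finally have "\<forall>\<^sub>F (h, d) in at_right 0 \<times>\<^sub>F nhds (1, - u).
          (W ((t + S, y) + h *\<^sub>R d) - W (t + S, y)) / ereal h < ereal (L y u + e / 2)"
        unfolding D_down_def using Limsup_lessD by (force simp: case_prod_beta')
      moreover have "LIM h at_right 0. (h, (1, - u)) :> at_right 0 \<times>\<^sub>F nhds (1, - u)"
        by (intro filterlim_Pair filterlim_ident tendsto_const)
      ultimately have ev1: "\<forall>\<^sub>F h in at_right 0. (W ((t + S, y) + h *\<^sub>R (1, - u)) - W (t + S, y)) / ereal h < ereal (L y u + e / 2)"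
        by (auto dest: eventually_compose_filterlim)
      have "0 < e / 2" using e by simp
      from L_unif_cont[OF this] obtain \<delta> where \<delta>: "\<delta> > 0" "\<And>x1 u1 x' u'. norm x1 \<le> norm y \<Longrightarrow> norm u1 \<le> norm u \<Longrightarrow>
          norm (x' - x1) \<le> \<delta> \<Longrightarrow> norm (u' - u1) \<le> \<delta> \<Longrightarrow> \<bar>L x' u' - L x1 u1\<bar> \<le> e / 2"
        by metis
      have "((\<lambda>h. h * norm u) \<longlongrightarrow> 0 * norm u) (at_right 0)" by (intro tendsto_intros)
      then have ev2: "\<forall>\<^sub>F h in at_right 0. h * norm u < \<delta>" using \<delta>(1) by (intro order_tendstoD(2)) auto
      have ev3: "\<forall>\<^sub>F h in at_right 0. h < \<tau> - S" using S\<tau> by (intro order_tendstoD(2)[OF tendsto_ident_at]) auto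
      have "\<forall>\<^sub>F h in at_right (0::real). S + h \<in> A \<and> 0 < h"
        using ev1 ev2 ev3 eventually_at_right_less[of 0]
      proof eventually_elim
        case (elim h)
        have "h * (L y u - e / 2) \<le> seg h (y - h *\<^sub>R u) u"
        proof (rule seg_ge)
          fix s assume s: "0 \<le> s" "s \<le> h"
          have "y - h *\<^sub>R u + s *\<^sub>R u - y = - ((h - s) *\<^sub>R u)" by (simp add: algebra_simps)
          then have "norm (y - h *\<^sub>R u + s *\<^sub>R u - y) = (h - s) * norm u" using s by (simp only: norm_minus_cancel norm_scaleR)
          also have "\<dots> \<le> h * norm u" using s by (intro mult_right_mono) auto
          finally have "\<bar>L (y - h *\<^sub>R u + s *\<^sub>R u) u - L y u\<bar> \<le> e / 2" using elim(2) \<delta>(1) by (intro \<delta>(2)) auto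
          then show "L y u - e / 2 \<le> L (y - h *\<^sub>R u + s *\<^sub>R u) u" by linarith
        qed (use elim in simp)
        moreover have yh: "y - h *\<^sub>R u = z - (S + h) *\<^sub>R u" by (simp add: y_def algebra_simps)
        ultimately have "h * (L y u - e / 2) \<le> C (S + h) - C S" using C_add[of S h] S elim(4) by simp
        then have inc: "q + h * (L y u + e / 2) \<le> r + C (S + h) + e * (S + h)"
          using SA q by (simp add: algebra_simps)
        have "f (S + h) \<le> ereal (q + h * (L y u + e / 2))"
        proof -
          have "(t + S, y) + h *\<^sub>R (1, - u) = (t + (S + h), y - h *\<^sub>R u)" by simp
          then have eq: "W ((t + S, y) + h *\<^sub>R (1, - u)) = f (S + h)" "W (t + S, y) = ereal q"
            using q by (simp_all only: yh f_def y_def[symmetric])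
          show ?thesis using elim(1,4) unfolding eq
            by (cases "f (S + h)") (auto simp: pos_divide_less_eq mult.commute)
        qed
        also have "\<dots> \<le> ereal (r + C (S + h) + e * (S + h))" using inc by simp
        finally show ?case using S elim(3,4) by (simp add: A_def)
      qed
      then obtain h where "S + h \<in> A" "0 < h" using eventually_happens'[OF trivial_limit_at_right_real] by blast
      then have "S + h \<le> S" unfolding S_def using bdd by (intro cSup_upper)
      with \<open>0 < h\<close> show False by simp
    qed
    then have "W (t + \<tau>, x) \<le> ereal (r + seg \<tau> x u + e * \<tau>)" using SA by (simp add: f_def C_def z_def)
    also have "\<dots> \<le> W (t, x + \<tau> *\<^sub>R u) + ereal (seg \<tau> x u) + ereal e0" using e(2) real by simp
    finally show "W (t + \<tau>, x) \<le> W (t, x + \<tau> *\<^sub>R u) + ereal (seg \<tau> x u) + ereal e0" .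
  qed
next
  case MInf
  then show ?thesis using W[OF t(1), of "x + \<tau> *\<^sub>R u"] by simp
qed simp

lemma cond_b_reach:
  assumes W: "\<And>t x. 0 \<le> t \<Longrightarrow> 0 \<le> W (t, x)" and lsc: "lsc_on ({0..} \<times> UNIV) W" and b: "cond_b L W"
    and "reach K s x z c" "0 \<le> t"
  shows "W (t + s, x) \<le> W (t, z) + ereal c"
  using assms(4)
proof (induction rule: reach.induct)
  case (reach_step \<tau> u s x z c)
  have "W (t + s + \<tau>, x) \<le> W (t + s, x + \<tau> *\<^sub>R u) + ereal (seg \<tau> x u)"
    using reach_step.hyps assms(5) reach_time_nonneg by (intro cond_b_segment[OF W lsc b]) auto
  also have "\<dots> \<le> W (t, z) + ereal c + ereal (seg \<tau> x u)"
    by (intro add_right_mono reach_step.IH)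
  also have "\<dots> = W (t, z) + ereal (seg \<tau> x u + c)"
    by (simp add: ac_simps flip: plus_ereal.simps(1))
  finally show ?case by (simp add: ac_simps)
qed simp

theorem cond_b_le_value_fun:
  assumes \<phi>: "\<And>x. 0 \<le> \<phi> x"
    and W: "\<And>t x. 0 \<le> t \<Longrightarrow> 0 \<le> W (t, x)" "lsc_on ({0..} \<times> UNIV) W" "cond_b L W" "\<And>x. W (0, x) = \<phi> x"
    and t: "0 \<le> t"
  shows "W (t, x) \<le> value_fun L \<phi> (t, x)"
proof (rule ccontr)
  assume "\<not> ?thesis"
  then obtain K z c where "reach K t x z c" "ereal c + \<phi> z < W (t, x)"
    using value_fun_less[where \<phi>=\<phi> and x=x and m="W (t, x)", OF \<phi> t] by (auto simp: not_le)
  with cond_b_reach[where W=W, OF W(1-3) _ order_refl] W(4) show False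
    by (metis add.commute add_0 not_le)
qed

text \<open>The bound on the liminf makes the quotient small frequently, and the estimates of
  \<open>eventually_direction\<close> hold eventually, so some nearby pair satisfies both. Its
  segment gives a descent whose defect is proportional to the actual duration
  \<open>\<tau>\<close>.\<close>

lemma cond_a_step:
  assumes a: "cond_a L W" and t: "0 < t" and W: "W (t, x) = ereal r" and e: "0 < e"
  shows "\<exists>\<tau> K z c. 0 < \<tau> \<and> \<tau> \<le> t \<and> reach K \<tau> x z c \<and> ereal c + W (t - \<tau>, z) \<le> ereal (r + e * \<tau>)"
proof -
  \<comment> \<open>The quotient and the running cost lose \<open>e1 * h\<close> each, in total
    \<open>e * h / 2\<close>, which is at most \<open>e * (h * \<beta>)\<close> because
    \<open>\<beta> \<ge> 1 / 2\<close>.\<close>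
  define e1 where "e1 = e / 4"
  have e1: "0 < e1" using e by (simp add: e1_def)
  obtain u where u: "D_up W (t, x) (-1, u) \<le> - ereal (L x u)"
    using a t W unfolding cond_a_def by fastforce
  let ?q = "\<lambda>(h, d). (W ((t, x) + h *\<^sub>R d) - W (t, x)) / ereal h"
  have "\<not> (\<forall>\<^sub>F z in at_right 0 \<times>\<^sub>F nhds (-1, u). ereal (e1 - L x u) \<le> ?q z)"
  proof
    assume "\<forall>\<^sub>F z in at_right 0 \<times>\<^sub>F nhds (-1, u). ereal (e1 - L x u) \<le> ?q z"
    then have "ereal (e1 - L x u) \<le> D_up W (t, x) (-1, u)" unfolding D_up_def by (rule Liminf_bounded)
    from order_trans[OF this u] have "ereal (e1 - L x u) \<le> - ereal (L x u)" .
    then show False using e1 by simp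
  qed
  then have "\<exists>\<^sub>F z in at_right 0 \<times>\<^sub>F nhds (-1, u). \<not> ereal (e1 - L x u) \<le> ?q z"
    by (simp add: frequently_def)
  then have "\<exists>\<^sub>F z in at_right 0 \<times>\<^sub>F nhds (-1, u). \<not> ereal (e1 - L x u) \<le> ?q z \<and> (case z of (h, d) \<Rightarrow>
    0 < h \<and> 1 / 2 \<le> -1 * fst d \<and> h * (-1 * fst d) \<le> t \<and>
    (\<forall>x'. norm (x' - x) \<le> h * norm (snd d) \<longrightarrow> (-1 * fst d) * L x' (- (snd d) /\<^sub>R fst d) \<le> L x u + e1))"
    by (rule frequently_rev_mp) (use eventually_direction[where s="-1" and \<eta>=t and u=u and x=x and e=e1] e1 t in \<open>auto elim!: eventually_mono\<close>)
  from frequently_ex[OF this] obtain z where z: "\<not> ereal (e1 - L x u) \<le> ?q z" "case z of (h, d) \<Rightarrow>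
    0 < h \<and> 1 / 2 \<le> -1 * fst d \<and> h * (-1 * fst d) \<le> t \<and>
    (\<forall>x'. norm (x' - x) \<le> h * norm (snd d) \<longrightarrow> (-1 * fst d) * L x' (- (snd d) /\<^sub>R fst d) \<le> L x u + e1)"
    by blast
  obtain h \<alpha> v where zz: "z = (h, (\<alpha>, v))" by (metis prod.exhaust)
  have h: "0 < h" "1 / 2 \<le> - \<alpha>" "h * - \<alpha> \<le> t"
    and Lx: "\<And>x'. norm (x' - x) \<le> h * norm v \<Longrightarrow> - \<alpha> * L x' (- v /\<^sub>R \<alpha>) \<le> L x u + e1"
    using z(2) by (simp_all add: zz)
  have q: "\<not> ereal (e1 - L x u) \<le> (W ((t, x) + h *\<^sub>R (\<alpha>, v)) - W (t, x)) / ereal h"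
    using z(1) by (simp add: zz)
  define \<beta> where "\<beta> = - \<alpha>"
  have \<beta>: "1 / 2 \<le> \<beta>" "h * \<beta> \<le> t" using h by (auto simp: \<beta>_def)
  let ?w = "v /\<^sub>R \<beta>"
  have w: "- v /\<^sub>R \<alpha> = ?w" by (simp add: \<beta>_def)
  have "seg (h * \<beta>) x ?w \<le> (h * \<beta>) * ((L x u + e1) / \<beta>)"
  proof (rule seg_le)
    fix s assume s: "0 \<le> s" "s \<le> h * \<beta>"
    have "x + s *\<^sub>R ?w - x = (s / \<beta>) *\<^sub>R v" by (simp add: divide_inverse)
    moreover have "\<bar>s / \<beta>\<bar> \<le> h" using s \<beta> by (simp add: pos_divide_le_eq)
    ultimately have "norm (x + s *\<^sub>R ?w - x) \<le> h * norm v" by (simp only: norm_scaleR mult_right_mono norm_ge_zero)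
    from Lx[OF this] have "\<beta> * L (x + s *\<^sub>R ?w) ?w \<le> L x u + e1" unfolding w \<beta>_def[symmetric] .
    then show "L (x + s *\<^sub>R ?w) ?w \<le> (L x u + e1) / \<beta>"
      using \<beta> by (simp only: pos_le_divide_eq mult.commute)
  qed (use h \<beta> in simp)
  then have cost: "seg (h * \<beta>) x ?w \<le> h * (L x u + e1)" using \<beta> by simp
  have pt: "(t, x) + h *\<^sub>R (\<alpha>, v) = (t - h * \<beta>, x + h *\<^sub>R v)" by (simp add: \<beta>_def)
  have W': "W (t - h * \<beta>, x + h *\<^sub>R v) \<le> ereal (r + h * (e1 - L x u))"
    using q h(1) unfolding pt W
    by (cases "W (t - h * \<beta>, x + h *\<^sub>R v)") (auto simp: field_simps not_le)
  have "ereal (seg (h * \<beta>) x ?w) + W (t - h * \<beta>, x + h *\<^sub>R v) \<le> ereal (h * (L x u + e1)) + ereal (r + h * (e1 - L x u))"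
    using cost W' by (intro add_mono) auto
  also have "\<dots> = ereal (r + 2 * e1 * h)" by (simp add: algebra_simps)
  also have "\<dots> \<le> ereal (r + e * (h * \<beta>))"
  proof -
    have "e * h * (1 / 2) \<le> e * h * \<beta>" using e h \<beta> by (intro mult_left_mono) auto
    then show ?thesis by (simp add: e1_def)
  qed
  finally have "ereal (seg (h * \<beta>) x ?w) + W (t - h * \<beta>, x + h *\<^sub>R v) \<le> ereal (r + e * (h * \<beta>))" .
  moreover have "reach (norm ?w) (h * \<beta>) x (x + h *\<^sub>R v) (seg (h * \<beta>) x ?w)"
    using h \<beta> by (intro reach_seg) auto
  ultimately show ?thesis using h \<beta>
    by (intro exI[of _ "h * \<beta>"] exI[of _ "norm ?w"] exI[of _ "x + h *\<^sub>R v"] exI[of _ "seg (h * \<beta>) x ?w"]) simp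
qed

theorem value_fun_le_cond_a:
  assumes \<phi>: "\<And>x. 0 \<le> \<phi> x"
    and W: "\<And>t x. 0 \<le> t \<Longrightarrow> 0 \<le> W (t, x)" and lsc: "lsc_on ({0..} \<times> UNIV) W" and a: "cond_a L W"
    and W0: "\<And>x. W (0, x) = \<phi> x"
    and t0: "0 \<le> t0"
  shows "value_fun L \<phi> (t0, x0) \<le> W (t0, x0)"
proof (cases "W (t0, x0)")
  case (real r)
  show ?thesis
  proof (rule ereal_le_epsilon2)
    fix e0 :: real assume "0 < e0"
    \<comment> \<open>Covers the slack \<open>e * t0\<close> accumulated down to time 0 and the
      final choice \<open>\<epsilon> = e\<close>.\<close>
    define e where "e = e0 / (t0 + 2)"
    have e: "0 < e" "e * (t0 + 1) \<le> e0" using \<open>0 < e0\<close> t0 by (auto simp: e_def field_simps)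
    \<comment> \<open>The slack \<open>e * (t0 - t)\<close> pays for the defects of
      \<open>cond_a_step\<close>. The arbitrary \<open>\<epsilon>\<close>, with \<open>K\<close> and
      \<open>c\<close> free to vary with it, absorbs the loss in \<open>reach_limit\<close> and
      makes \<open>P\<close> stable under limits.\<close>
    define P where "P t x \<longleftrightarrow> (\<forall>\<epsilon>>0. \<exists>K c. reach K (t0 - t) x0 x c \<and> ereal c + W (t, x) \<le> ereal (r + e * (t0 - t) + \<epsilon>))" for t x
    define T where "T = {t\<in>{0..t0}. \<exists>x. P t x}"
    have Pt0: "P t0 x0"
      unfolding P_def using reach_refl[of 0 x0] real by (auto intro!: exI[of _ 0])
    then have "t0 \<in> T" using t0 by (auto simp: T_def)
    have bdd: "bdd_below T" by (rule bdd_belowI[of _ 0]) (auto simp: T_def)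
    define m where "m = Inf T"
    have m: "0 \<le> m" "m \<le> t0"
      using \<open>t0 \<in> T\<close> bdd by (auto simp: m_def T_def intro!: cInf_lower cInf_greatest)
    \<comment> \<open>The infimum is attained. The case \<open>m = t0\<close> stands apart because
      \<open>reach_limit\<close> requires the positive duration \<open>t0 - m\<close>.\<close>
    have "\<exists>x. P m x"
    proof (cases "m = t0")
      case False
      then have mt: "0 < t0 - m" using m by simp
      obtain tn where tn: "\<And>n. tn n \<in> T" "tn \<longlonglongrightarrow> m"
        using closure_sequential[of m T] closure_contains_Inf[OF _ bdd] \<open>t0 \<in> T\<close> by (auto simp: m_def)
      have tn0: "0 \<le> tn n" "tn n \<le> t0" for n using tn(1)[of n] by (auto simp: T_def)
      have "\<exists>x K c. reach K (t0 - tn n) x0 x c \<and> ereal c + W (tn n, x) \<le> ereal (r + e * (t0 - tn n) + inverse (Suc n))" for n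
      proof -
        obtain x where "P (tn n) x" using tn(1)[of n] by (auto simp: T_def)
        moreover have "0 < inverse (real (Suc n))" by simp
        ultimately show ?thesis unfolding P_def by blast
      qed
      then obtain xn Kn cn where R: "\<And>n. reach (Kn n) (t0 - tn n) x0 (xn n) (cn n)"
        and le: "\<And>n. ereal (cn n) + W (tn n, xn n) \<le> ereal (r + e * (t0 - tn n) + inverse (Suc n))" by metis
      have Wn: "W (tn n, xn n) \<le> ereal (r + e * (t0 - tn n) + inverse (Suc n) - cn n)" for n
        using le[of n] by (cases "W (tn n, xn n)") auto
      have "cn n \<le> r + e * t0 + 1" for n
      proof -
        have "ereal (cn n) + 0 \<le> ereal (cn n) + W (tn n, xn n)" by (intro add_left_mono W tn0)
        from order_trans[OF this le[of n]] have "cn n \<le> r + e * (t0 - tn n) + inverse (Suc n)" by simp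
        also have "inverse (real (Suc n)) \<le> 1" by (simp add: inverse_le_1_iff)
        also have "e * (t0 - tn n) \<le> e * t0" using e tn0[of n] by (intro mult_left_mono) auto
        finally show ?thesis by simp
      qed
      moreover have tlim: "(\<lambda>n. t0 - tn n) \<longlonglongrightarrow> t0 - m" by (intro tendsto_intros tn)
      ultimately obtain s x c where s: "strict_mono (s :: nat \<Rightarrow> nat)"
        and xc: "(\<lambda>n. xn (s n)) \<longlonglongrightarrow> x" "(\<lambda>n. cn (s n)) \<longlonglongrightarrow> c"
        using reach_subsequence[of Kn "\<lambda>n. t0 - tn n" "\<lambda>_. x0" xn cn, OF R _ tendsto_const] by blast
      have lim': "(\<lambda>n. tn (s n)) \<longlonglongrightarrow> m" "(\<lambda>n. inverse (real (Suc (s n)))) \<longlonglongrightarrow> 0"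
        using LIMSEQ_subseq_LIMSEQ[OF tn(2) s] LIMSEQ_subseq_LIMSEQ[OF LIMSEQ_inverse_real_of_nat s]
        by (simp_all add: o_def)
      have Wx: "W (m, x) \<le> ereal (r + e * (t0 - m) + 0 - c)"
      proof (rule lsc_on_sequentially_le[OF lsc])
        show "(m, x) \<in> {0..} \<times> UNIV" using m by simp
        show "(tn (s n), xn (s n)) \<in> {0..} \<times> UNIV" for n using tn0 by simp
        show "(\<lambda>n. (tn (s n), xn (s n))) \<longlonglongrightarrow> (m, x)" by (intro tendsto_intros lim' xc)
        show "W (tn (s n), xn (s n)) \<le> ereal (r + e * (t0 - tn (s n)) + inverse (real (Suc (s n))) - cn (s n))" for n
          by (rule Wn)
        show "(\<lambda>n. r + e * (t0 - tn (s n)) + inverse (real (Suc (s n))) - cn (s n)) \<longlonglongrightarrow> r + e * (t0 - m) + 0 - c"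
          by (intro tendsto_intros lim' xc)
      qed
      have "P m x"
        unfolding P_def
      proof (intro allI impI)
        fix \<epsilon> :: real assume "0 < \<epsilon>"
        have "(\<lambda>n. t0 - tn (s n)) \<longlonglongrightarrow> t0 - m" by (intro tendsto_intros lim')
        from reach_limit[OF R this tendsto_const xc mt \<open>0 < \<epsilon>\<close>]
        obtain K c' where c': "reach K (t0 - m) x0 x c'" "c' \<le> c + \<epsilon>" by blast
        have "ereal c' + W (m, x) \<le> ereal (c + \<epsilon>) + ereal (r + e * (t0 - m) + 0 - c)"
          using c'(2) Wx by (intro add_mono) auto
        then show "\<exists>K c. reach K (t0 - m) x0 x c \<and> ereal c + W (m, x) \<le> ereal (r + e * (t0 - m) + \<epsilon>)"
          using c'(1) by (auto simp: add.commute)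
      qed
      then show ?thesis by blast
    qed (use Pt0 in blast)
    then obtain x where x: "P m x" by blast
    have "m = 0"
    proof (rule ccontr)
      assume "m \<noteq> 0"
      then have m0: "0 < m" using m by simp
      obtain K c where "ereal c + W (m, x) \<le> ereal (r + e * (t0 - m) + 1)"
        using x unfolding P_def by (meson zero_less_one)
      then obtain w where w: "W (m, x) = ereal w" using W[OF m(1), of x] by (cases "W (m, x)") auto
      \<comment> \<open>One more descent step from \<open>(m, x)\<close> preserves \<open>P\<close>
        and undercuts the infimum.\<close>
      from cond_a_step[OF a m0 w e(1)] obtain \<tau> K z d where \<tau>: "0 < \<tau>" "\<tau> \<le> m"
        and z: "reach K \<tau> x z d" "ereal d + W (m - \<tau>, z) \<le> ereal (w + e * \<tau>)" by blast
      have "P (m - \<tau>) z"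
        unfolding P_def
      proof (intro allI impI)
        fix \<epsilon> :: real assume "0 < \<epsilon>"
        with x obtain K' c where c: "reach K' (t0 - m) x0 x c" "ereal c + W (m, x) \<le> ereal (r + e * (t0 - m) + \<epsilon>)"
          unfolding P_def by blast
        have "reach (max K K') (t0 - m + \<tau>) x0 z (c + d)"
          by (rule reach_append[OF reach_mono[OF c(1)] reach_mono[OF z(1)]]) auto
        moreover have "ereal (c + d) + W (m - \<tau>, z) \<le> ereal (r + e * (t0 - (m - \<tau>)) + \<epsilon>)"
        proof -
          have "ereal (c + d) + W (m - \<tau>, z) = ereal c + (ereal d + W (m - \<tau>, z))"
            by (simp add: add.assoc flip: plus_ereal.simps(1))
          also have "\<dots> \<le> ereal c + ereal (w + e * \<tau>)" using z(2) by (intro add_left_mono)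
          also have "\<dots> \<le> ereal (r + e * (t0 - (m - \<tau>)) + \<epsilon>)" using c(2) w by (simp add: algebra_simps)
          finally show ?thesis .
        qed
        moreover have "t0 - m + \<tau> = t0 - (m - \<tau>)" by simp
        ultimately show "\<exists>K c. reach K (t0 - (m - \<tau>)) x0 z c \<and> ereal c + W (m - \<tau>, z) \<le> ereal (r + e * (t0 - (m - \<tau>)) + \<epsilon>)"
          by metis
      qed
      then have "m - \<tau> \<in> T" using \<tau> m by (auto simp: T_def)
      then have "m \<le> m - \<tau>" unfolding m_def using bdd by (intro cInf_lower)
      then show False using \<tau> by simp
    qed
    with x e(1) obtain K c where c: "reach K (t0 - 0) x0 x c" "ereal c + W (0, x) \<le> ereal (r + e * (t0 - 0) + e)"
      unfolding P_def by blast
    have "value_fun L \<phi> (t0, x0) \<le> ereal c + \<phi> x" using value_fun_le[of K t0 x0 x c \<phi>] c(1) by simp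
    also have "\<dots> \<le> ereal (r + e * t0 + e)" using c(2) W0 by simp
    also have "\<dots> \<le> W (t0, x0) + ereal e0" using real e(2) by (simp add: algebra_simps)
    finally show "value_fun L \<phi> (t0, x0) \<le> W (t0, x0) + ereal e0" .
  qed
next
  case MInf
  then show ?thesis using W[OF t0, of x0] by simp
qed simp

end

section \<open>The theorem\<close>

text \<open>Beyond some radius the quotient exceeds \<open>A\<close>; inside it the constant
  \<open>\<bar>A\<bar> * M\<close> absorbs the linear term. Taking \<open>M \<ge> 1\<close> keeps
  \<open>norm u\<close> positive where the quotient is multiplied out.\<close>

lemma superlinear_growth_bound:
  fixes \<Theta> :: "'a::euclidean_space \<Rightarrow> real"
  assumes nonneg: "\<And>u. 0 \<le> \<Theta> u" and super: "filterlim (\<lambda>u. \<Theta> u / norm u) at_top at_infinity"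
  shows "\<exists>B\<ge>0. \<forall>u. A * norm u - B \<le> \<Theta> u"
proof -
  have "\<forall>\<^sub>F u in at_infinity. A \<le> \<Theta> u / norm u"
    using super by (simp add: filterlim_at_top)
  then obtain R where R: "\<And>u. R \<le> norm u \<Longrightarrow> A \<le> \<Theta> u / norm u"
    by (auto simp: eventually_at_infinity)
  define M where "M = max R 1"
  have "A * norm u - \<bar>A\<bar> * M \<le> \<Theta> u" for u
  proof (cases "M \<le> norm u")
    case True
    then have "0 < norm u" "A \<le> \<Theta> u / norm u" using R[of u] by (auto simp: M_def)
    then have "A * norm u \<le> \<Theta> u" by (simp only: pos_le_divide_eq)
    moreover have "0 \<le> \<bar>A\<bar> * M" by (simp add: M_def)
    ultimately show ?thesis by linarith
  next
    case False
    have "A * norm u \<le> \<bar>A\<bar> * norm u" by (intro mult_right_mono) auto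
    also have "\<dots> \<le> \<bar>A\<bar> * M" using False by (intro mult_left_mono) auto
    finally show ?thesis using nonneg[of u] by simp
  qed
  moreover have "0 \<le> \<bar>A\<bar> * M" by (simp add: M_def)
  ultimately show ?thesis by blast
qed

theorem theorem4p1:
  fixes L :: "real ^ 'n \<Rightarrow> real ^ 'n \<Rightarrow> real"
    and \<phi> :: "real ^ 'n \<Rightarrow> ereal"
    and \<Theta> :: "real ^ 'n \<Rightarrow> real"
  assumes L_nonneg: "\<And>x u. 0 \<le> L x u"
    and L_lsc: "lsc_on UNIV (\<lambda>(x, u). L x u)"
    and L_convex: "\<And>x. convex_on UNIV (L x)"
    and Theta_nonneg: "\<And>u. 0 \<le> \<Theta> u"
    and Theta_convex: "convex_on UNIV \<Theta>"
    and Theta_superlinear: "filterlim (\<lambda>u. \<Theta> u / norm u) at_top at_infinity"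
    and L_ge_Theta: "\<And>x u. \<Theta> u \<le> L x u"
    and phi_nonneg: "\<And>x. 0 \<le> \<phi> x"
    and phi_lsc: "lsc_on UNIV \<phi>"
    and phi_proper: "\<exists>x. \<phi> x \<noteq> \<infinity>"
    and L_cont: "continuous_on UNIV (\<lambda>(x, u). L x u)"
  shows
    "(lsc_on ({0..} \<times> UNIV) (value_fun L \<phi>) \<and> cond_a L (value_fun L \<phi>) \<and> cond_b L (value_fun L \<phi>))
     \<and> (\<forall>W. nonneg_lsc_with_init \<phi> W \<longrightarrow>
          (cond_a L W \<longrightarrow> (\<forall>t\<ge>0. \<forall>x. W (t, x) \<ge> value_fun L \<phi> (t, x))) \<and>
          (cond_b L W \<longrightarrow> (\<forall>t\<ge>0. \<forall>x. W (t, x) \<le> value_fun L \<phi> (t, x))))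
     \<and> (nonneg_lsc_with_init \<phi> (value_fun L \<phi>) \<and>
        cond_a L (value_fun L \<phi>) \<and> cond_b L (value_fun L \<phi>) \<and>
        (\<forall>W. nonneg_lsc_with_init \<phi> W \<and> cond_a L W \<and> cond_b L W \<longrightarrow>
          (\<forall>t\<ge>0. \<forall>x. W (t, x) = value_fun L \<phi> (t, x))))"
proof -
  interpret superlinear_lagrangian L
  proof
    fix A :: real
    obtain B where "B \<ge> 0" "\<And>u. A * norm u - B \<le> \<Theta> u"
      using superlinear_growth_bound[of \<Theta> A] Theta_nonneg Theta_superlinear by blast
    then show "\<exists>B\<ge>0. \<forall>x u. A * norm u - B \<le> L x u"
      using L_ge_Theta by (meson order_trans)
  qed (fact L_nonneg L_convex L_cont)+
  let ?V = "value_fun L \<phi>"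
  have V: "lsc_on ({0..} \<times> UNIV) ?V" "cond_a L ?V" "cond_b L ?V"
    using value_fun_lsc[of \<phi>] value_fun_cond_a[of \<phi>] value_fun_cond_b[of \<phi>] phi_nonneg phi_lsc by auto
  have "nonneg_lsc_with_init \<phi> ?V"
    unfolding nonneg_lsc_with_init_def
    using V value_fun_nonneg[of \<phi>] value_fun_0[of \<phi>] phi_nonneg by auto
  moreover have le: "?V (t, x) \<le> W (t, x)"
    if "nonneg_lsc_with_init \<phi> W" "cond_a L W" "0 \<le> t" for W t x
    using that value_fun_le_cond_a[of \<phi> W t x] phi_nonneg by (simp add: nonneg_lsc_with_init_def)
  moreover have ge: "W (t, x) \<le> ?V (t, x)"
    if "nonneg_lsc_with_init \<phi> W" "cond_b L W" "0 \<le> t" for W t x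
    using that cond_b_le_value_fun[of \<phi> W t x] phi_nonneg by (simp add: nonneg_lsc_with_init_def)
  moreover have "W (t, x) = ?V (t, x)"
    if "nonneg_lsc_with_init \<phi> W" "cond_a L W" "cond_b L W" "0 \<le> t" for W t x
    using le[OF that(1,2,4)] ge[OF that(1,3,4)] by (rule antisym[rotated])
  ultimately show ?thesis using V by blast
qed

end
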